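(* Let $a>0$, $p\in(1,\infty)$ and $W\in\mathcal W(a,p)$, let $Q\in\mathcal Q$ be the quadratic integrand associated with $W$ by the quadratic Taylor expansion at the identity, i.e. the element $Q\in\mathcal Q$ with $$\limsup_{G\to0,\ G\neq0}\ \operatorname*{ess\,sup}_{y\in\mathbb R^n}\frac{|W(y,\mathrm{Id}+G)-Q(y,G)|}{|G|^2}=0,$$ and let $W^{(\mathrm{mc})}_{\hom}$ and $Q^{(1)}_{\hom}$ be the multi-cell homogenization of $W$ and the one-cell homogenization of $Q$, respectively. Then $$\limsup_{G\to 0,\ G\neq 0}\frac{\left|W^{(\mathrm{mc})}_{\hom}(\mathrm{Id}+G)-Q^{(1)}_{\hom}(G)\right|}{|G|^2}=0 .$$ The statement remains valid if the growth, coercivity and local Lipschitz condition $$\tfrac1a|F|^p-a\le W(y,F)\le a(1+|F|^p),\qquad |W(y,F)-W(y,G)|\le a(1+|F|^{p-1}+|G|^{p-1})|F-G|\qquad\text{for all }F,G\in\mathbb M^n\text{ and a.e. }y\in\mathbb R^n$$ is dropped, i.e. for every Carathéodory function $W:\mathbb R^n\times\mathbb M^n\to[0,\infty)$ that is $Y$-periodic in its first variable and satisfies only the following: $W(y,\mathrm{Id})=0$ for a.e. $y\in\mathbb R^n$; $W(y,F)\ge\tfrac1a\operatorname{dist}^2(F,SO(n))$ for all $F\in\mathbb M^n$ and a.e. $y\in\mathbb R^n$; and there exists $Q\in\mathcal Q$ with $\limsup_{G\to0,\,G\ne0}\operatorname*{ess\,sup}_{y\in\mathbb R^n}\frac{|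W(y,\mathrm{Id}+G)-Q(y,G)|}{|G|^2}=0$.
   Context: Let $n\ge 2$, let $\mathbb M^n$ be the space of real $n\times n$ matrices with $|F|=\sqrt{\operatorname{tr}F^{T}F}$, $SO(n)$ the set of rotations, $\mathrm{Id}$ the identity matrix, $Y:=[0,1)^n$. For $k\in\mathbb N$ a measurable function $u$ on $\mathbb R^n$ is $kY$-periodic if $u(y+z)=u(y)$ for a.e. $y\in\mathbb R^n$ and all $z\in k\mathbb Z^n$; $W^{1,p}_{\mathrm{per}}(kY;\mathbb R^n)$ is the space of $kY$-periodic functions in $W^{1,p}_{\mathrm{loc}}(\mathbb R^n;\mathbb R^n)$. $\mathcal Q$ is the set of Carathéodory functions $Q:\mathbb R^n\times\mathbb M^n\to[0,+\infty)$ that are $Y$-periodic in the first variable, non-negative and quadratic (a quadratic form) in the second variable, and bounded in the sense that for some constant $c>0$, $\operatorname{ess\,sup}_{y\in\mathbb R^n}Q(y,G)\le c|G|^2$ for all $G\in\mathbb M^n$. For $a>0$ and $p\in(1,\infty)$, $\mathcal W(a,p)$ is the class of Carathéodory functions $W:\mathbb R^n\times\mathbb M^n\to[0,\infty)$ that are $Y$-periodic in the first variable and satisfy: (W1) $\tfrac1a|F|^p-a\le W(y,F)\le a(1+|F|^p)$ and $|W(y,F)-W(y,G)|\le a(1+|F|^{p-1}+|G|^{p-1})|F-G|$ for all $F,G\in\mathbb M^n$ and a.e. $y\in\mathbb R^n$; (W2) $W(y,\mathrm{Id})=0$ for a.e. $y\in\mathbb R^n$; (W3) $W(y,F)\ge\tfrac1a\operatorname{dist}^2(F,SO(n))$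 for all $F\in\mathbb M^n$ and a.e. $y\in\mathbb R^n$; (W4) there exists $Q\in\mathcal Q$ with $\displaystyle\limsup_{G\to0,\,G\ne0}\ \operatorname*{ess\,sup}_{y\in\mathbb R^n}\frac{|W(y,\mathrm{Id}+G)-Q(y,G)|}{|G|^2}=0$. The multi-cell homogenization of $W$ is $$W^{(\mathrm{mc})}_{\hom}(F):=\inf_{k\in\mathbb N}\inf\Big\{\frac1{k^n}\int_{kY}W(y,F+\nabla\varphi(y))\,dy:\varphi\in W^{1,p}_{\mathrm{per}}(kY;\mathbb R^n)\Big\},$$ and the one-cell homogenization of $Q\in\mathcal Q$ is $$Q^{(1)}_{\hom}(G):=\inf\Big\{\int_YQ(y,G+\nabla\varphi(y))\,dy:\varphi\in W^{1,2}_{\mathrm{per}}(Y;\mathbb R^n)\Big\}.$$ *)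

theory Defs
  imports "HOL-Analysis.Analysis" "HOL-Probability.Essential_Supremum"
begin

text \<open>
  Matrices are \<^typ>\<open>real^'n^'n\<close>, with \<open>F $ i $ j\<close> in row \<open>i\<close> and column \<open>j\<close>. The library norm
  on this type is the Frobenius norm, so \<^const>\<open>infdist\<close> below is the Frobenius distance.
\<close>

lemma norm_matrix_eq_sqrt_trace:
  fixes F :: "real^'n^'n"
  shows "norm F = sqrt (trace (transpose F ** F))"
proof -
  have "trace (transpose F ** F) = (\<Sum>j\<in>UNIV. \<Sum>i\<in>UNIV. (F $ i $ j)\<^sup>2)"
    by (simp add: trace_def matrix_matrix_mult_def transpose_def power2_eq_square)
  also have "\<dots> = (\<Sum>i\<in>UNIV. \<Sum>j\<in>UNIV. (F $ i $ j)\<^sup>2)"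
    by (rule sum.swap)
  finally show ?thesis
    by (simp add: norm_vec_def L2_set_def sum_nonneg)
qed

definition SO :: "(real^'n^'n) set" where
  "SO = {R. rotation_matrix R}"

definition cell :: "nat \<Rightarrow> (real^'n) set" where
  "cell k = {y. \<forall>i. 0 \<le> y $ i \<and> y $ i < real k}"

definition cell_periodic :: "nat \<Rightarrow> (real^'n \<Rightarrow> 'b) \<Rightarrow> bool" where
  "cell_periodic k u \<longleftrightarrow>
     (\<forall>z. (\<forall>i. z $ i \<in> \<int>) \<longrightarrow> (AE y in lebesgue. u (y + real k *\<^sub>R z) = u y))"

subsection \<open>Sobolev functions\<close>

primrec Ck :: "nat \<Rightarrow> (real^'n \<Rightarrow> real) \<Rightarrow> bool" where
  "Ck 0 f \<longleftrightarrow> continuous_on UNIV f"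
| "Ck (Suc k) f \<longleftrightarrow>
     f differentiable_on UNIV \<and> (\<forall>v. Ck k (\<lambda>x. frechet_derivative f (at x) v))"

definition test_function :: "(real^'n \<Rightarrow> real) \<Rightarrow> bool" where
  "test_function \<psi> \<longleftrightarrow> (\<forall>k. Ck k \<psi>) \<and> compact (closure {x. \<psi> x \<noteq> 0})"

definition Lp_loc :: "real \<Rightarrow> (real^'n \<Rightarrow> 'b::euclidean_space) \<Rightarrow> bool" where
  "Lp_loc p f \<longleftrightarrow> f \<in> borel_measurable lebesgue \<and>
     (\<forall>K. compact K \<longrightarrow> set_integrable lebesgue K (\<lambda>y. norm (f y) powr p))"

text \<open>\<open>\<Phi> y $ i $ j\<close> is the weak partial derivative of \<open>\<phi> $ i\<close> in direction \<open>j\<close>.\<close>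

definition has_weak_gradient :: "(real^'n \<Rightarrow> real^'n) \<Rightarrow> (real^'n \<Rightarrow> real^'n^'n) \<Rightarrow> bool" where
  "has_weak_gradient \<phi> \<Phi> \<longleftrightarrow> Lp_loc 1 \<phi> \<and> Lp_loc 1 \<Phi> \<and>
     (\<forall>\<psi> i j. test_function \<psi> \<longrightarrow>
        (LINT y|lebesgue. \<phi> y $ i * frechet_derivative \<psi> (at y) (axis j 1)) =
        - (LINT y|lebesgue. \<Phi> y $ i $ j * \<psi> y))"

definition W1p_per :: "real \<Rightarrow> nat \<Rightarrow> (real^'n \<Rightarrow> real^'n) set" where
  "W1p_per p k = {\<phi>. cell_periodic k \<phi> \<and> Lp_loc p \<phi> \<and>
     (\<exists>\<Phi>. Lp_loc p \<Phi> \<and> has_weak_gradient \<phi> \<Phi>)}"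

subsection \<open>Integrands\<close>

definition periodic_caratheodory :: "(real^'n \<Rightarrow> real^'n^'n \<Rightarrow> real) \<Rightarrow> bool" where
  "periodic_caratheodory V \<longleftrightarrow>
     (\<forall>y F. 0 \<le> V y F) \<and>
     (\<forall>F. (\<lambda>y. V y F) \<in> borel_measurable lebesgue) \<and>
     (AE y in lebesgue. continuous_on UNIV (V y)) \<and>
     (\<forall>F. cell_periodic 1 (\<lambda>y. V y F))"

definition quadratic_form :: "(real^'n^'n \<Rightarrow> real) \<Rightarrow> bool" where
  "quadratic_form q \<longleftrightarrow> (\<exists>B. bilinear B \<and> (\<forall>G H. B G H = B H G) \<and> (\<forall>G. q G = B G G))"

definition quadratic_integrands :: "(real^'n \<Rightarrow> real^'n^'n \<Rightarrow> real) set" where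
  "quadratic_integrands = {Q. periodic_caratheodory Q \<and>
     (\<forall>y. quadratic_form (Q y)) \<and>
     (\<exists>c>0. \<forall>G. esssup lebesgue (\<lambda>y. ereal (Q y G)) \<le> ereal (c * (norm G)\<^sup>2))}"

text \<open>The filter \<^term>\<open>at 0\<close> excludes \<open>G = 0\<close>.\<close>

definition quadratic_expansion ::
    "(real^'n \<Rightarrow> real^'n^'n \<Rightarrow> real) \<Rightarrow> (real^'n \<Rightarrow> real^'n^'n \<Rightarrow> real) \<Rightarrow> bool" where
  "quadratic_expansion W Q \<longleftrightarrow>
     Limsup (at 0) (\<lambda>G. esssup lebesgue
       (\<lambda>y. ereal (\<bar>W y (mat 1 + G) - Q y G\<bar> / (norm G)\<^sup>2))) = 0"

definition growth_lipschitz :: "real \<Rightarrow> real \<Rightarrow> (real^'n \<Rightarrow> real^'n^'n \<Rightarrow> real) \<Rightarrow> bool" where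
  "growth_lipschitz a p W \<longleftrightarrow>
     (\<forall>F. AE y in lebesgue.
        1 / a * norm F powr p - a \<le> W y F \<and> W y F \<le> a * (1 + norm F powr p)) \<and>
     (\<forall>F G. AE y in lebesgue.
        \<bar>W y F - W y G\<bar> \<le> a * (1 + norm F powr (p - 1) + norm G powr (p - 1)) * norm (F - G))"

definition nondegenerate_at_SO :: "real \<Rightarrow> (real^'n \<Rightarrow> real^'n^'n \<Rightarrow> real) \<Rightarrow> bool" where
  "nondegenerate_at_SO a W \<longleftrightarrow>
     (\<forall>F. AE y in lebesgue. 1 / a * (infdist F SO)\<^sup>2 \<le> W y F)"

text \<open>The class without the growth, coercivity and local Lipschitz condition.\<close>

definition class_W0 :: "real \<Rightarrow> (real^'n \<Rightarrow> real^'n^'n \<Rightarrow> real) set" where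
  "class_W0 a = {W. periodic_caratheodory W \<and>
     (AE y in lebesgue. W y (mat 1) = 0) \<and>
     nondegenerate_at_SO a W \<and>
     (\<exists>Q\<in>quadratic_integrands. quadratic_expansion W Q)}"

definition class_W :: "real \<Rightarrow> real \<Rightarrow> (real^'n \<Rightarrow> real^'n^'n \<Rightarrow> real) set" where
  "class_W a p = {W \<in> class_W0 a. growth_lipschitz a p W}"

subsection \<open>Homogenization\<close>

text \<open>
  Weak gradients are unique up to null sets, so quantifying over all weak gradients \<open>\<Phi>\<close> of \<open>\<phi>\<close>
  does not enlarge the set of energies. Energies take values in \<^typ>\<open>ennreal\<close>: without upper growth
  bounds they may be infinite.
\<close>

definition cell_inf :: "real \<Rightarrow> nat \<Rightarrow> (real^'n \<Rightarrow> real^'n^'n \<Rightarrow> real) \<Rightarrow> real^'n^'n \<Rightarrow> ennreal" where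
  "cell_inf p k V F =
     Inf {(\<integral>\<^sup>+y\<in>cell k. ennreal (V y (F + \<Phi> y)) \<partial>lebesgue) / ennreal (real k ^ CARD('n)) | \<phi> \<Phi>.
       \<phi> \<in> W1p_per p k \<and> has_weak_gradient \<phi> \<Phi>}"

definition multi_cell_hom :: "real \<Rightarrow> (real^'n \<Rightarrow> real^'n^'n \<Rightarrow> real) \<Rightarrow> real^'n^'n \<Rightarrow> ennreal" where
  "multi_cell_hom p W F = (INF k\<in>{1..}. cell_inf p k W F)"

definition one_cell_hom :: "(real^'n \<Rightarrow> real^'n^'n \<Rightarrow> real) \<Rightarrow> real^'n^'n \<Rightarrow> ennreal" where
  "one_cell_hom Q G = cell_inf 2 1 Q G"

end

theory Submission
  imports Defs "HOL-Probability.Giry_Monad"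
begin

text \<open>
  Write \<open>A = G + \<nabla>\<phi>\<close> for the gradient of a periodic perturbation of an affine map. Three observations carry
  the proof.

  Periodic rigidity. The form \<open>minor_form A A\<close>, which is \<open>(tr A)\<^sup>2 - tr (A A)\<close>, is a null Lagrangian: its
  mean over a period cell depends on \<open>G\<close> only (\<open>null_lagrangian\<close>). At \<open>A = R - Id\<close> with a rotation
  \<open>R\<close> it is bounded below by a multiple of \<open>norm A\<close> squared (\<open>minor_form_rotation_ge\<close>), because it
  is nonnegative at every orthogonal matrix and vanishes there only at the identity and at reflections in a
  hyperplane. Perturbing this estimate gives, for every matrix \<open>A\<close>, a bound of \<open>norm A\<close> squared by
  the null Lagrangian plus the squared distance of \<open>Id + A\<close> to the rotations
  (\<open>norm_sq_le_minor_form_infdist\<close>). After averaging, the mean square of \<open>A\<close> over the large cell is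
  controlled by \<open>norm G\<close> squared plus the mean energy, with a constant that does not depend on the number of
  cells (\<open>periodic_rigidity\<close>). Since the energies to be compared are of order \<open>norm G\<close> squared, so is
  the mean square of \<open>A\<close>.

  Approximate correctors. A minimiser of the quadratic one-cell problem need not have a bounded gradient, hence it
  is not a suitable competitor for \<open>W\<close>, on which only an expansion at the identity is available. It is replaced by
  almost minimisers with bounded gradients: choosing one for each element of a basis and extending linearly, one
  obtains fields \<open>A\<close> with \<open>norm A \<le> L * norm G\<close> everywhere that satisfy the Euler-Lagrange equation up
  to an error \<open>\<eta> * norm G\<close> (\<open>approximate_correctors\<close>). Their energy \<open>J\<close> differs from the
  one-cell energy of \<open>Q\<close> by at most \<open>\<eta>\<^sup>2\<close> times \<open>norm G\<close> squared
  (\<open>one_cell_bounds\<close>). For small \<open>G\<close> these fields stay in the region in which the expansion of \<open>W\<close>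
  holds, which gives the upper bound for the multi-cell energy (\<open>multi_cell_upper_bound\<close>).

  Convexity. Let \<open>A\<close> be the field of an approximate corrector and let \<open>X\<close> be the gradient of an arbitrary
  competitor on a large cell. If \<open>b\<close> is the bilinear form of \<open>Q\<close>, then
  \<open>b X X \<ge> 2 * b A X - b A A\<close>, and the right-hand side is affine in \<open>X\<close>. It bounds
  \<open>W (Id + X)\<close> from below up to \<open>\<kappa> * (norm X)\<^sup>2\<close> with a small \<open>\<kappa>\<close>: for small \<open>X\<close> by
  the expansion of \<open>W\<close>, for large \<open>X\<close> because \<open>A\<close> is small and \<open>W\<close> is nonnegative. By
  rigidity the error term has a mean of order \<open>\<kappa>\<close> times \<open>norm G\<close> squared, and the Euler-Lagrange
  equation shows that the mean of \<open>2 * b A X - b A A\<close> is almost \<open>J\<close>; the equation passes from one cell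
  to many by averaging test fields over lattice translates (\<open>fold_torus\<close>). This is
  \<open>multi_cell_lower_bound\<close>.

  The analytic part provides these steps for weak gradients. Averages over random translates commute with weak
  gradients, and with three choices of the random shift they yield translations, mollifications and difference
  quotients. Difference quotients on the torus satisfy a discrete form of the null Lagrangian identity that
  follows from translation invariance alone, and mollification extends it to all square integrable gradients.
\<close>

section \<open>A quadratic form that is coercive on rotations\<close>

text \<open>
  The symmetric bilinear form whose quadratic form is twice the sum of the principal minors of size two. It is a
  combination of minors, which makes it a null Lagrangian.
\<close>

definition minor_form :: "real^'n^'n \<Rightarrow> real^'n^'n \<Rightarrow> real" where
  "minor_form X Y = trace X * trace Y - trace (X ** Y)"

lemma inner_matrix_eq_trace:
  fixes X Y :: "real^'n^'n"
  shows "X \<bullet> Y = trace (transpose X ** Y)"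
proof -
  have "trace (transpose X ** Y) = (\<Sum>j\<in>UNIV. \<Sum>i\<in>UNIV. X $ i $ j * Y $ i $ j)"
    by (simp add: trace_def matrix_matrix_mult_def transpose_def)
  also have "\<dots> = (\<Sum>i\<in>UNIV. \<Sum>j\<in>UNIV. X $ i $ j * Y $ i $ j)"
    by (rule sum.swap)
  finally show ?thesis
    by (simp add: inner_vec_def)
qed

lemma trace_transpose: "trace (transpose X) = trace (X :: real^'n^'n)"
  by (simp add: trace_def transpose_def)

lemma norm_transpose: "norm (transpose X) = norm (X :: real^'n^'n)"
  unfolding norm_matrix_eq_sqrt_trace transpose_transpose by (simp add: trace_mul_sym[of X])

lemma minor_form_commute: "minor_form X Y = minor_form Y X"
  unfolding minor_form_def by (simp add: trace_mul_sym[of X])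

lemma matrix_add_mult: "(A + B) ** C = A ** C + B ** (C :: real^'n^'m)"
  and matrix_diff_mult: "(A - B) ** C = A ** C - B ** (C :: real^'n^'m)"
  and matrix_mult_diff: "D ** (E - F) = D ** E - D ** (F :: real^'n^'m)"
  by (simp_all add: matrix_matrix_mult_def vec_eq_iff distrib_right left_diff_distrib
      right_diff_distrib sum.distrib sum_subtractf)

lemma bilinear_minor_form: "bilinear (minor_form :: real^'n^'n \<Rightarrow> _)"
proof -
  have l: "linear (\<lambda>X. minor_form X Y)" for Y :: "real^'n^'n"
  proof (rule linearI)
    fix X Z :: "real^'n^'n" and c :: real
    show "minor_form (X + Z) Y = minor_form X Y + minor_form Z Y"
      by (simp add: minor_form_def trace_add matrix_add_mult distrib_right)
    have "trace (c *\<^sub>R X) = c * trace X" for X :: "real^'n^'n"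
      by (simp add: trace_def sum_distrib_left)
    then show "minor_form (c *\<^sub>R X) Y = c *\<^sub>R minor_form X Y"
      by (simp add: minor_form_def scalar_matrix_assoc[symmetric] right_diff_distrib)
  qed
  moreover have "linear (\<lambda>Y. minor_form X Y)" for X :: "real^'n^'n"
  proof -
    have "(\<lambda>Y. minor_form X Y) = (\<lambda>Y. minor_form Y X)"
      by (intro ext minor_form_commute)
    then show ?thesis using l[of X] by (simp only:)
  qed
  ultimately show ?thesis
    by (simp add: bilinear_def)
qed

text \<open>
  The entries of \<open>transpose A ** A\<close> are the inner products of the columns of \<open>A\<close>, so this is the
  Cauchy-Schwarz inequality for pairs of columns. Equality of the norms forces equality for each pair, hence
  parallel columns.
\<close>

lemma norm_transpose_mult_le:
  fixes A :: "real^'n^'n"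
  shows "(norm (transpose A ** A))\<^sup>2 \<le> (norm A)^4"
    and "(norm (transpose A ** A))\<^sup>2 = (norm A)^4 \<Longrightarrow>
      (transpose A $ i \<bullet> transpose A $ j)\<^sup>2 = (norm (transpose A $ i))\<^sup>2 * (norm (transpose A $ j))\<^sup>2"
proof -
  let ?a = "\<lambda>i. transpose A $ i"
  have l: "(norm (transpose A ** A))\<^sup>2 = (\<Sum>i\<in>UNIV. \<Sum>j\<in>UNIV. (?a i \<bullet> ?a j)\<^sup>2)"
    unfolding power2_norm_eq_inner
    by (simp add: inner_vec_def power2_eq_square matrix_matrix_mult_def transpose_def)
  have "(norm A)\<^sup>2 = (\<Sum>i\<in>UNIV. (norm (?a i))\<^sup>2)"
    unfolding norm_transpose[of A, symmetric] power2_norm_eq_inner by (simp add: inner_vec_def)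
  then have "(norm A)^4 = (\<Sum>i\<in>UNIV. (norm (?a i))\<^sup>2) * (\<Sum>j\<in>UNIV. (norm (?a j))\<^sup>2)"
    by (metis mult_2_right numeral_Bit0 power2_eq_square power_add)
  then have r: "(norm A)^4 = (\<Sum>i\<in>UNIV. \<Sum>j\<in>UNIV. (norm (?a i))\<^sup>2 * (norm (?a j))\<^sup>2)"
    by (simp add: sum_product)
  have le: "(?a i \<bullet> ?a j)\<^sup>2 \<le> (norm (?a i))\<^sup>2 * (norm (?a j))\<^sup>2" for i j
    using Cauchy_Schwarz_ineq[of "?a i" "?a j"] by (simp add: power2_norm_eq_inner)
  show "(norm (transpose A ** A))\<^sup>2 \<le> (norm A)^4"
    unfolding l r by (intro sum_mono le)
  assume "(norm (transpose A ** A))\<^sup>2 = (norm A)^4"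
  then have "(\<Sum>i\<in>UNIV. \<Sum>j\<in>UNIV. (norm (?a i))\<^sup>2 * (norm (?a j))\<^sup>2 - (?a i \<bullet> ?a j)\<^sup>2) = 0"
    unfolding l r by (simp add: sum_subtractf)
  then have "(\<Sum>j\<in>UNIV. (norm (?a i))\<^sup>2 * (norm (?a j))\<^sup>2 - (?a i \<bullet> ?a j)\<^sup>2) = 0"
    using le by (subst (asm) sum_nonneg_eq_0_iff) (auto intro!: sum_nonneg)
  then show "(?a i \<bullet> ?a j)\<^sup>2 = (norm (?a i))\<^sup>2 * (norm (?a j))\<^sup>2"
    using le by (subst (asm) sum_nonneg_eq_0_iff) auto
qed

text \<open>
  Expanding \<open>transpose R ** R = mat 1\<close> expresses the traces of \<open>A\<close> and \<open>A ** A\<close> through norms.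
  The first formula for the form shows coercivity for small \<open>A\<close>, the second one shows that it is nonnegative.
\<close>

lemma orthogonal_minus_id:
  fixes R :: "real^'n^'n"
  assumes "orthogonal_matrix R"
  defines "A \<equiv> R - mat 1"
  shows "transpose A ** A = - (A + transpose A)"
    and "minor_form A A = (norm A)\<^sup>2 + (norm A)^4 / 4 - (norm (transpose A ** A))\<^sup>2 / 2"
    and "minor_form A A = (norm (A - transpose A))\<^sup>2 / 4 + ((norm A)^4 - (norm (transpose A ** A))\<^sup>2) / 4"
proof -
  have R: "transpose R ** R = mat 1" using assms orthogonal_matrix by blast
  have tA: "transpose A = transpose R - mat 1"
    by (simp add: A_def transpose_def mat_def vec_eq_iff)
  have "transpose A ** A = mat 1 - transpose R - R + mat 1"
    unfolding tA by (simp add: A_def matrix_mult_diff matrix_diff_mult R)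
  then show 1: "transpose A ** A = - (A + transpose A)"
    unfolding tA by (simp add: A_def)
  have n2: "(norm A)\<^sup>2 = - 2 * trace A"
  proof -
    have "(norm A)\<^sup>2 = trace (transpose A ** A)"
      by (simp add: power2_norm_eq_inner inner_matrix_eq_trace)
    also have "\<dots> = - trace (A + transpose A)"
      unfolding 1 by (simp add: trace_def sum_negf[symmetric])
    finally show ?thesis by (simp add: trace_add trace_transpose)
  qed
  have tr: "transpose A \<bullet> A = trace (A ** A)"
    by (simp add: inner_matrix_eq_trace)
  have nt: "transpose A \<bullet> transpose A = (norm A)\<^sup>2"
    using norm_transpose[of A] by (simp add: power2_norm_eq_inner[symmetric])
  have 2: "(norm (transpose A ** A))\<^sup>2 = 2 * (norm A)\<^sup>2 + 2 * trace (A ** A)"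
    unfolding 1 norm_minus_cancel power2_norm_eq_inner
    using tr nt by (simp add: inner_add inner_commute power2_norm_eq_inner)
  have 3: "(norm (A - transpose A))\<^sup>2 = 2 * (norm A)\<^sup>2 - 2 * trace (A ** A)"
    unfolding power2_norm_eq_inner
    using tr nt by (simp add: inner_diff inner_commute power2_norm_eq_inner)
  have 4: "trace A * trace A = (norm A)^4 / 4"
  proof -
    have "(norm A)^4 = ((norm A)\<^sup>2)\<^sup>2" by simp
    then show ?thesis unfolding n2 by (simp add: power2_eq_square)
  qed
  show "minor_form A A = (norm A)\<^sup>2 + (norm A)^4 / 4 - (norm (transpose A ** A))\<^sup>2 / 2"
    using 4 unfolding 2 minor_form_def by (simp add: field_simps)
  show "minor_form A A = (norm (A - transpose A))\<^sup>2 / 4 + ((norm A)^4 - (norm (transpose A ** A))\<^sup>2) / 4"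
    using 4 unfolding 2 3 minor_form_def by (simp add: field_simps)
qed

text \<open>
  In an orthonormal basis that contains \<open>v\<close> the matrix is diagonal with one entry \<open>-1\<close> and all others
  \<open>1\<close>.
\<close>

lemma det_reflection:
  fixes v :: "real^'n"
  assumes "norm v = 1"
  shows "det (mat 1 - (\<chi> i j. 2 * v $ i * v $ j)) = -1"
proof -
  let ?P = "\<chi> i j. 2 * v $ i * v $ j"
  fix k :: 'n
  obtain O' where O: "orthogonal_matrix O'" "O' *v axis k 1 = v"
    using orthogonal_matrix_exists_basis[OF assms] by metis
  have 1: "transpose O' ** O' = mat 1" using O orthogonal_matrix by blast
  have v: "v $ i = O' $ i $ k" for i
    unfolding O(2)[symmetric] by (simp add: matrix_vector_mult_basis column_def)
  have tv: "transpose O' *v v = axis k 1"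
    using O 1 by (metis matrix_vector_mul_assoc matrix_vector_mul_lid)
  have tv': "(\<Sum>m\<in>UNIV. O' $ m $ i * v $ m) = (if i = k then 1 else 0)" for i
    using arg_cong[OF tv, of "\<lambda>x. x $ i"] by (simp add: matrix_vector_mult_def transpose_def axis_def)
  have P: "transpose O' ** (?P ** O') = (\<chi> i j. if i = k \<and> j = k then 2 else 0)"
  proof -
    have "(?P ** O') $ m $ j = 2 * v $ m * (if j = k then 1 else 0)" for m j
    proof -
      have "(?P ** O') $ m $ j = 2 * v $ m * (\<Sum>l\<in>UNIV. O' $ l $ j * v $ l)"
        by (simp add: matrix_matrix_mult_def sum_distrib_left algebra_simps)
      then show ?thesis by (simp add: tv')
    qed
    then have PO: "?P ** O' = (\<chi> m j. 2 * v $ m * (if j = k then 1 else 0))"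
      unfolding vec_eq_iff vec_lambda_beta by blast
    have "(transpose O' ** (?P ** O')) $ i $ j = 2 * (if j = k then 1 else 0) * (\<Sum>m\<in>UNIV. O' $ m $ i * v $ m)" for i j
      unfolding PO by (simp add: matrix_matrix_mult_def transpose_def sum_distrib_left mult_ac)
    then show ?thesis unfolding vec_eq_iff by (simp add: tv')
  qed
  have "det (mat 1 - ?P) = det (transpose O') * det (mat 1 - ?P) * det O'"
    using 1 by (metis (no_types, lifting) det_I det_mul mult.commute mult.left_commute mult.right_neutral)
  also have "\<dots> = det (transpose O' ** ((mat 1 - ?P) ** O'))"
    by (simp add: det_mul)
  also have "transpose O' ** ((mat 1 - ?P) ** O') = mat 1 - (\<chi> i j. if i = k \<and> j = k then 2 else 0)"
    by (simp add: matrix_diff_mult matrix_mult_diff P 1)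
  also have "det \<dots> = (\<Prod>i\<in>UNIV. if i = k then -1 else 1)"
    by (subst det_diagonal, force simp: mat_def, rule prod.cong) (simp_all add: mat_def)
  also have "\<dots> = -1"
    by (simp add: prod.delta)
  finally show ?thesis .
qed

text \<open>
  If the form is not positive, both summands in the second formula of \<open>orthogonal_minus_id\<close> vanish. Then
  \<open>A\<close> is symmetric with parallel columns, that is, a multiple \<open>m\<close> of the projection onto a line,
  and \<open>A ** A = -2 *\<^sub>R A\<close> leaves \<open>m = -2\<close>. Thus \<open>R\<close> is a reflection, and its determinant is
  negative.
\<close>

lemma minor_form_rotation_pos:
  fixes R :: "real^'n^'n"
  assumes "rotation_matrix R" "R \<noteq> mat 1"
  shows "minor_form (R - mat 1) (R - mat 1) > 0"
proof (rule ccontr)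
  define A where "A = R - mat 1"
  have oR: "orthogonal_matrix R" using assms rotation_matrix_def by blast
  note id = orthogonal_minus_id[OF oR, folded A_def]
  assume "\<not> ?thesis"
  then have "minor_form A A \<le> 0" by (simp add: A_def)
  then have le: "(norm (A - transpose A))\<^sup>2 / 4 + ((norm A)^4 - (norm (transpose A ** A))\<^sup>2) / 4 \<le> 0"
    using id(3) by simp
  then have "(norm (A - transpose A))\<^sup>2 \<le> 0"
    using norm_transpose_mult_le(1)[of A] by argo
  then have sym: "transpose A = A" by simp
  have eq: "(norm (transpose A ** A))\<^sup>2 = (norm A)^4"
    using le norm_transpose_mult_le(1)[of A] zero_le_power2[of "norm (A - transpose A)"] by argo
  note cs = norm_transpose_mult_le(2)[OF eq, unfolded sym]
  have A2: "A ** A = -2 *\<^sub>R A"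
    using id(1) unfolding sym by (simp add: scaleR_2)
  have "A \<noteq> 0" using assms A_def by auto
  then obtain i where i: "A $ i \<noteq> 0" by (metis vec_eq_iff zero_index)
  define v where "v = A $ i /\<^sub>R norm (A $ i)"
  have v1: "norm v = 1" using i by (simp add: v_def)
  have "\<exists>c. A $ j = c *\<^sub>R v" for j
  proof -
    have "(norm (A $ i) * norm (A $ j))\<^sup>2 = (A $ i \<bullet> A $ j)\<^sup>2" using cs[of i j] by (simp add: power_mult_distrib)
    then have "\<bar>A $ i \<bullet> A $ j\<bar> = norm (A $ i) * norm (A $ j)"
      using real_sqrt_abs[of "A $ i \<bullet> A $ j"] real_sqrt_abs[of "norm (A $ i) * norm (A $ j)"]
      by (simp add: abs_mult)
    then have *: "norm (A $ i) *\<^sub>R A $ j = norm (A $ j) *\<^sub>R A $ i \<or> norm (A $ i) *\<^sub>R A $ j = - norm (A $ j) *\<^sub>R A $ i"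
      using norm_cauchy_schwarz_abs_eq by blast
    have v: "norm (A $ i) *\<^sub>R v = A $ i" using i by (simp add: v_def)
    from * have "norm (A $ i) *\<^sub>R A $ j = norm (A $ i) *\<^sub>R (norm (A $ j) *\<^sub>R v) \<or> norm (A $ i) *\<^sub>R A $ j = norm (A $ i) *\<^sub>R (- norm (A $ j) *\<^sub>R v)"
      unfolding scaleR_left_commute[of "norm (A $ i)"] v .
    then have "A $ j = norm (A $ j) *\<^sub>R v \<or> A $ j = - norm (A $ j) *\<^sub>R v"
      using i by (simp only: scaleR_cancel_left norm_eq_zero simp_thms)
    then show ?thesis by blast
  qed
  then obtain c where c: "A $ j = c j *\<^sub>R v" for j by metis
  have cA: "A $ j $ l = c j * v $ l" for j l by (simp add: c)
  have symA: "A $ j $ l = A $ l $ j" for j l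
    using arg_cong[OF sym, of "\<lambda>X. X $ l $ j"] by (simp add: transpose_def)
  have vv: "(\<Sum>l\<in>UNIV. v $ l * v $ l) = 1"
    using v1 by (simp add: norm_eq_1 inner_vec_def)
  define m where "m = (\<Sum>l\<in>UNIV. c l * v $ l)"
  have cj: "c j = m * v $ j" for j
  proof -
    have "c j = (\<Sum>l\<in>UNIV. A $ j $ l * v $ l)"
      using vv by (simp add: cA mult.assoc flip: sum_distrib_left)
    also have "\<dots> = (\<Sum>l\<in>UNIV. A $ l $ j * v $ l)" by (simp add: symA[of j])
    finally show ?thesis by (simp add: cA m_def sum_distrib_left mult_ac)
  qed
  have A: "A = (\<chi> j l. m * v $ j * v $ l)" by (simp add: vec_eq_iff cA cj)
  have "m * m = -2 * m"
  proof -
    obtain j where j: "v $ j \<noteq> 0" using v1 by (metis norm_zero vec_eq_iff zero_index zero_neq_one)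
    have "(A ** A) $ j $ j = m * v $ j * (m * v $ j) * (\<Sum>l\<in>UNIV. v $ l * v $ l)"
      unfolding A by (simp add: matrix_matrix_mult_def sum_distrib_left mult_ac)
    then have "m * v $ j * (m * v $ j) = -2 * (m * v $ j * v $ j)"
      using vv A2 by (simp add: A)
    then have "(m * m) * (v $ j * v $ j) = (-2 * m) * (v $ j * v $ j)" by (simp only: mult_ac)
    then show ?thesis using j by (metis mult_cancel_right mult_eq_0_iff)
  qed
  moreover have "m \<noteq> 0" using \<open>A \<noteq> 0\<close> A by (auto simp: vec_eq_iff)
  ultimately have "m = -2" by (metis mult_cancel_right)
  then have "R = mat 1 - (\<chi> i j. 2 * v $ i * v $ j)"
    using A by (simp add: A_def vec_eq_iff algebra_simps)
  then have "det R = -1" using det_reflection[OF v1] by simp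
  then show False using assms by (simp add: rotation_matrix_def)
qed

lemma compact_SO: "compact (SO :: (real^'n^'n) set)"
proof -
  have bd: "norm R = sqrt (real CARD('n))" if "orthogonal_matrix R" for R :: "real^'n^'n"
    using that by (simp add: norm_matrix_eq_sqrt_trace orthogonal_matrix trace_I)
  have "SO = {R :: real^'n^'n. transpose R ** R = mat 1 \<and> det R = 1}"
    by (auto simp: SO_def rotation_matrix_def orthogonal_matrix)
  moreover have "closed {R :: real^'n^'n. transpose R ** R = mat 1 \<and> det R = 1}"
    unfolding det_def transpose_def matrix_matrix_mult_def vec_eq_iff
    by (intro closed_Collect_conj closed_Collect_all closed_Collect_eq)
      (auto intro!: continuous_intros)
  moreover have "norm R \<le> sqrt (real CARD('n))" if "R \<in> SO" for R :: "real^'n^'n"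
    using that bd by (simp add: SO_def rotation_matrix_def)
  ultimately show ?thesis
    unfolding compact_eq_bounded_closed bounded_iff by metis
qed

lemma mat_1_in_SO: "mat 1 \<in> SO"
  by (simp add: SO_def rotation_matrix_def orthogonal_matrix_id)

lemma continuous_on_minor_form: "continuous_on S (\<lambda>A :: real^'n^'n. minor_form A A)"
  unfolding minor_form_def trace_def matrix_matrix_mult_def by (auto intro!: continuous_intros)

text \<open>
  Near the identity the quartic terms of \<open>orthogonal_minus_id\<close> are absorbed by the quadratic one. The remaining
  rotations form a compact set on which the form is positive.
\<close>

lemma minor_form_rotation_ge:
  obtains c where "c > 0" "\<And>R :: real^'n^'n. R \<in> SO \<Longrightarrow> c * (norm (R - mat 1))\<^sup>2 \<le> minor_form (R - mat 1) (R - mat 1)"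
proof -
  define K where "K = {R :: real^'n^'n. R \<in> SO \<and> norm (R - mat 1) \<ge> 1}"
  have "K = SO \<inter> {R. norm (R - mat 1) \<ge> 1}" by (auto simp: K_def)
  then have "compact K"
    by (auto intro!: compact_Int_closed compact_SO closed_Collect_le continuous_intros)
  have near: "3/4 * (norm (R - mat 1))\<^sup>2 \<le> minor_form (R - mat 1) (R - mat 1)"
    if "R \<in> SO" "R \<notin> K" for R :: "real^'n^'n"
  proof -
    let ?A = "R - mat 1"
    have "norm ?A < 1" using that by (simp add: K_def)
    then have "(norm ?A)\<^sup>2 \<le> 1" by (simp add: power_le_one)
    then have "(norm ?A)\<^sup>2 * (norm ?A)\<^sup>2 \<le> (norm ?A)\<^sup>2 * 1" by (intro mult_left_mono) auto
    then have "(norm ?A)^4 \<le> (norm ?A)\<^sup>2" by simp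
    moreover have "orthogonal_matrix R" using that by (simp add: SO_def rotation_matrix_def)
    ultimately show ?thesis
      using orthogonal_minus_id(2)[of R] norm_transpose_mult_le(1)[of ?A] by linarith
  qed
  show thesis
  proof (cases "K = {}")
    case True
    then show ?thesis using near that[of "3/4"] by auto
  next
    case False
    have co: "continuous_on K (\<lambda>R. minor_form (R - mat 1) (R - mat 1))"
      by (rule continuous_on_compose2[OF continuous_on_minor_form[of UNIV]]) (auto intro!: continuous_intros)
    obtain R0 where R0: "R0 \<in> K" "\<And>R. R \<in> K \<Longrightarrow> minor_form (R0 - mat 1) (R0 - mat 1) \<le> minor_form (R - mat 1) (R - mat 1)"
      using continuous_attains_inf[OF \<open>compact K\<close> False co] by auto
    define m where "m = minor_form (R0 - mat 1) (R0 - mat 1)"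
    have "R0 \<noteq> mat 1" "rotation_matrix R0" using R0(1) by (auto simp: K_def SO_def)
    then have m: "m > 0" using minor_form_rotation_pos[of R0] by (simp add: m_def)
    obtain B where B: "B > 0" "\<And>R. R \<in> SO \<Longrightarrow> norm (R - mat 1 :: real^'n^'n) \<le> B"
    proof -
      have "bounded ((\<lambda>R. R - mat 1) ` (SO :: (real^'n^'n) set))"
        by (intro compact_imp_bounded compact_continuous_image compact_SO continuous_intros)
      then show ?thesis using that by (auto simp: bounded_pos)
    qed
    define c where "c = min (3/4) (m / B\<^sup>2)"
    show ?thesis
    proof
      show "c > 0" using m B by (simp add: c_def)
      fix R :: "real^'n^'n" assume R: "R \<in> SO"
      show "c * (norm (R - mat 1))\<^sup>2 \<le> minor_form (R - mat 1) (R - mat 1)"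
      proof (cases "R \<in> K")
        case True
        have "c * (norm (R - mat 1))\<^sup>2 \<le> m / B\<^sup>2 * B\<^sup>2"
          using B R m by (intro mult_mono power_mono) (auto simp: c_def)
        also have "\<dots> = m" using B by simp
        also have "\<dots> \<le> minor_form (R - mat 1) (R - mat 1)" using R0(2)[OF True] by (simp add: m_def)
        finally show ?thesis .
      next
        case False
        have "c \<le> 3/4" unfolding c_def by (rule min.cobounded1)
        then have "c * (norm (R - mat 1))\<^sup>2 \<le> 3/4 * (norm (R - mat 1))\<^sup>2"
          by (intro mult_right_mono) simp_all
        then show ?thesis using near[OF R False] by linarith
      qed
    qed
  qed
qed

text \<open>
  The form is expanded around \<open>R - mat 1\<close>, where \<open>R\<close> is the rotation nearest to \<open>mat 1 + A\<close>; Young's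
  inequality absorbs the cross term.
\<close>

lemma norm_sq_le_minor_form_infdist:
  obtains C where "C > 0" "\<And>A :: real^'n^'n. (norm A)\<^sup>2 \<le> C * (minor_form A A + C * (infdist (mat 1 + A) SO)\<^sup>2)"
proof -
  obtain c where c: "c > 0" and ge: "\<And>R :: real^'n^'n. R \<in> SO \<Longrightarrow> c * (norm (R - mat 1))\<^sup>2 \<le> minor_form (R - mat 1) (R - mat 1)"
    using minor_form_rotation_ge by blast
  obtain K where K: "K > 0" "\<And>X Y :: real^'n^'n. \<bar>minor_form X Y\<bar> \<le> K * norm X * norm Y"
    using bilinear_bounded_pos[OF bilinear_minor_form] by (metis real_norm_def)
  define C where "C = max (4 / c) (c/2 + 2 * K\<^sup>2 / c + K)"
  have "(norm A)\<^sup>2 \<le> 4 / c * (minor_form A A + (c/2 + 2 * K\<^sup>2 / c + K) * (infdist (mat 1 + A) SO)\<^sup>2)" for A :: "real^'n^'n"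
  proof -
    obtain R where R: "R \<in> SO" "infdist (mat 1 + A) SO = dist (mat 1 + A) R"
      using infdist_attains_inf[OF compact_imp_closed[OF compact_SO]] mat_1_in_SO by (metis empty_iff)
    define D where "D = mat 1 + A - R"
    define X where "X = R - mat 1"
    have A: "A = X + D" by (simp add: X_def D_def)
    have d: "infdist (mat 1 + A) SO = norm D" by (simp add: R dist_norm D_def)
    have q: "minor_form A A = minor_form X X + 2 * minor_form X D + minor_form D D"
      unfolding A using minor_form_commute[of D X]
      by (simp add: bilinear_ladd[OF bilinear_minor_form] bilinear_radd[OF bilinear_minor_form])
    have "(norm A)\<^sup>2 \<le> (norm X + norm D)\<^sup>2" unfolding A by (intro power_mono norm_triangle_ineq) simp
    also have "\<dots> \<le> 2 * (norm X)\<^sup>2 + 2 * (norm D)\<^sup>2"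
      using sum_squares_bound[of "norm X" "norm D"] by (simp add: power2_sum)
    finally have 1: "(norm A)\<^sup>2 \<le> 2 * (norm X)\<^sup>2 + 2 * (norm D)\<^sup>2" .
    have 2: "2 * K * norm X * norm D \<le> c/2 * (norm X)\<^sup>2 + 2 * K\<^sup>2 / c * (norm D)\<^sup>2"
    proof -
      have "0 \<le> (c * norm X - 2 * K * norm D)\<^sup>2" by simp
      then have "4 * (c * (norm X * (K * norm D))) \<le> c\<^sup>2 * (norm X)\<^sup>2 + 4 * K\<^sup>2 * (norm D)\<^sup>2"
        by (simp add: power2_diff power_mult_distrib)
      then have "(4 * (c * (norm X * (K * norm D)))) / (2 * c) \<le> (c\<^sup>2 * (norm X)\<^sup>2 + 4 * K\<^sup>2 * (norm D)\<^sup>2) / (2 * c)"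
        using c by (intro divide_right_mono) auto
      then show ?thesis using c by (simp add: field_simps power2_eq_square)
    qed
    have "minor_form A A \<ge> c * (norm X)\<^sup>2 - 2 * K * norm X * norm D - K * (norm D)\<^sup>2"
      using ge[OF R(1)] K(2)[of X D] K(2)[of D D] unfolding q X_def[symmetric]
      by (simp add: power2_eq_square mult.assoc)
    then have "c / 4 * (norm A)\<^sup>2 \<le> minor_form A A + (c/2 + 2 * K\<^sup>2 / c + K) * (norm D)\<^sup>2"
      using 1 2 mult_left_mono[OF 1, of "c/4"] c by (simp add: algebra_simps)
    then have "4 / c * (c / 4 * (norm A)\<^sup>2) \<le> 4 / c * (minor_form A A + (c/2 + 2 * K\<^sup>2 / c + K) * (norm D)\<^sup>2)"
      using c by (intro mult_left_mono) auto
    then show ?thesis using c by (simp add: d)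
  qed
  note * = this
  show thesis
  proof
    show "C > 0" using c K by (auto simp: C_def less_max_iff_disj)
    fix A :: "real^'n^'n"
    let ?y = "minor_form A A + (c/2 + 2 * K\<^sup>2 / c + K) * (infdist (mat 1 + A) SO)\<^sup>2"
    have "0 \<le> 4 / c * ?y" using *[of A] zero_le_power2 order_trans by blast
    then have "?y \<ge> 0" using c by (simp add: zero_le_divide_iff zero_le_mult_iff)
    then have "(norm A)\<^sup>2 \<le> C * ?y"
      using *[of A] mult_right_mono[of "4/c" C ?y] by (simp add: C_def)
    also have "\<dots> \<le> C * (minor_form A A + C * (infdist (mat 1 + A) SO)\<^sup>2)"
      using \<open>C > 0\<close> by (intro mult_left_mono add_left_mono mult_right_mono) (auto simp: C_def)
    finally show "(norm A)\<^sup>2 \<le> C * (minor_form A A + C * (infdist (mat 1 + A) SO)\<^sup>2)" .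
  qed
qed

section \<open>Smooth bumps and uniqueness of weak gradients\<close>

text \<open>
  Derivatives of these functions are combinations of functions of the same kind (\<open>flat_has_derivative\<close>), hence all
  of them are smooth, also at the origin.
\<close>

definition flat :: "nat \<Rightarrow> real \<Rightarrow> real" where
  "flat m t = (if t > 0 then exp (- (1 / t)) / t ^ m else 0)"

lemma flat_tendsto_0: "(flat m \<longlongrightarrow> 0) (at 0)"
proof -
  have l: "(flat m \<longlongrightarrow> 0) (at_left 0)"
    by (rule Lim_transform_eventually[OF tendsto_const])
      (auto simp: flat_def eventually_at_left_field intro!: exI[of _ "-1"])
  have "((\<lambda>t. inverse t ^ m / exp (inverse t)) \<longlongrightarrow> 0) (at_right (0::real))"
    using filterlim_compose[OF tendsto_power_div_exp_0 filterlim_inverse_at_top_right] .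
  then have "(flat m \<longlongrightarrow> 0) (at_right 0)"
    by (rule Lim_transform_eventually)
      (auto simp: flat_def eventually_at_right_less field_simps exp_minus intro!: eventually_mono[OF eventually_at_right_less])
  with l show ?thesis by (rule filterlim_split_at)
qed

lemma flat_has_derivative:
  "(flat m has_real_derivative (flat (m + 2) t - real m * flat (m + 1) t)) (at t)"
proof -
  consider "t > 0" | "t < 0" | "t = 0" by linarith
  then show ?thesis
  proof cases
    case 1
    have d1: "((\<lambda>t. exp (- (1 / t))) has_real_derivative exp (- (1 / t)) * (inverse t)\<^sup>2) (at t)"
      using 1 by (auto intro!: derivative_eq_intros simp: power2_eq_square field_simps)
    have d2: "((\<lambda>t. inverse t ^ m) has_real_derivative - real m * inverse t ^ (m + 1)) (at t)"
    proof (cases m)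
      case (Suc k)
      have "((\<lambda>t. inverse t ^ Suc k) has_real_derivative real (Suc k) * (- (inverse t ^ Suc (Suc 0)) * inverse t ^ k)) (at t)"
        using DERIV_power_Suc[OF DERIV_inverse, of t k UNIV] 1 by (simp add: of_nat_Suc distrib_right)
      then show ?thesis by (simp add: Suc algebra_simps)
    qed simp
    have "((\<lambda>t. exp (- (1 / t)) / t ^ m) has_real_derivative (flat (m + 2) t - real m * flat (m + 1) t)) (at t)"
      using DERIV_mult[OF d1 d2] 1
      by (simp add: flat_def divide_inverse power_inverse power2_eq_square algebra_simps)
    then show ?thesis
      by (rule has_field_derivative_transform_within_open[of _ _ _ "{0<..}"]) (use 1 in \<open>auto simp: flat_def\<close>)
  next
    case 2
    have "((\<lambda>t. 0) has_real_derivative 0) (at t)" by simp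
    then have "(flat m has_real_derivative 0) (at t)"
      by (rule has_field_derivative_transform_within_open[of _ _ _ "{..<0}"]) (use 2 in \<open>auto simp: flat_def\<close>)
    then show ?thesis using 2 by (simp add: flat_def)
  next
    case 3
    have "((\<lambda>h. (flat m (0 + h) - flat m 0) / h) \<longlongrightarrow> 0) (at 0)"
      by (rule Lim_transform_eventually[OF flat_tendsto_0[of "m+1"]])
        (auto simp: flat_def eventually_at_filter)
    then show ?thesis
      unfolding 3 DERIV_def by (simp add: flat_def)
  qed
qed

lemma Ck_Suc_imp: "Ck (Suc k) f \<Longrightarrow> Ck k f"
proof (induction k arbitrary: f)
  case 0
  then show ?case by (simp add: differentiable_imp_continuous_on)
next
  case (Suc k)
  then show ?case by (metis Ck.simps(2))
qed

lemma Ck_SucI: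
  assumes "\<And>x. (f has_derivative (\<lambda>v. f' v x)) (at x)" "\<And>v. Ck k (f' v)"
  shows "Ck (Suc k) f"
proof -
  have "frechet_derivative f (at x) = (\<lambda>v. f' v x)" for x
    using frechet_derivative_at[OF assms(1)] by simp
  moreover have "f differentiable_on UNIV"
    using assms(1) by (auto simp: differentiable_on_def differentiable_def)
  ultimately show ?thesis
    using assms(2) by simp
qed

lemma Ck_SucD:
  assumes "Ck (Suc k) f"
  shows "(f has_derivative (\<lambda>v. frechet_derivative f (at x) v)) (at x)"
    and "Ck k (\<lambda>x. frechet_derivative f (at x) v)"
  using assms by (auto simp: differentiable_on_def frechet_derivative_works[symmetric])

lemma Ck_const: "Ck k (\<lambda>x. c)"
  by (induction k arbitrary: c) (auto intro!: Ck_SucI[where f' = "\<lambda>v x. 0"] derivative_eq_intros)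

lemma Ck_add: "Ck k f \<Longrightarrow> Ck k g \<Longrightarrow> Ck k (\<lambda>x. f x + g x)"
proof (induction k arbitrary: f g)
  case (Suc k)
  show ?case
    by (rule Ck_SucI[OF has_derivative_add[OF Ck_SucD(1)[OF Suc.prems(1)] Ck_SucD(1)[OF Suc.prems(2)]]])
      (intro Suc.IH Ck_SucD(2) Suc.prems)
qed (auto intro: continuous_intros)

lemma Ck_mult: "Ck k f \<Longrightarrow> Ck k g \<Longrightarrow> Ck k (\<lambda>x. f x * g x)"
proof (induction k arbitrary: f g)
  case (Suc k)
  show ?case
    by (rule Ck_SucI[OF has_derivative_mult[OF Ck_SucD(1)[OF Suc.prems(1)] Ck_SucD(1)[OF Suc.prems(2)]]])
      (intro Ck_add Suc.IH Ck_SucD(2) Suc.prems Ck_Suc_imp)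
qed (auto intro: continuous_intros)

lemma Ck_prod: "finite I \<Longrightarrow> (\<And>i. i \<in> I \<Longrightarrow> Ck k (f i)) \<Longrightarrow> Ck k (\<lambda>x. \<Prod>i\<in>I. f i x)"
  by (induction I rule: finite_induct) (auto intro: Ck_const Ck_mult)

lemma Ck_flat: "Ck k (\<lambda>x :: real^'n. flat m (a * x $ i + b))"
proof (induction k arbitrary: m)
  case 0
  have "isCont (flat m) t" for t using flat_has_derivative DERIV_isCont by blast
  then have "continuous_on UNIV (flat m)" by (simp add: continuous_at_imp_continuous_on)
  then show ?case
    by (auto intro!: continuous_on_compose2[of UNIV "flat m"] continuous_intros)
next
  case (Suc k)
  show ?case
  proof (rule Ck_SucI)
    fix x :: "real^'n"
    have "((\<lambda>x :: real^'n. a * x $ i + b) has_derivative (\<lambda>v. a * v $ i)) (at x)"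
      by (auto intro!: derivative_eq_intros bounded_linear_imp_has_derivative bounded_linear_vec_nth)
    from has_derivative_compose[OF this flat_has_derivative[unfolded has_field_derivative_def]]
    show "((\<lambda>x. flat m (a * x $ i + b)) has_derivative
      (\<lambda>v. (a * v $ i) * (flat (m + 2) (a * x $ i + b) + (- real m) * flat (m + 1) (a * x $ i + b)))) (at x)"
      by (simp add: mult_ac)
  next
    fix v :: "real^'n"
    show "Ck k (\<lambda>x. (a * v $ i) * (flat (m + 2) (a * x $ i + b) + (- real m) * flat (m + 1) (a * x $ i + b)))"
      by (intro Ck_mult Ck_add Ck_const Suc)
  qed
qed

text \<open>
  A product over the coordinates of smooth cutoffs at both faces of the box. The scale \<open>N\<close> steepens the cutoffs, so
  that the bumps converge to the indicator of the box.
\<close>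

definition bump :: "real^'n \<Rightarrow> real^'n \<Rightarrow> nat \<Rightarrow> real^'n \<Rightarrow> real" where
  "bump a b N x = (\<Prod>i\<in>UNIV. flat 0 (real N * x $ i + - (real N * a $ i)) * flat 0 (- real N * x $ i + real N * b $ i))"

lemma bump_eq_0:
  assumes "x \<notin> box a b" shows "bump a b N x = 0"
proof -
  obtain i where "\<not> (a $ i < x $ i \<and> x $ i < b $ i)"
    using assms by (auto simp: mem_box_cart)
  then have "real N * x $ i + - (real N * a $ i) \<le> 0 \<or> - real N * x $ i + real N * b $ i \<le> 0"
    using mult_left_mono[of "x $ i" "a $ i" "real N"] mult_left_mono[of "b $ i" "x $ i" "real N"] by force
  then have "flat 0 (real N * x $ i + - (real N * a $ i)) * flat 0 (- real N * x $ i + real N * b $ i) = 0"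
    by (auto simp: flat_def)
  then show ?thesis
    unfolding bump_def by (intro prod_zero bexI[of _ i]) auto
qed

lemma test_function_bump: "test_function (bump a b N)"
  unfolding test_function_def
proof (intro conjI allI)
  fix k show "Ck k (bump a b N)"
    unfolding bump_def[abs_def] by (intro Ck_prod Ck_mult Ck_flat) simp
  have "bounded {x. bump a b N x \<noteq> 0}"
    by (rule bounded_subset[OF bounded_box[of a b]]) (use bump_eq_0 in blast)
  then show "compact (closure {x. bump a b N x \<noteq> 0})"
    by (simp add: compact_closure)
qed

lemma bump_bounds: "0 \<le> bump a b N x" "bump a b N x \<le> 1"
proof -
  have f: "0 \<le> flat 0 t" "flat 0 t \<le> 1" for t by (auto simp: flat_def)
  show "0 \<le> bump a b N x" "bump a b N x \<le> 1" unfolding bump_def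
    by (intro prod_nonneg prod_le_1 mult_nonneg_nonneg mult_le_one conjI f ballI)+
qed

lemma bump_tendsto: "(\<lambda>N. bump a b N x) \<longlonglongrightarrow> indicator (box a b) x"
proof (cases "x \<in> box a b")
  case False
  then show ?thesis by (simp add: bump_eq_0)
next
  case True
  have l: "(\<lambda>N. flat 0 (real N * t)) \<longlonglongrightarrow> 1" if "t > 0" for t
  proof -
    have "(\<lambda>N. exp (- (inverse (real N) * (1 / t)))) \<longlonglongrightarrow> exp (- (0 * (1 / t)))"
      by (intro tendsto_exp tendsto_minus tendsto_mult tendsto_const lim_inverse_n)
    then have "(\<lambda>N. exp (- (inverse (real N) * (1 / t)))) \<longlonglongrightarrow> 1" by simp
    moreover have "exp (- (inverse (real N) * (1 / t))) = flat 0 (real N * t)" if "N > 0" for N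
      using that \<open>t > 0\<close> by (simp add: flat_def inverse_eq_divide)
    ultimately show ?thesis
      by (rule Lim_transform_eventually[OF _ eventually_mono[OF eventually_gt_at_top[of 0]]])
  qed
  have e: "real N * s + - (real N * t) = real N * (s - t)" "- real N * s + real N * t = real N * (t - s)" for s t :: real and N
    by (simp_all add: algebra_simps)
  have "(\<lambda>N. \<Prod>i\<in>UNIV. flat 0 (real N * (x $ i - a $ i)) * flat 0 (real N * (b $ i - x $ i))) \<longlonglongrightarrow> (\<Prod>i\<in>(UNIV :: 'a set). 1 * 1)"
    using True by (intro tendsto_prod tendsto_mult l) (auto simp: mem_box_cart)
  then show ?thesis using True unfolding bump_def e by simp
qed

lemma test_function_continuous:
  assumes "test_function \<psi>"
  shows "continuous_on UNIV \<psi>" "continuous_on UNIV (\<lambda>y. frechet_derivative \<psi> (at y) v)"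
    "(\<psi> has_derivative frechet_derivative \<psi> (at x)) (at x)"
proof -
  have *: "Ck k \<psi>" for k using assms by (simp add: test_function_def)
  show "continuous_on UNIV \<psi>" using *[of 0] by simp
  show "continuous_on UNIV (\<lambda>y. frechet_derivative \<psi> (at y) v)"
    using Ck_SucD(2)[of 0 \<psi>] *[of "Suc 0"] unfolding Ck.simps(1) by blast
  show "(\<psi> has_derivative frechet_derivative \<psi> (at x)) (at x)"
    using Ck_SucD(1)[OF *] .
qed

text \<open>
  Boxes are an intersection-stable generator of the Borel sets, so the integrals over all Borel subsets of a box
  vanish, in particular over those where \<open>g\<close> has a fixed sign.
\<close>

lemma AE_zero_if_box_integrals_zero:
  fixes g :: "real^'n \<Rightarrow> real"
  assumes [measurable]: "g \<in> borel_measurable borel"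
    and int: "\<And>a b. set_integrable lborel (box a b) g"
    and zero: "\<And>a b. (LINT x:box a b|lborel. g x) = 0"
  shows "AE x in lborel. g x = 0"
proof -
  have "AE x in lborel. x \<in> box a b \<longrightarrow> g x = 0" for a b
  proof -
    let ?B = "box a b"
    have intA: "integrable lborel (\<lambda>x. indicator (A \<inter> ?B) x *\<^sub>R g x)" if "A \<in> sets borel" for A
      using set_integrable_subset[OF int[of a b], of "A \<inter> ?B"] that by (simp add: set_integrable_def)
    have zA: "(\<integral>x. indicator (A \<inter> ?B) x *\<^sub>R g x \<partial>lborel) = 0" if "A \<in> sets borel" for A
    proof -
      have "Int_stable (range (\<lambda>(a, b). box a b :: (real^'n) set))"
        by (auto simp: Int_stable_def box_Int_box)
      moreover have "range (\<lambda>(a, b). box a b :: (real^'n) set) \<subseteq> Pow UNIV" by simp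
      moreover have "A \<in> sigma_sets UNIV (range (\<lambda>(a, b). box a b :: (real^'n) set))"
        using that unfolding borel_eq_box by simp
      ultimately show ?thesis
      proof (induction rule: sigma_sets_induct_disjoint)
        case (basic A)
        then show ?case using zero by (auto simp: box_Int_box set_lebesgue_integral_def)
      next
        case empty
        then show ?case by simp
      next
        case (compl A)
        then have A: "A \<in> sets borel" unfolding borel_eq_box by simp
        have "(\<integral>x. indicator ((UNIV - A) \<inter> ?B) x *\<^sub>R g x \<partial>lborel) =
          (\<integral>x. indicator ?B x *\<^sub>R g x - indicator (A \<inter> ?B) x *\<^sub>R g x \<partial>lborel)"
          by (intro Bochner_Integration.integral_cong) (auto simp: indicator_def)
        also have "\<dots> = 0"
          using compl zero[of a b] int[of a b] intA[OF A]
          by (simp add: set_lebesgue_integral_def set_integrable_def)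
        finally show ?case .
      next
        case (union A)
        then have A: "A i \<in> sets borel" for i unfolding borel_eq_box by auto
        have "(LINT x:(\<Union>i. A i \<inter> ?B)|lborel. g x) = (\<Sum>i. LINT x:A i \<inter> ?B|lborel. g x)"
          using A union(1) intA[of "\<Union>i. A i"]
          by (intro lebesgue_integral_countable_add) (auto simp: disjoint_family_on_def set_integrable_def)
        then show ?case using union(3) by (simp add: set_lebesgue_integral_def)
      qed
    qed
    have pos: "AE x in lborel. x \<in> {x. s * g x > 0} \<inter> ?B \<longrightarrow> g x = 0" for s
    proof -
      let ?A = "{x. s * g x > 0}"
      have A: "?A \<in> sets borel" by simp
      have "(\<integral>x. s * (indicator (?A \<inter> ?B) x *\<^sub>R g x) \<partial>lborel) = 0"
        using zA[OF A] by simp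
      then have "AE x in lborel. s * (indicator (?A \<inter> ?B) x *\<^sub>R g x) = 0"
        by (subst (asm) integral_nonneg_eq_0_iff_AE) (use intA[OF A] in \<open>auto simp: indicator_def\<close>)
      then show ?thesis by eventually_elim (auto simp: indicator_def)
    qed
    show ?thesis using pos[of 1] pos[of "-1"] by eventually_elim force
  qed
  then have "AE x in lborel. \<forall>k::nat. x \<in> box (vec (- real k)) (vec (real k)) \<longrightarrow> g x = 0"
    unfolding AE_all_countable by blast
  then show ?thesis
  proof eventually_elim
    case (elim x)
    obtain k :: nat where k: "norm x < real k" using reals_Archimedean2 by blast
    have "\<bar>x $ i\<bar> < real k" for i
      using component_le_norm_cart[of x i] k by linarith
    then have "x \<in> box (vec (- real k)) (vec (real k))"
      by (simp add: mem_box_cart abs_less_iff minus_less_iff)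
    then show ?case using elim by blast
  qed
qed

text \<open>
  The fundamental lemma of the calculus of variations: bumps that converge to the indicator of a box reduce it to
  integrals over boxes.
\<close>

lemma AE_zero_if_test_integrals_zero:
  fixes g :: "real^'n \<Rightarrow> real"
  assumes g: "Lp_loc 1 g" and zero: "\<And>\<psi>. test_function \<psi> \<Longrightarrow> (LINT x|lebesgue. g x * \<psi> x) = 0"
  shows "AE x in lebesgue. g x = 0"
proof -
  obtain h where h[measurable]: "h \<in> borel_measurable lborel" and gh: "AE x in lborel. g x = h x"
    using g completion_ex_borel_measurable_real[of g lborel] by (auto simp: Lp_loc_def)
  have gh': "AE x in lebesgue. g x = h x" using gh by (simp add: AE_completion)
  have [measurable]: "g \<in> borel_measurable lebesgue" using g by (simp add: Lp_loc_def)
  have h1: "h \<in> borel_measurable borel" using h by simp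
  have abs_int: "integrable lborel (\<lambda>x. indicator K x *\<^sub>R \<bar>h x\<bar>)" if K: "compact K" for K :: "(real^'n) set"
  proof -
    have [measurable]: "K \<in> sets borel" using K by (intro borel_closed compact_imp_closed)
    have "integrable lebesgue (\<lambda>x. indicator K x *\<^sub>R (norm (g x) powr 1))"
      using g K by (simp add: Lp_loc_def set_integrable_def)
    then have "integrable lebesgue (\<lambda>x. indicator K x *\<^sub>R \<bar>h x\<bar>)"
      by (rule integrable_cong_AE_imp) (use gh' in \<open>auto elim!: eventually_mono intro!: measurable_completion\<close>)
    then show ?thesis by (subst (asm) integrable_completion) auto
  qed
  have cb: "integrable lborel (\<lambda>x. indicator (cbox a b) x *\<^sub>R \<bar>h x\<bar>)" for a b by (rule abs_int) simp
  have "AE x in lborel. h x = 0"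
  proof (rule AE_zero_if_box_integrals_zero[OF h1])
    fix a b :: "real^'n"
    show "set_integrable lborel (box a b) h" unfolding set_integrable_def
      by (rule Bochner_Integration.integrable_bound[OF cb[of a b]]) (use box_subset_cbox[of a b] in \<open>auto simp: indicator_def\<close>)
    have z: "(\<integral>x. h x * bump a b N x \<partial>lborel) = 0" for N
    proof -
      have c: "continuous_on UNIV (bump a b N)" using test_function_bump by (rule test_function_continuous)
      have [measurable]: "bump a b N \<in> borel_measurable borel"
        by (rule borel_measurable_continuous_onI[OF c])
      have "(\<integral>x. h x * bump a b N x \<partial>lborel) = (\<integral>x. h x * bump a b N x \<partial>lebesgue)"
        by (subst integral_completion) auto
      also have "\<dots> = (\<integral>x. g x * bump a b N x \<partial>lebesgue)"
      proof (rule integral_cong_AE)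
        have [measurable]: "bump a b N \<in> borel_measurable lebesgue" "h \<in> borel_measurable lebesgue"
          by (simp_all add: measurable_completion)
        show "(\<lambda>x. h x * bump a b N x) \<in> borel_measurable lebesgue" "(\<lambda>x. g x * bump a b N x) \<in> borel_measurable lebesgue"
          by measurable
        show "AE x in lebesgue. h x * bump a b N x = g x * bump a b N x"
          using gh' by eventually_elim simp
      qed
      finally show ?thesis using zero[OF test_function_bump] by simp
    qed
    have "(\<lambda>N. \<integral>x. h x * bump a b N x \<partial>lborel) \<longlonglongrightarrow> (\<integral>x. h x * indicator (box a b) x \<partial>lborel)"
    proof (rule integral_dominated_convergence[OF _ _ cb[of a b]])
      show "(\<lambda>x. h x * indicator (box a b) x) \<in> borel_measurable lborel" by measurable
      fix N
      have c: "continuous_on UNIV (bump a b N)" using test_function_bump by (rule test_function_continuous)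
      have [measurable]: "bump a b N \<in> borel_measurable borel"
        by (rule borel_measurable_continuous_onI[OF c])
      show "(\<lambda>x. h x * bump a b N x) \<in> borel_measurable lborel" by measurable
      show "AE x in lborel. norm (h x * bump a b N x) \<le> indicator (cbox a b) x *\<^sub>R \<bar>h x\<bar>"
      proof (rule AE_I2)
        fix x
        show "norm (h x * bump a b N x) \<le> indicator (cbox a b) x *\<^sub>R \<bar>h x\<bar>"
          using bump_bounds[of a b N x] bump_eq_0[of x a b N] box_subset_cbox[of a b]
          by (cases "x \<in> box a b") (auto simp: abs_mult indicator_def intro!: mult_left_le)
      qed
    next
      show "AE x in lborel. (\<lambda>N. h x * bump a b N x) \<longlonglongrightarrow> h x * indicator (box a b) x"
        by (intro AE_I2 tendsto_mult tendsto_const bump_tendsto)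
    qed
    then show "(LINT x:box a b|lborel. h x) = 0"
      unfolding z by (auto simp: set_lebesgue_integral_def mult.commute dest: LIMSEQ_unique[OF tendsto_const])
  qed
  then have "AE x in lebesgue. h x = 0" by (simp add: AE_completion)
  with gh' show ?thesis by eventually_elim simp
qed

lemma Lp_loc_1_iff: "Lp_loc 1 f \<longleftrightarrow> f \<in> borel_measurable lebesgue \<and> (\<forall>K. compact K \<longrightarrow> set_integrable lebesgue K f)"
proof -
  have "set_integrable lebesgue K (\<lambda>y. norm (f y) powr 1) \<longleftrightarrow> set_integrable lebesgue K f"
    if "f \<in> borel_measurable lebesgue" "compact K" for K
  proof -
    have "K \<in> sets lebesgue" using that(2) by (simp add: lmeasurable_compact fmeasurableD)
    then have "(\<lambda>x. indicat_real K x *\<^sub>R f x) \<in> borel_measurable lebesgue" using that(1) by (intro borel_measurable_scaleR) auto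
    from integrable_norm_iff[OF this] show ?thesis by (simp add: set_integrable_def)
  qed
  then show ?thesis by (auto simp: Lp_loc_def)
qed

text \<open>
  Applied to a periodic function and its translate by a period, this makes weak gradients of periodic functions
  periodic.
\<close>

lemma has_weak_gradient_unique:
  assumes 1: "has_weak_gradient \<phi> \<Phi>" and 2: "has_weak_gradient \<phi>' \<Psi>" and eq: "AE y in lebesgue. \<phi> y = \<phi>' y"
  shows "AE y in lebesgue. \<Phi> y = \<Psi> y"
proof -
  have L: "Lp_loc 1 \<Phi>" "Lp_loc 1 \<Psi>" "Lp_loc 1 \<phi>" "Lp_loc 1 \<phi>'" using 1 2 by (auto simp: has_weak_gradient_def)
  note L' = this[unfolded Lp_loc_1_iff]
  have "AE y in lebesgue. \<Phi> y $ i $ j - \<Psi> y $ i $ j = 0" for i j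
  proof (rule AE_zero_if_test_integrals_zero)
    have m: "(\<lambda>x. F x $ i $ j) \<in> borel_measurable lebesgue" if "F \<in> borel_measurable lebesgue" for F :: "real^'a \<Rightarrow> real^'a^'a"
      using that by (rule measurable_compose) (simp add: borel_measurable_continuous_onI continuous_on_component)
    have i: "set_integrable lebesgue K (\<lambda>x. F x $ i $ j)" if "set_integrable lebesgue K F" for F :: "real^'a \<Rightarrow> real^'a^'a" and K
      using integrable_bounded_linear[OF bounded_linear_compose[OF bounded_linear_vec_nth[of j] bounded_linear_vec_nth[of i]] that[unfolded set_integrable_def]]
      by (simp add: set_integrable_def)
    show "Lp_loc 1 (\<lambda>y. \<Phi> y $ i $ j - \<Psi> y $ i $ j)"
      unfolding Lp_loc_1_iff using L' by (auto intro!: borel_measurable_diff m set_integral_diff i)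
    fix \<psi> :: "real^'a \<Rightarrow> real" assume t: "test_function \<psi>"
    define K where "K = closure {x. \<psi> x \<noteq> 0}"
    have K: "compact K" using t by (simp add: K_def test_function_def)
    have K0: "\<psi> x = 0" if "x \<notin> K" for x using that closure_subset by (force simp: K_def)
    have c: "continuous_on UNIV \<psi>" using t by (rule test_function_continuous)
    obtain B where B: "\<And>x. \<bar>\<psi> x\<bar> \<le> B"
    proof -
      have "bounded (\<psi> ` K)" using c K continuous_on_subset compact_imp_bounded compact_continuous_image by blast
      then obtain B where "\<And>x. x \<in> K \<Longrightarrow> \<bar>\<psi> x\<bar> \<le> B" "B > 0" by (auto simp: bounded_pos)
      then show ?thesis using K0 by (intro that[of B]) (metis abs_zero less_imp_le)
    qed
    have I: "integrable lebesgue (\<lambda>y. F y $ i $ j * \<psi> y)" if "Lp_loc 1 F" for F :: "real^'a \<Rightarrow> real^'a^'a"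
    proof -
      have F: "F \<in> borel_measurable lebesgue" "set_integrable lebesgue K F" using that K by (auto simp: Lp_loc_1_iff)
      have "integrable lebesgue (\<lambda>x. B * (indicator K x *\<^sub>R F x $ i $ j))"
        using i[OF F(2)] by (simp add: set_integrable_def)
      moreover have "(\<lambda>y. F y $ i $ j * \<psi> y) \<in> borel_measurable lebesgue"
        by (intro borel_measurable_times m F) (simp add: borel_measurable_continuous_onI[OF c] measurable_completion)
      moreover have "norm (F x $ i $ j * \<psi> x) \<le> norm (B * (indicator K x *\<^sub>R F x $ i $ j))" for x
        using order_trans[OF B abs_ge_self[of B], of x] K0[of x]
        by (cases "x \<in> K") (auto simp: abs_mult mult.commute intro!: mult_right_mono)
      ultimately show ?thesis by (blast intro: Bochner_Integration.integrable_bound AE_I2)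
    qed
    have e: "(LINT y|lebesgue. \<phi> y $ i * frechet_derivative \<psi> (at y) (axis j 1)) =
          (LINT y|lebesgue. \<phi>' y $ i * frechet_derivative \<psi> (at y) (axis j 1))"
    proof (rule integral_cong_AE)
      have "continuous_on UNIV (\<lambda>y. frechet_derivative \<psi> (at y) (axis j 1))"
        using t by (rule test_function_continuous)
      then have d: "(\<lambda>y. frechet_derivative \<psi> (at y) (axis j 1)) \<in> borel_measurable lebesgue"
        by (simp add: borel_measurable_continuous_onI measurable_completion)
      have "(\<lambda>y. f y $ i * frechet_derivative \<psi> (at y) (axis j 1)) \<in> borel_measurable lebesgue"
        if "f \<in> borel_measurable lebesgue" for f :: "real^'a \<Rightarrow> real^'a"
        by (intro borel_measurable_times d measurable_compose[OF that]) (simp add: borel_measurable_continuous_onI continuous_on_component)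
      then show "(\<lambda>y. \<phi> y $ i * frechet_derivative \<psi> (at y) (axis j 1)) \<in> borel_measurable lebesgue"
        "(\<lambda>y. \<phi>' y $ i * frechet_derivative \<psi> (at y) (axis j 1)) \<in> borel_measurable lebesgue" using L' by auto
      show "AE y in lebesgue. \<phi> y $ i * frechet_derivative \<psi> (at y) (axis j 1) = \<phi>' y $ i * frechet_derivative \<psi> (at y) (axis j 1)"
        using eq by eventually_elim simp
    qed
    have "(LINT y|lebesgue. \<Phi> y $ i $ j * \<psi> y) = (LINT y|lebesgue. \<Psi> y $ i $ j * \<psi> y)"
    proof -
      have "- (LINT y|lebesgue. \<Phi> y $ i $ j * \<psi> y) = - (LINT y|lebesgue. \<Psi> y $ i $ j * \<psi> y)"
        using 1 2 t e unfolding has_weak_gradient_def by presburger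
      then show ?thesis by simp
    qed
    then show "(LINT y|lebesgue. (\<Phi> y $ i $ j - \<Psi> y $ i $ j) * \<psi> y) = 0"
      using I[OF L(1)] I[OF L(2)] by (simp add: left_diff_distrib)
  qed
  then have "AE y in lebesgue. \<forall>i j. \<Phi> y $ i $ j - \<Psi> y $ i $ j = 0"
    unfolding AE_all_countable by blast
  then show ?thesis by eventually_elim (simp add: vec_eq_iff)
qed

section \<open>Translations of integrals and test functions\<close>

lemma nn_integral_translate:
  fixes s :: "'a::euclidean_space"
  assumes "f \<in> borel_measurable borel"
  shows "(\<integral>\<^sup>+x. f (x + s) \<partial>lborel) = (\<integral>\<^sup>+x. f x \<partial>lborel)"
proof -
  have "(\<integral>\<^sup>+x. f x \<partial>lborel) = (\<integral>\<^sup>+x. f x \<partial>distr lborel borel ((+) s))"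
    by (simp add: lborel_distr_plus)
  also have "\<dots> = (\<integral>\<^sup>+x. f (s + x) \<partial>lborel)"
    using assms by (subst nn_integral_distr) auto
  finally show ?thesis by (simp add: add.commute)
qed

lemma integral_translate:
  fixes s :: "'a::euclidean_space" and f :: "'a \<Rightarrow> 'b::{banach, second_countable_topology}"
  assumes "f \<in> borel_measurable borel"
  shows "(\<integral>x. f (x + s) \<partial>lborel) = (\<integral>x. f x \<partial>lborel)"
proof -
  have "(\<integral>x. f x \<partial>lborel) = (\<integral>x. f x \<partial>distr lborel borel ((+) s))"
    by (simp add: lborel_distr_plus)
  also have "\<dots> = (\<integral>x. f (s + x) \<partial>lborel)"
    using assms by (subst integral_distr) auto
  finally show ?thesis by (simp add: add.commute)
qed

lemma AE_translate:
  fixes s :: "'a::euclidean_space"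
  assumes "AE x in lborel. P x"
  shows "AE x in lborel. P (x + s)"
proof -
  have "AE x in distr lborel borel ((+) s). P x" using assms unfolding lborel_distr_plus .
  then have "AE x in lborel. P (s + x)" by (rule AE_distrD[rotated]) simp
  then show ?thesis by (simp add: add.commute)
qed

lemma Ck_translate: "Ck k f \<Longrightarrow> Ck k (\<lambda>x. f (x + s))"
proof (induction k arbitrary: f)
  case 0
  then show ?case by (auto intro!: continuous_on_compose2[of UNIV f] continuous_intros)
next
  case (Suc k)
  show ?case
  proof (rule Ck_SucI)
    fix x
    have "((\<lambda>x. x + s) has_derivative (\<lambda>v. v)) (at x)" by (auto intro!: derivative_eq_intros)
    from has_derivative_compose[OF this Ck_SucD(1)[OF Suc.prems]]
    show "((\<lambda>x. f (x + s)) has_derivative (\<lambda>v. frechet_derivative f (at (x + s)) v)) (at x)" .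
  next
    fix v
    show "Ck k (\<lambda>x. frechet_derivative f (at (x + s)) v)"
      by (rule Suc.IH[OF Ck_SucD(2)[OF Suc.prems]])
  qed
qed

lemma test_function_translate:
  assumes "test_function \<psi>"
  shows "test_function (\<lambda>x. \<psi> (x + s))"
    and "frechet_derivative (\<lambda>x. \<psi> (x + s)) (at x) = frechet_derivative \<psi> (at (x + s))"
proof -
  have "((\<lambda>x. x + s) has_derivative (\<lambda>v. v)) (at x)" by (auto intro!: derivative_eq_intros)
  from has_derivative_compose[OF this test_function_continuous(3)[OF assms]]
  show "frechet_derivative (\<lambda>x. \<psi> (x + s)) (at x) = frechet_derivative \<psi> (at (x + s))"
    using frechet_derivative_at by fastforce
  have "{x. \<psi> (x + s) \<noteq> 0} = (\<lambda>x. x - s) ` {x. \<psi> x \<noteq> 0}"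
    by (auto simp: image_iff intro!: exI[of _ "_ + s"])
  then have "closure {x. \<psi> (x + s) \<noteq> 0} = (\<lambda>x. x - s) ` closure {x. \<psi> x \<noteq> 0}"
    by (simp add: closure_translation_subtract)
  then have "compact (closure {x. \<psi> (x + s) \<noteq> 0})"
    using assms by (auto simp: test_function_def intro!: compact_continuous_image continuous_intros)
  then show "test_function (\<lambda>x. \<psi> (x + s))"
    using assms by (auto simp: test_function_def Ck_translate)
qed

lemma test_function_support:
  fixes \<psi> :: "real^'n \<Rightarrow> real"
  assumes "test_function \<psi>"
  shows "\<exists>R. \<forall>x. x \<notin> cball 0 R \<longrightarrow> \<psi> x = 0 \<and> (\<forall>v. frechet_derivative \<psi> (at x) v = 0)"
proof -
  have "bounded (closure {x. \<psi> x \<noteq> 0})"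
    using assms by (simp add: test_function_def compact_imp_bounded)
  from bounded_subset_ballD[OF this, of 0] obtain R where R: "closure {x. \<psi> x \<noteq> 0} \<subseteq> ball 0 R"
    by blast
  have z: "\<psi> x = 0" if "x \<notin> cball 0 R" for x
    using that R closure_subset[of "{x. \<psi> x \<noteq> 0}"] ball_subset_cball[of 0 R] by blast
  show ?thesis
  proof (intro exI[of _ R] allI impI conjI z)
    fix x v :: "real^'n" assume x: "x \<notin> cball 0 R"
    have "((\<lambda>x. 0 :: real) has_derivative (\<lambda>v. 0)) (at x)" by simp
    then have "(\<psi> has_derivative (\<lambda>v. 0)) (at x)"
      by (rule has_derivative_transform_within_open[of _ _ _ _ "- cball 0 R"])
        (use x z in \<open>simp_all del: mem_cball add: open_Compl\<close>)
    from frechet_derivative_at[OF this] show "frechet_derivative \<psi> (at x) v = 0"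
      by metis
  qed
qed

section \<open>Averages over random translates\<close>

definition locally_integrable :: "(real^'n \<Rightarrow> 'b::euclidean_space) \<Rightarrow> bool" where
  "locally_integrable f \<longleftrightarrow> f \<in> borel_measurable borel \<and> (\<forall>R. set_integrable lborel (cball 0 R) f)"

lemma Lp_loc_1_iff_locally_integrable:
  assumes [measurable]: "f \<in> borel_measurable borel"
  shows "Lp_loc 1 f \<longleftrightarrow> locally_integrable f"
proof
  have f: "f \<in> borel_measurable lebesgue" by (simp add: measurable_completion)
  { fix K :: "(real^'a) set" assume "compact K"
    then have [measurable]: "K \<in> sets borel" by (intro borel_closed compact_imp_closed)
    have "set_integrable lebesgue K f \<longleftrightarrow> set_integrable lborel K f"
      unfolding set_integrable_def by (rule integrable_completion) measurable }
  note 1 = this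
  { assume "Lp_loc 1 f"
    then show "locally_integrable f" unfolding Lp_loc_1_iff locally_integrable_def using 1 by auto }
  { assume f2: "locally_integrable f"
    have "set_integrable lebesgue K f" if K: "compact K" for K
    proof -
      have "K \<in> sets borel" using K by (intro borel_closed compact_imp_closed)
      obtain R where "K \<subseteq> cball 0 R" using bounded_subset_ballD[OF compact_imp_bounded[OF K], of 0] ball_subset_cball by blast
      then have "set_integrable lborel K f"
        using f2 \<open>K \<in> sets borel\<close> by (auto simp: locally_integrable_def intro: set_integrable_subset)
      then show ?thesis using 1[OF K] by simp
    qed
    then show "Lp_loc 1 f" unfolding Lp_loc_1_iff using f by blast }
qed

lemma borel_measurable_nth [measurable]: "(\<lambda>x :: 'a::euclidean_space^'n. x $ i) \<in> borel_measurable borel"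
  by (simp add: borel_measurable_continuous_onI continuous_on_component)

text \<open>
  Translations and product measures are handled with \<open>lborel\<close>; this is the form in which weak gradients of Borel
  functions are used below.
\<close>

lemma has_weak_gradient_borel_iff:
  fixes \<phi> :: "real^'n \<Rightarrow> real^'n"
  assumes [measurable]: "\<phi> \<in> borel_measurable borel" "\<Phi> \<in> borel_measurable borel"
  shows "has_weak_gradient \<phi> \<Phi> \<longleftrightarrow> locally_integrable \<phi> \<and> locally_integrable \<Phi> \<and>
     (\<forall>\<psi> i j. test_function \<psi> \<longrightarrow>
        (\<integral>y. \<phi> y $ i * frechet_derivative \<psi> (at y) (axis j 1) \<partial>lborel) =
        - (\<integral>y. \<Phi> y $ i $ j * \<psi> y \<partial>lborel))"
proof -
  have "(\<integral>y. \<phi> y $ i * frechet_derivative \<psi> (at y) (axis j 1) \<partial>lebesgue) = (\<integral>y. \<phi> y $ i * frechet_derivative \<psi> (at y) (axis j 1) \<partial>lborel)"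
    "(\<integral>y. \<Phi> y $ i $ j * \<psi> y \<partial>lebesgue) = (\<integral>y. \<Phi> y $ i $ j * \<psi> y \<partial>lborel)"
    if "test_function \<psi>" for \<psi> i j
  proof -
    have [measurable]: "\<psi> \<in> borel_measurable borel" "(\<lambda>y. frechet_derivative \<psi> (at y) (axis j 1)) \<in> borel_measurable borel"
      using that by (auto intro!: borel_measurable_continuous_onI test_function_continuous)
    show "(\<integral>y. \<phi> y $ i * frechet_derivative \<psi> (at y) (axis j 1) \<partial>lebesgue) = (\<integral>y. \<phi> y $ i * frechet_derivative \<psi> (at y) (axis j 1) \<partial>lborel)"
      by (rule integral_completion) measurable
    show "(\<integral>y. \<Phi> y $ i $ j * \<psi> y \<partial>lebesgue) = (\<integral>y. \<Phi> y $ i $ j * \<psi> y \<partial>lborel)"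
      by (rule integral_completion) measurable
  qed
  then show ?thesis
    by (auto simp: has_weak_gradient_def Lp_loc_1_iff_locally_integrable)
qed

lemma locally_integrable_bounded_linear:
  assumes "locally_integrable f" "bounded_linear T"
  shows "locally_integrable (\<lambda>x. T (f x))"
  unfolding locally_integrable_def
proof (intro conjI allI)
  have "T \<in> borel_measurable borel"
    by (intro borel_measurable_continuous_onI bounded_linear.continuous_on[OF assms(2)] continuous_on_id)
  then show "(\<lambda>x. T (f x)) \<in> borel_measurable borel"
    using assms(1) unfolding locally_integrable_def by (blast intro: measurable_compose)
  fix R
  have "set_integrable lborel (cball 0 R) f" using assms(1) by (simp add: locally_integrable_def)
  from integrable_bounded_linear[OF assms(2) this[unfolded set_integrable_def]]
  show "set_integrable lborel (cball 0 R) (\<lambda>x. T (f x))"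
    unfolding set_integrable_def by (simp only: bounded_linear.linear[OF assms(2)] linear_cmul)
qed

definition avg :: "(real^'n) measure \<Rightarrow> (real^'n \<Rightarrow> 'b::euclidean_space) \<Rightarrow> real^'n \<Rightarrow> 'b" where
  "avg M f x = (\<integral>s. f (x + s) \<partial>M)"

text \<open>
  A random bounded shift with distribution \<open>M\<close>. Point masses turn \<open>avg\<close> into a translation, uniform
  measures on balls into a mollification, and uniform measures on segments into the mean of a gradient along a
  segment, that is, a difference quotient.
\<close>

locale kernel = prob_space M for M :: "(real^'n) measure" +
  fixes r :: real
  assumes sets_M[measurable_cong]: "sets M = sets borel"
    and support: "AE s in M. norm s \<le> r"
begin

sublocale P: pair_sigma_finite lborel M ..

lemma measurable_pair_borel:
  "h \<in> borel_measurable (borel \<Otimes>\<^sub>M borel) \<Longrightarrow> h \<in> borel_measurable (lborel \<Otimes>\<^sub>M M)"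
  by (subst measurable_cong_sets[OF sets_pair_measure_cong[OF sets_lborel sets_M] refl])

lemma integrable_translates:
  assumes "locally_integrable f"
  shows "integrable (lborel \<Otimes>\<^sub>M M) (\<lambda>(x, s). indicator (cball 0 R) x *\<^sub>R f (x + s))"
proof (rule integrableI_bounded)
  have [measurable]: "f \<in> borel_measurable borel" using assms by (simp add: locally_integrable_def)
  have [measurable]: "cball (0 :: real^'n) R \<in> sets borel" for R by simp
  show m: "(\<lambda>(x, s). indicator (cball 0 R) x *\<^sub>R f (x + s)) \<in> borel_measurable (lborel \<Otimes>\<^sub>M M)"
    by (rule measurable_pair_borel) measurable
  define C where "C = (\<integral>\<^sup>+x. norm (indicator (cball 0 (R + r)) x *\<^sub>R f x) \<partial>lborel)"
  have "C < \<infinity>"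
    using assms unfolding C_def locally_integrable_def set_integrable_def integrable_iff_bounded by blast
  have "(\<integral>\<^sup>+z. norm (case z of (x, s) \<Rightarrow> indicator (cball 0 R) x *\<^sub>R f (x + s)) \<partial>(lborel \<Otimes>\<^sub>M M)) =
    (\<integral>\<^sup>+s. \<integral>\<^sup>+x. norm (indicator (cball 0 R) x *\<^sub>R f (x + s)) \<partial>lborel \<partial>M)"
    using P.nn_integral_snd[of "\<lambda>z. ennreal (norm (case z of (x, s) \<Rightarrow> indicator (cball 0 R) x *\<^sub>R f (x + s)))"] m
    by simp
  also have "\<dots> \<le> (\<integral>\<^sup>+s. C \<partial>M)"
  proof (rule nn_integral_mono_AE)
    show "AE s in M. (\<integral>\<^sup>+x. norm (indicator (cball 0 R) x *\<^sub>R f (x + s)) \<partial>lborel) \<le> C"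
      using support
    proof eventually_elim
      case (elim s)
      have "(\<integral>\<^sup>+x. norm (indicator (cball 0 R) x *\<^sub>R f (x + s)) \<partial>lborel)
        \<le> (\<integral>\<^sup>+x. norm (indicator (cball 0 (R + r)) (x + s) *\<^sub>R f (x + s)) \<partial>lborel)"
      proof (intro nn_integral_mono)
        fix x
        have "x + s \<in> cball 0 (R + r)" if "x \<in> cball 0 R"
          using that elim norm_triangle_ineq[of x s] by simp
        then show "ennreal (norm (indicator (cball 0 R) x *\<^sub>R f (x + s)))
          \<le> ennreal (norm (indicator (cball 0 (R + r)) (x + s) *\<^sub>R f (x + s)))"
          by (cases "x \<in> cball 0 R") (simp_all only: indicator_simps, simp_all)
      qed
      also have "\<dots> = C"
        unfolding C_def by (subst nn_integral_translate) auto
      finally show ?case .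
    qed
  qed
  also have "\<dots> < \<infinity>" using \<open>C < \<infinity>\<close> by (simp add: emeasure_space_1)
  finally show "(\<integral>\<^sup>+z. norm (case z of (x, s) \<Rightarrow> indicator (cball 0 R) x *\<^sub>R f (x + s)) \<partial>(lborel \<Otimes>\<^sub>M M)) < \<infinity>" .
qed

lemma borel_measurable_avg:
  assumes [measurable]: "f \<in> borel_measurable borel"
  shows "avg M f \<in> borel_measurable borel"
  unfolding avg_def[abs_def]
  by (rule borel_measurable_lebesgue_integral)
    (subst measurable_cong_sets[OF sets_pair_measure_cong[OF refl sets_M] refl], measurable)

lemma avg_locally_integrable:
  assumes "locally_integrable f"
  shows "locally_integrable (avg M f)"
  unfolding locally_integrable_def
proof (intro conjI allI)
  show "avg M f \<in> borel_measurable borel"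
    using assms by (intro borel_measurable_avg) (simp add: locally_integrable_def)
  fix R
  show "set_integrable lborel (cball 0 R) (avg M f)"
    using P.integrable_fst[OF integrable_translates[OF assms, of R]]
    unfolding set_integrable_def avg_def integral_scaleR_right .
qed

lemma AE_integrable_translates:
  assumes "locally_integrable f"
  shows "AE x in lborel. integrable M (\<lambda>s. f (x + s))"
proof -
  have "AE x in lborel. \<forall>N::nat. integrable M (\<lambda>s. indicator (cball 0 (real N)) x *\<^sub>R f (x + s))"
    unfolding AE_all_countable using P.AE_integrable_fst[OF integrable_translates[OF assms]] by blast
  then show ?thesis
  proof eventually_elim
    case (elim x)
    obtain N :: nat where "norm x \<le> real N" using real_arch_simple by blast
    then show ?case using elim[rule_format, of N] by (simp add: indicator_def)
  qed
qed

lemma integrable_translates_mult: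
  fixes f :: "real^'n \<Rightarrow> real"
  assumes f: "locally_integrable f" and g: "continuous_on UNIV g" "\<And>x. x \<notin> cball 0 R \<Longrightarrow> g x = 0"
  shows "integrable (lborel \<Otimes>\<^sub>M M) (\<lambda>(x, s). f (x + s) * g x)"
proof -
  have [measurable]: "f \<in> borel_measurable borel" using assms by (simp add: locally_integrable_def)
  have [measurable]: "cball (0 :: real^'n) R \<in> sets borel" for R by simp
  have [measurable]: "g \<in> borel_measurable borel" using g by (simp add: borel_measurable_continuous_onI)
  obtain B where B: "\<And>x. \<bar>g x\<bar> \<le> B"
  proof -
    have "bounded (g ` cball 0 R)"
      by (intro compact_imp_bounded compact_continuous_image compact_cball continuous_on_subset[OF g(1)]) simp
    then obtain B where B: "\<forall>x\<in>cball 0 R. \<bar>g x\<bar> \<le> B" "B > 0"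
      unfolding bounded_pos by (auto simp del: mem_cball)
    show ?thesis
    proof (rule that)
      show "\<bar>g x\<bar> \<le> B" for x using B g(2)[of x] by (cases "x \<in> cball 0 R") (simp_all del: mem_cball)
    qed
  qed
  show ?thesis
  proof (rule Bochner_Integration.integrable_bound)
    show "integrable (lborel \<Otimes>\<^sub>M M) (\<lambda>z. B * (case z of (x, s) \<Rightarrow> indicator (cball 0 R) x *\<^sub>R f (x + s)))"
      by (intro integrable_mult_right integrable_translates f)
    show "(\<lambda>(x, s). f (x + s) * g x) \<in> borel_measurable (lborel \<Otimes>\<^sub>M M)" by (rule measurable_pair_borel) measurable
    have "norm (f (x + s) * g x) \<le> norm (B * (indicator (cball 0 R) x *\<^sub>R f (x + s)))" for x s
      using order_trans[OF B abs_ge_self[of B], of x] g(2)[of x]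
      by (cases "x \<in> cball 0 R") (auto simp: abs_mult mult.commute indicator_def intro!: mult_right_mono)
    then show "AE z in lborel \<Otimes>\<^sub>M M. norm (case z of (x, s) \<Rightarrow> f (x + s) * g x) \<le>
      norm (B * (case z of (x, s) \<Rightarrow> indicator (cball 0 R) x *\<^sub>R f (x + s)))"
      by (intro AE_I2) (auto split: prod.split)
  qed
qed

lemma integral_avg_mult:
  fixes f :: "real^'n \<Rightarrow> real"
  assumes f: "locally_integrable f" and g: "continuous_on UNIV g" "\<And>x. x \<notin> cball 0 R \<Longrightarrow> g x = 0"
  shows "(\<integral>x. avg M f x * g x \<partial>lborel) = (\<integral>s. \<integral>x. f x * g (x - s) \<partial>lborel \<partial>M)"
proof -
  have [measurable]: "f \<in> borel_measurable borel" using assms by (simp add: locally_integrable_def)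
  have [measurable]: "cball (0 :: real^'n) R \<in> sets borel" for R by simp
  have [measurable]: "g \<in> borel_measurable borel" using g by (simp add: borel_measurable_continuous_onI)
  from P.Fubini_integral[OF integrable_translates_mult[OF f g]]
  have "(\<integral>x. avg M f x * g x \<partial>lborel) = (\<integral>s. \<integral>x. f (x + s) * g x \<partial>lborel \<partial>M)"
    by (simp add: avg_def)
  also have "\<dots> = (\<integral>s. \<integral>x. f x * g (x - s) \<partial>lborel \<partial>M)"
  proof (rule Bochner_Integration.integral_cong)
    fix s
    show "(\<integral>x. f (x + s) * g x \<partial>lborel) = (\<integral>x. f x * g (x - s) \<partial>lborel)"
      using integral_translate[of "\<lambda>x. f x * g (x - s)" s] by simp
  qed simp
  finally show ?thesis .
qed

lemma avg_bounded_linear: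
  assumes "locally_integrable f" "bounded_linear T"
  shows "AE x in lborel. T (avg M f x) = avg M (\<lambda>x. T (f x)) x"
  using AE_integrable_translates[OF assms(1)]
  by eventually_elim (simp only: avg_def integral_bounded_linear[OF assms(2)])

text \<open>
  Fubini's theorem moves the average onto the test function, and translates of test functions are test functions.
\<close>

lemma has_weak_gradient_avg:
  assumes [measurable]: "\<phi> \<in> borel_measurable borel" "\<Phi> \<in> borel_measurable borel" and wg: "has_weak_gradient \<phi> \<Phi>"
  shows "has_weak_gradient (avg M \<phi>) (avg M \<Phi>)"
proof -
  have L: "locally_integrable \<phi>" "locally_integrable \<Phi>" and
    w: "\<And>\<psi> i j. test_function \<psi> \<Longrightarrow> (\<integral>y. \<phi> y $ i * frechet_derivative \<psi> (at y) (axis j 1) \<partial>lborel) =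
        - (\<integral>y. \<Phi> y $ i $ j * \<psi> y \<partial>lborel)"
    using wg unfolding has_weak_gradient_borel_iff[OF assms(1,2)] by auto
  have bl: "bounded_linear (\<lambda>x :: real^'n. x $ i)" "bounded_linear (\<lambda>x :: real^'n^'n. x $ i $ j)" for i j
    by (auto intro: bounded_linear_compose[OF bounded_linear_vec_nth bounded_linear_vec_nth] bounded_linear_vec_nth)
  have [measurable]: "avg M \<phi> \<in> borel_measurable borel" "avg M \<Phi> \<in> borel_measurable borel"
    by (simp_all add: borel_measurable_avg)
  have "(\<integral>y. avg M \<phi> y $ i * frechet_derivative \<psi> (at y) (axis j 1) \<partial>lborel) =
        - (\<integral>y. avg M \<Phi> y $ i $ j * \<psi> y \<partial>lborel)" if t: "test_function \<psi>" for \<psi> i j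
  proof -
    define d\<psi> where "d\<psi> = (\<lambda>y. frechet_derivative \<psi> (at y) (axis j 1))"
    have c: "continuous_on UNIV \<psi>" "continuous_on UNIV d\<psi>"
      unfolding d\<psi>_def using t by (auto intro: test_function_continuous)
    then have [measurable]: "\<psi> \<in> borel_measurable borel" "d\<psi> \<in> borel_measurable borel"
      by (simp_all add: borel_measurable_continuous_onI)
    obtain R where R: "\<forall>x. x \<notin> cball 0 R \<longrightarrow> \<psi> x = 0 \<and> (\<forall>v. frechet_derivative \<psi> (at x) v = 0)"
      using test_function_support[OF t] by (rule exE)
    have z: "\<psi> x = 0" and z': "d\<psi> x = 0" if "x \<notin> cball 0 R" for x
      unfolding d\<psi>_def using R that by (simp_all del: mem_cball)
    have [measurable]: "avg M (\<lambda>y. \<phi> y $ i) \<in> borel_measurable borel" "avg M (\<lambda>y. \<Phi> y $ i $ j) \<in> borel_measurable borel"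
      by (intro borel_measurable_avg; measurable)+
    have "(\<integral>y. avg M \<phi> y $ i * d\<psi> y \<partial>lborel) = (\<integral>y. avg M (\<lambda>y. \<phi> y $ i) y * d\<psi> y \<partial>lborel)"
    proof (rule integral_cong_AE)
      show "AE x in lborel. avg M \<phi> x $ i * d\<psi> x = avg M (\<lambda>y. \<phi> y $ i) x * d\<psi> x"
        using avg_bounded_linear[OF L(1) bl(1)[of i]] by eventually_elim simp
    qed measurable
    also have "\<dots> = (\<integral>s. \<integral>x. \<phi> x $ i * d\<psi> (x - s) \<partial>lborel \<partial>M)"
      by (rule integral_avg_mult[OF locally_integrable_bounded_linear[OF L(1) bl(1)] c(2) z'])
    also have "\<dots> = (\<integral>s. - (\<integral>x. \<Phi> x $ i $ j * \<psi> (x - s) \<partial>lborel) \<partial>M)"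
    proof (rule Bochner_Integration.integral_cong)
      fix s
      show "(\<integral>x. \<phi> x $ i * d\<psi> (x - s) \<partial>lborel) = - (\<integral>x. \<Phi> x $ i $ j * \<psi> (x - s) \<partial>lborel)"
        using w[OF test_function_translate(1)[OF t, of "-s"], of i j] test_function_translate(2)[OF t, of "-s"]
        by (simp add: d\<psi>_def)
    qed simp
    also have "\<dots> = - (\<integral>s. (\<integral>x. \<Phi> x $ i $ j * \<psi> (x - s) \<partial>lborel) \<partial>M)" by simp
    also have "(\<integral>s. (\<integral>x. \<Phi> x $ i $ j * \<psi> (x - s) \<partial>lborel) \<partial>M) = (\<integral>y. avg M (\<lambda>y. \<Phi> y $ i $ j) y * \<psi> y \<partial>lborel)"
      by (rule integral_avg_mult[OF locally_integrable_bounded_linear[OF L(2) bl(2)] c(1) z, symmetric])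
    also have "\<dots> = (\<integral>y. avg M \<Phi> y $ i $ j * \<psi> y \<partial>lborel)"
    proof (rule integral_cong_AE)
      show "AE x in lborel. avg M (\<lambda>y. \<Phi> y $ i $ j) x * \<psi> x = avg M \<Phi> x $ i $ j * \<psi> x"
        using avg_bounded_linear[OF L(2) bl(2)[of i j]] by eventually_elim simp
    qed measurable
    finally show ?thesis by (simp add: d\<psi>_def)
  qed
  note weak = this
  show ?thesis
    unfolding has_weak_gradient_borel_iff[OF borel_measurable_avg[OF assms(1)] borel_measurable_avg[OF assms(2)]]
    by (intro conjI allI impI avg_locally_integrable L, erule weak)
qed

text \<open>
  The Cauchy-Schwarz inequality (Jensen's inequality for the square) under the integral, then Tonelli's theorem.
\<close>

lemma nn_integral_avg_error:
  assumes f: "locally_integrable f"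
  shows "(\<integral>\<^sup>+x\<in>cball 0 R. ennreal ((norm (avg M f x - f x))\<^sup>2) \<partial>lborel)
    \<le> (\<integral>\<^sup>+s. (\<integral>\<^sup>+x\<in>cball 0 R. ennreal ((norm (f (x + s) - f x))\<^sup>2) \<partial>lborel) \<partial>M)"
proof -
  have [measurable]: "f \<in> borel_measurable borel" using assms by (simp add: locally_integrable_def)
  have [measurable]: "cball (0 :: real^'n) R \<in> sets borel" for R by simp
  have "(\<integral>\<^sup>+x\<in>cball 0 R. ennreal ((norm (avg M f x - f x))\<^sup>2) \<partial>lborel) \<le>
    (\<integral>\<^sup>+x. (\<integral>\<^sup>+s. ennreal ((norm (f (x + s) - f x))\<^sup>2) * indicator (cball 0 R) x \<partial>M) \<partial>lborel)"
  proof (rule nn_integral_mono_AE)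
    show "AE x in lborel. ennreal ((norm (avg M f x - f x))\<^sup>2) * indicator (cball 0 R) x
      \<le> (\<integral>\<^sup>+s. ennreal ((norm (f (x + s) - f x))\<^sup>2) * indicator (cball 0 R) x \<partial>M)"
      using AE_integrable_translates[OF f]
    proof eventually_elim
      case (elim x)
      have e: "avg M f x - f x = (\<integral>s. f (x + s) - f x \<partial>M)"
        using elim by (simp add: avg_def prob_space)
      have "integrable M (\<lambda>s. f (x + s) - f x)" using elim by simp
      then have "ennreal (norm (avg M f x - f x)) \<le> (\<integral>\<^sup>+s. norm (f (x + s) - f x) \<partial>M)"
        unfolding e by (rule integral_norm_bound_ennreal)
      then have "(ennreal (norm (avg M f x - f x)))\<^sup>2 \<le> (\<integral>\<^sup>+s. norm (f (x + s) - f x) * 1 \<partial>M)\<^sup>2"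
        by (simp add: power_mono)
      also have "\<dots> \<le> (\<integral>\<^sup>+s. (ennreal (norm (f (x + s) - f x)))\<^sup>2 \<partial>M) * (\<integral>\<^sup>+s. 1\<^sup>2 \<partial>M)"
        using Cauchy_Schwarz_nn_integral[of "\<lambda>s. ennreal (norm (f (x + s) - f x))" M "\<lambda>_. 1"] by simp
      finally have "ennreal ((norm (avg M f x - f x))\<^sup>2) \<le> (\<integral>\<^sup>+s. ennreal ((norm (f (x + s) - f x))\<^sup>2) \<partial>M)"
        by (simp add: emeasure_space_1 ennreal_power)
      then show ?case by (auto simp: indicator_def)
    qed
  qed
  also have "\<dots> = (\<integral>\<^sup>+s. (\<integral>\<^sup>+x\<in>cball 0 R. ennreal ((norm (f (x + s) - f x))\<^sup>2) \<partial>lborel) \<partial>M)"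
    by (rule P.Fubini'[OF measurable_pair_borel, symmetric]) measurable
  finally show ?thesis .
qed

end

section \<open>Mean square convergence of averages\<close>

lemma measurable_imp_borel_representative:
  fixes f :: "'a::euclidean_space \<Rightarrow> 'b::euclidean_space"
  assumes "f \<in> borel_measurable lebesgue"
  obtains g where "g \<in> borel_measurable borel" "AE x in lborel. f x = g x"
proof -
  have "\<exists>g\<in>borel_measurable lborel. AE x in lborel. f x \<bullet> b = g x" for b
    using assms by (intro completion_ex_borel_measurable_real) auto
  then obtain g where g: "\<And>b. g b \<in> borel_measurable lborel" "\<And>b. AE x in lborel. f x \<bullet> b = g b x"
    by metis
  have "AE x in lborel. \<forall>b\<in>Basis. f x \<bullet> b = g b x"
    by (intro AE_finite_allI g) simp
  then have "AE x in lborel. f x = (\<Sum>b\<in>Basis. g b x *\<^sub>R b)"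
  proof eventually_elim
    case (elim x)
    have "f x = (\<Sum>b\<in>Basis. (f x \<bullet> b) *\<^sub>R b)" by (simp add: euclidean_representation)
    also have "\<dots> = (\<Sum>b\<in>Basis. g b x *\<^sub>R b)" using elim by (intro sum.cong) simp_all
    finally show ?case .
  qed
  moreover have "(\<lambda>x. \<Sum>b\<in>Basis. g b x *\<^sub>R b) \<in> borel_measurable borel"
    using g(1) by (auto intro!: borel_measurable_sum)
  ultimately show thesis using that by blast
qed

lemma norm_add_square_le: "(norm (a + b))\<^sup>2 \<le> 2 * (norm a)\<^sup>2 + 2 * (norm b)\<^sup>2"
proof -
  have "(norm (a + b))\<^sup>2 \<le> (norm a + norm b)\<^sup>2" by (intro power_mono norm_triangle_ineq) simp
  also have "\<dots> \<le> 2 * (norm a)\<^sup>2 + 2 * (norm b)\<^sup>2"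
    using sum_squares_bound[of "norm a" "norm b"] by (simp add: power2_sum)
  finally show ?thesis .
qed

lemma nn_integral_square_add_le:
  fixes f g :: "'a \<Rightarrow> 'b::euclidean_space"
  assumes [measurable]: "f \<in> borel_measurable M" "g \<in> borel_measurable M"
  shows "(\<integral>\<^sup>+x. ennreal ((norm (f x + g x))\<^sup>2) \<partial>M) \<le>
    2 * (\<integral>\<^sup>+x. ennreal ((norm (f x))\<^sup>2) \<partial>M) + 2 * (\<integral>\<^sup>+x. ennreal ((norm (g x))\<^sup>2) \<partial>M)"
proof -
  have "ennreal ((norm (f x + g x))\<^sup>2) \<le> 2 * ennreal ((norm (f x))\<^sup>2) + 2 * ennreal ((norm (g x))\<^sup>2)" for x
  proof -
    have "ennreal ((norm (f x + g x))\<^sup>2) \<le> ennreal (2 * (norm (f x))\<^sup>2 + 2 * (norm (g x))\<^sup>2)"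
      by (intro ennreal_leI norm_add_square_le)
    then show ?thesis by (simp add: ennreal_mult)
  qed
  then have "(\<integral>\<^sup>+x. ennreal ((norm (f x + g x))\<^sup>2) \<partial>M) \<le>
    (\<integral>\<^sup>+x. 2 * ennreal ((norm (f x))\<^sup>2) + 2 * ennreal ((norm (g x))\<^sup>2) \<partial>M)"
    by (intro nn_integral_mono)
  also have "\<dots> = 2 * (\<integral>\<^sup>+x. ennreal ((norm (f x))\<^sup>2) \<partial>M) + 2 * (\<integral>\<^sup>+x. ennreal ((norm (g x))\<^sup>2) \<partial>M)"
    by (simp add: nn_integral_add nn_integral_cmult)
  finally show ?thesis .
qed

text \<open>
  A measurable function is a limit of continuous ones almost everywhere. Composing these with the projection onto a
  ball that contains the range of \<open>f\<close> does not change the limit and provides a bound for dominated convergence.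
\<close>

lemma continuous_dense_L2_bounded:
  fixes f :: "'a::euclidean_space \<Rightarrow> 'b::euclidean_space"
  assumes [measurable]: "f \<in> borel_measurable borel" "S \<in> sets borel"
    and S: "emeasure lborel S < \<infinity>" and bd: "\<And>x. norm (f x) \<le> b" and e: "e > 0"
  shows "\<exists>g. continuous_on UNIV g \<and> (\<integral>\<^sup>+x. ennreal ((norm (f x - g x))\<^sup>2) \<partial>restrict_space lborel S) \<le> ennreal e"
proof -
  have "b \<ge> 0" using bd[of 0] norm_ge_zero order_trans by blast
  define T :: "'b \<Rightarrow> 'b" where "T = closest_point (cball 0 b)"
  have cT: "continuous_on UNIV T" unfolding T_def
    using \<open>b \<ge> 0\<close> by (intro continuous_on_closest_point) auto
  have T: "norm (T y) \<le> b" for y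
    using closest_point_in_set[of "cball 0 b" y] \<open>b \<ge> 0\<close> by (simp add: T_def)
  have Tf: "T (f x) = f x" for x
    using bd[of x] by (simp add: T_def closest_point_self)
  have "f measurable_on UNIV"
    by (rule lebesgue_measurable_imp_measurable_on) (simp_all add: measurable_completion)
  then obtain N h where N: "negligible N" and h: "\<And>n. continuous_on UNIV (h n)"
    and lim: "\<And>x. x \<notin> N \<Longrightarrow> (\<lambda>n. h n x) \<longlonglongrightarrow> f x"
    by (auto simp: measurable_on_def)
  define g where "g n x = T (h n x)" for n x
  have g: "continuous_on UNIV (g n)" for n
    unfolding g_def using continuous_on_compose2[OF cT h] by simp
  then have [measurable]: "g n \<in> borel_measurable borel" for n
    by (simp add: borel_measurable_continuous_onI)
  have "AE x in lebesgue. x \<notin> N"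
    using N by (intro AE_not_in) (simp add: negligible_iff_null_sets)
  then have "AE x in lborel. x \<notin> N" by (simp add: AE_completion_iff)
  then have *: "AE x in restrict_space lborel S. (\<lambda>n. ennreal ((norm (f x - g n x))\<^sup>2)) \<longlonglongrightarrow> 0"
  proof (subst AE_restrict_space_iff, simp, eventually_elim, intro impI)
    fix x assume x: "x \<notin> N"
    have "isCont T (f x)" using cT continuous_on_eq_continuous_at open_UNIV by blast
    then have "(\<lambda>n. g n x) \<longlonglongrightarrow> T (f x)"
      unfolding g_def by (rule isCont_tendsto_compose[OF _ lim[OF x]])
    then have "(\<lambda>n. (norm (f x - g n x))\<^sup>2) \<longlonglongrightarrow> (norm (f x - f x))\<^sup>2"
      unfolding Tf by (intro tendsto_intros)
    then show "(\<lambda>n. ennreal ((norm (f x - g n x))\<^sup>2)) \<longlonglongrightarrow> 0"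
      using tendsto_ennrealI by fastforce
  qed
  have "(\<lambda>n. \<integral>\<^sup>+x. ennreal ((norm (f x - g n x))\<^sup>2) \<partial>restrict_space lborel S) \<longlonglongrightarrow> (\<integral>\<^sup>+x. 0 \<partial>restrict_space lborel S)"
  proof (rule nn_integral_dominated_convergence[OF _ _ _ _ _ *])
    show "AE x in restrict_space lborel S. ennreal ((norm (f x - g n x))\<^sup>2) \<le> ennreal ((2 * b)\<^sup>2)" for n
    proof (intro AE_I2 ennreal_leI power_mono)
      fix x show "norm (f x - g n x) \<le> 2 * b"
        using norm_triangle_ineq4[of "f x" "g n x"] bd[of x] T[of "h n x"] by (simp add: g_def)
    qed simp
    show "(\<integral>\<^sup>+x. ennreal ((2 * b)\<^sup>2) \<partial>restrict_space lborel S) < \<infinity>"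
      using S by (simp add: emeasure_restrict_space ennreal_mult_less_top)
  qed (auto intro!: measurable_restrict_space1)
  then have "(\<lambda>n. \<integral>\<^sup>+x. ennreal ((norm (f x - g n x))\<^sup>2) \<partial>restrict_space lborel S) \<longlonglongrightarrow> 0"
    by simp
  from order_tendstoD(2)[OF this, of "ennreal e"] e
  obtain n where "(\<integral>\<^sup>+x. ennreal ((norm (f x - g n x))\<^sup>2) \<partial>restrict_space lborel S) < ennreal e"
    by (auto simp: eventually_sequentially)
  then show ?thesis using g by (intro exI[of _ "g n"]) simp
qed

text \<open>
  Truncation of the values reduces to the bounded case.
\<close>

lemma continuous_dense_L2:
  fixes f :: "'a::euclidean_space \<Rightarrow> 'b::euclidean_space"
  assumes [measurable]: "f \<in> borel_measurable borel" "S \<in> sets borel"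
    and S: "emeasure lborel S < \<infinity>"
    and f: "(\<integral>\<^sup>+x. ennreal ((norm (f x))\<^sup>2) \<partial>restrict_space lborel S) < \<infinity>" and e: "e > 0"
  shows "\<exists>g. continuous_on UNIV g \<and> (\<integral>\<^sup>+x. ennreal ((norm (f x - g x))\<^sup>2) \<partial>restrict_space lborel S) \<le> ennreal e"
proof -
  define F where "F n x = (if norm (f x) \<le> real n then f x else 0)" for n x
  have [measurable]: "F n \<in> borel_measurable borel" for n unfolding F_def[abs_def] by measurable
  have "(\<lambda>n. \<integral>\<^sup>+x. ennreal ((norm (f x - F n x))\<^sup>2) \<partial>restrict_space lborel S) \<longlonglongrightarrow> (\<integral>\<^sup>+x. 0 \<partial>restrict_space lborel S)"
  proof (rule nn_integral_dominated_convergence[OF _ _ _ _ f])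
    show "AE x in restrict_space lborel S. ennreal ((norm (f x - F n x))\<^sup>2) \<le> ennreal ((norm (f x))\<^sup>2)" for n
      by (auto simp: F_def)
    show "AE x in restrict_space lborel S. (\<lambda>n. ennreal ((norm (f x - F n x))\<^sup>2)) \<longlonglongrightarrow> 0"
    proof (rule AE_I2)
      fix x
      obtain m :: nat where m: "norm (f x) \<le> real m" using real_arch_simple by blast
      then have "\<forall>\<^sub>F n in sequentially. norm (f x) \<le> real n"
        by (auto intro!: eventually_sequentiallyI[of m])
      then have "\<forall>\<^sub>F n in sequentially. 0 = ennreal ((norm (f x - F n x))\<^sup>2)"
        by eventually_elim (simp add: F_def)
      then show "(\<lambda>n. ennreal ((norm (f x - F n x))\<^sup>2)) \<longlonglongrightarrow> 0"
        by (rule Lim_transform_eventually[OF tendsto_const])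
    qed
  qed (auto intro!: measurable_restrict_space1)
  then have "(\<lambda>n. \<integral>\<^sup>+x. ennreal ((norm (f x - F n x))\<^sup>2) \<partial>restrict_space lborel S) \<longlonglongrightarrow> 0"
    by simp
  from order_tendstoD(2)[OF this, of "ennreal (e / 4)"] e
  obtain n where n: "(\<integral>\<^sup>+x. ennreal ((norm (f x - F n x))\<^sup>2) \<partial>restrict_space lborel S) < ennreal (e / 4)"
    by (auto simp: eventually_sequentially)
  have "norm (F n x) \<le> real n" for x by (simp add: F_def)
  then have "\<exists>g. continuous_on UNIV g \<and> (\<integral>\<^sup>+x. ennreal ((norm (F n x - g x))\<^sup>2) \<partial>restrict_space lborel S) \<le> ennreal (e / 4)"
    using e S by (intro continuous_dense_L2_bounded[of "F n" S "real n" "e / 4"]) simp_all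
  then obtain g where g: "continuous_on UNIV g"
    "(\<integral>\<^sup>+x. ennreal ((norm (F n x - g x))\<^sup>2) \<partial>restrict_space lborel S) \<le> ennreal (e / 4)"
    by (elim exE conjE)
  have [measurable]: "g \<in> borel_measurable borel" using g by (simp add: borel_measurable_continuous_onI)
  have "(\<integral>\<^sup>+x. ennreal ((norm (f x - g x))\<^sup>2) \<partial>restrict_space lborel S) \<le>
    2 * (\<integral>\<^sup>+x. ennreal ((norm (f x - F n x))\<^sup>2) \<partial>restrict_space lborel S) +
    2 * (\<integral>\<^sup>+x. ennreal ((norm (F n x - g x))\<^sup>2) \<partial>restrict_space lborel S)"
    using nn_integral_square_add_le[of "\<lambda>x. f x - F n x" "restrict_space lborel S" "\<lambda>x. F n x - g x"]
    by (simp add: measurable_restrict_space1)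
  also have "\<dots> \<le> 2 * ennreal (e / 4) + 2 * ennreal (e / 4)"
    using n g(2) by (intro add_mono mult_left_mono) auto
  also have "2 * ennreal (e / 4) = ennreal (e / 2)"
    using e ennreal_mult[of 2 "e / 4"] by simp
  also have "ennreal (e / 2) + ennreal (e / 2) = ennreal e"
    using e by (simp flip: ennreal_plus)
  finally show ?thesis using g by blast
qed

definition locally_L2 :: "(real^'n \<Rightarrow> 'b::euclidean_space) \<Rightarrow> bool" where
  "locally_L2 f \<longleftrightarrow> f \<in> borel_measurable borel \<and>
    (\<forall>R. (\<integral>\<^sup>+x\<in>cball 0 R. ennreal ((norm (f x))\<^sup>2) \<partial>lborel) < \<infinity>)"

lemma nn_integral_cball_eq:
  "(\<integral>\<^sup>+x\<in>cball 0 R. f x \<partial>lborel) = (\<integral>\<^sup>+x. f x \<partial>restrict_space lborel (cball 0 R))"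
  for f :: "'a::euclidean_space \<Rightarrow> ennreal"
  by (simp add: nn_integral_restrict_space)

text \<open>
  Uniform continuity on compact sets gives this for continuous functions, and density transfers it to \<open>f\<close>.
\<close>

lemma L2_translation_continuous:
  fixes f :: "real^'n \<Rightarrow> 'b::euclidean_space"
  assumes f: "locally_L2 f" and e: "e > 0"
  shows "\<exists>d>0. \<forall>s. norm s \<le> d \<longrightarrow>
    (\<integral>\<^sup>+x\<in>cball 0 R. ennreal ((norm (f (x + s) - f x))\<^sup>2) \<partial>lborel) \<le> ennreal e"
proof -
  let ?B = "\<lambda>R. restrict_space lborel (cball (0 :: real^'n) R)"
  have [measurable]: "cball (0 :: real^'n) R \<in> sets borel" for R by simp
  have [measurable]: "f \<in> borel_measurable borel" using f by (simp add: locally_L2_def)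
  \<comment> \<open>Two applications of the parallelogram inequality to three errors of size \<open>\<eta>\<close> cost a factor of \<open>10\<close>.\<close>
  define \<eta> where "\<eta> = e / 12"
  have \<eta>: "\<eta> > 0" using e by (simp add: \<eta>_def)
  obtain g where g: "continuous_on UNIV g" and fg: "(\<integral>\<^sup>+x. ennreal ((norm (f x - g x))\<^sup>2) \<partial>?B (R + 1)) \<le> ennreal \<eta>"
    using continuous_dense_L2[of f "cball 0 (R + 1)" \<eta>] f \<eta> emeasure_lborel_cball_finite[of 0 "R + 1"]
    unfolding locally_L2_def nn_integral_cball_eq by auto
  have [measurable]: "g \<in> borel_measurable borel" using g by (simp add: borel_measurable_continuous_onI)
  define V where "V = measure lborel (cball (0 :: real^'n) R)"
  have V: "emeasure lborel (cball (0 :: real^'n) R) = ennreal V"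
    unfolding V_def by (rule emeasure_eq_ennreal_measure) (use emeasure_lborel_cball_finite[of "0 :: real^'n" R] in auto)
  define t where "t = sqrt (\<eta> / (V + 1))"
  have "V \<ge> 0" by (simp add: V_def)
  then have t: "t > 0" using \<eta> by (simp add: t_def)
  have "uniformly_continuous_on (cball 0 (R + 1)) g"
    by (intro compact_uniformly_continuous continuous_on_subset[OF g]) auto
  then obtain d where d: "d > 0" "\<And>x y. x \<in> cball 0 (R + 1) \<Longrightarrow> y \<in> cball 0 (R + 1) \<Longrightarrow> dist y x < d \<Longrightarrow> dist (g y) (g x) < t"
    unfolding uniformly_continuous_on_def using t by metis
  show ?thesis
  proof (intro exI[of _ "min 1 (d/2)"] conjI allI impI)
    show "min 1 (d/2) > 0" using d by simp
    fix s :: "real^'n" assume s: "norm s \<le> min 1 (d/2)"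
    have in1: "x + s \<in> cball 0 (R + 1)" "x \<in> cball 0 (R + 1)" if "x \<in> cball 0 R" for x
      using that s norm_triangle_ineq[of x s] by simp_all
    let ?I = "\<lambda>h. \<integral>\<^sup>+x. ennreal ((norm (h x :: 'b))\<^sup>2) \<partial>?B R"
    have 1: "?I (\<lambda>x. f (x + s) - g (x + s)) \<le> ennreal \<eta>"
    proof -
      have "?I (\<lambda>x. f (x + s) - g (x + s)) =
        (\<integral>\<^sup>+x. ennreal ((norm (f (x + s) - g (x + s)))\<^sup>2) * indicator (cball 0 R) x \<partial>lborel)"
        by (simp add: nn_integral_restrict_space)
      also have "\<dots> \<le> (\<integral>\<^sup>+x. ennreal ((norm (f (x + s) - g (x + s)))\<^sup>2) * indicator (cball 0 (R + 1)) (x + s) \<partial>lborel)"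
        using in1(1) by (intro nn_integral_mono mult_left_mono) (auto simp: indicator_def simp del: mem_cball)
      also have "\<dots> = (\<integral>\<^sup>+x. ennreal ((norm (f x - g x))\<^sup>2) * indicator (cball 0 (R + 1)) x \<partial>lborel)"
        by (rule nn_integral_translate[of "\<lambda>x. ennreal ((norm (f x - g x))\<^sup>2) * indicator (cball 0 (R + 1)) x"]) auto
      also have "\<dots> \<le> ennreal \<eta>" using fg by (simp add: nn_integral_restrict_space)
      finally show ?thesis .
    qed
    have 2: "?I (\<lambda>x. g (x + s) - g x) \<le> ennreal \<eta>"
    proof -
      have "?I (\<lambda>x. g (x + s) - g x) \<le> (\<integral>\<^sup>+x. ennreal (\<eta> / (V + 1)) \<partial>?B R)"
      proof (intro nn_integral_mono ennreal_leI)
        fix x assume "x \<in> space (?B R)"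
        then have x: "x \<in> cball 0 R" by (simp add: space_restrict_space)
        have "norm (g (x + s) - g x) < t"
          using d(2)[OF in1(2)[OF x] in1(1)[OF x]] s d(1) by (simp add: dist_norm)
        then have "(norm (g (x + s) - g x))\<^sup>2 \<le> t\<^sup>2" by (intro power_mono) auto
        then show "(norm (g (x + s) - g x))\<^sup>2 \<le> \<eta> / (V + 1)" using \<eta> \<open>V \<ge> 0\<close> by (simp add: t_def)
      qed
      also have "\<dots> = ennreal (\<eta> / (V + 1)) * ennreal V"
        by (simp add: emeasure_restrict_space V)
      also have "\<dots> = ennreal (\<eta> / (V + 1) * V)"
        using \<eta> \<open>V \<ge> 0\<close> by (intro ennreal_mult[symmetric]) auto
      also have "\<dots> \<le> ennreal \<eta>"
        using \<eta> \<open>V \<ge> 0\<close> by (intro ennreal_leI) (simp add: field_simps)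
      finally show ?thesis .
    qed
    have 3: "?I (\<lambda>x. g x - f x) \<le> ennreal \<eta>"
    proof -
      have "?I (\<lambda>x. g x - f x) \<le> (\<integral>\<^sup>+x. ennreal ((norm (f x - g x))\<^sup>2) \<partial>?B (R + 1))"
        using in1(2) by (auto simp: nn_integral_restrict_space norm_minus_commute simp del: mem_cball
            intro!: nn_integral_mono mult_left_mono split: split_indicator)
      then show ?thesis using fg by (rule order_trans)
    qed
    have "?I (\<lambda>x. f (x + s) - f x) \<le> 2 * ?I (\<lambda>x. f (x + s) - g (x + s)) + 2 * ?I (\<lambda>x. (g (x + s) - g x) + (g x - f x))"
      using nn_integral_square_add_le[of "\<lambda>x. f (x + s) - g (x + s)" "?B R" "\<lambda>x. (g (x + s) - g x) + (g x - f x)"]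
      by (simp add: measurable_restrict_space1)
    also have "\<dots> \<le> 2 * ?I (\<lambda>x. f (x + s) - g (x + s)) + 2 * (2 * ?I (\<lambda>x. g (x + s) - g x) + 2 * ?I (\<lambda>x. g x - f x))"
      by (intro add_left_mono mult_left_mono nn_integral_square_add_le) (simp_all add: measurable_restrict_space1)
    also have "\<dots> \<le> 2 * ennreal \<eta> + 2 * (2 * ennreal \<eta> + 2 * ennreal \<eta>)"
      by (intro add_mono mult_left_mono 1 2 3) auto
    also have "2 * ennreal \<eta> = ennreal (2 * \<eta>)"
      using \<eta> ennreal_mult[of 2 \<eta>] by simp
    also have "ennreal (2 * \<eta>) + 2 * (ennreal (2 * \<eta>) + ennreal (2 * \<eta>)) = ennreal (2 * \<eta> + 2 * (2 * \<eta> + 2 * \<eta>))"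
    proof -
      have "2 * ennreal (4 * \<eta>) = ennreal (8 * \<eta>)"
        using \<eta> ennreal_mult[of 2 "4 * \<eta>"] by simp
      then show ?thesis using \<eta> by (simp flip: ennreal_plus)
    qed
    also have "\<dots> \<le> ennreal e" using e by (intro ennreal_leI) (simp add: \<eta>_def)
    finally show "(\<integral>\<^sup>+x\<in>cball 0 R. ennreal ((norm (f (x + s) - f x))\<^sup>2) \<partial>lborel) \<le> ennreal e"
      unfolding nn_integral_cball_eq .
  qed
qed

lemma locally_L2_imp_locally_integrable:
  assumes "locally_L2 f" shows "locally_integrable f"
  unfolding locally_integrable_def
proof (intro conjI allI)
  show f: "f \<in> borel_measurable borel" using assms by (simp add: locally_L2_def)
  fix R
  have [measurable]: "f \<in> borel_measurable borel" "cball (0 :: real^'a) R \<in> sets borel"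
    by (simp_all add: f)
  show "set_integrable lborel (cball 0 R) f"
    unfolding set_integrable_def
  proof (rule integrableI_bounded)
    show "(\<lambda>x. indicat_real (cball 0 R) x *\<^sub>R f x) \<in> borel_measurable lborel" by measurable
    have "(\<integral>\<^sup>+x. ennreal (norm (indicat_real (cball 0 R) x *\<^sub>R f x)) \<partial>lborel)
      \<le> (\<integral>\<^sup>+x. indicator (cball 0 R) x + ennreal ((norm (f x))\<^sup>2) * indicator (cball 0 R) x \<partial>lborel)"
    proof (rule nn_integral_mono)
      fix x
      have "norm (f x) \<le> 1 + (norm (f x))\<^sup>2"
        using sum_squares_bound[of 1 "norm (f x)"] norm_ge_zero[of "f x"]
        unfolding one_power2 mult_1_right by linarith
      then have "ennreal (norm (f x)) \<le> ennreal (1 + (norm (f x))\<^sup>2)" by (rule ennreal_leI)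
      then have "ennreal (norm (f x)) \<le> 1 + ennreal ((norm (f x))\<^sup>2)" by simp
      then show "ennreal (norm (indicat_real (cball 0 R) x *\<^sub>R f x)) \<le> indicator (cball 0 R) x + ennreal ((norm (f x))\<^sup>2) * indicator (cball 0 R) x"
        by (cases "x \<in> cball 0 R") (simp_all del: mem_cball)
    qed
    also have "\<dots> = emeasure lborel (cball (0::real^'a) R) + (\<integral>\<^sup>+x\<in>cball 0 R. ennreal ((norm (f x))\<^sup>2) \<partial>lborel)"
      by (subst nn_integral_add) auto
    also have "\<dots> < \<infinity>"
      using assms emeasure_lborel_cball_finite[of 0 R] by (simp add: locally_L2_def)
    finally show "(\<integral>\<^sup>+x. ennreal (norm (indicat_real (cball 0 R) x *\<^sub>R f x)) \<partial>lborel) < \<infinity>" .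
  qed
qed

lemma avg_L2_tendsto:
  fixes f :: "real^'n \<Rightarrow> 'b::euclidean_space"
  assumes f: "locally_L2 f" and M: "\<And>m. kernel (M m) (r m)" and r: "r \<longlonglongrightarrow> 0"
  shows "(\<lambda>m. \<integral>\<^sup>+x\<in>cball 0 R. ennreal ((norm (avg (M m) f x - f x))\<^sup>2) \<partial>lborel) \<longlonglongrightarrow> 0"
proof (rule order_tendstoI)
  fix a :: ennreal assume "0 < a"
  then obtain b where b: "0 < b" "b < a" using dense by blast
  then obtain e where "b = ennreal e" "e \<ge> 0" by (cases b) auto
  then have e: "0 < e" "ennreal e < a" using b by simp_all
  obtain d where d: "d > 0" "\<And>s. norm s \<le> d \<Longrightarrow>
    (\<integral>\<^sup>+x\<in>cball 0 R. ennreal ((norm (f (x + s) - f x))\<^sup>2) \<partial>lborel) \<le> ennreal e"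
    using L2_translation_continuous[OF f e(1)] by blast
  have "\<forall>\<^sub>F m in sequentially. r m < d" using order_tendstoD(2)[OF r d(1)] .
  then show "\<forall>\<^sub>F m in sequentially. (\<integral>\<^sup>+x\<in>cball 0 R. ennreal ((norm (avg (M m) f x - f x))\<^sup>2) \<partial>lborel) < a"
  proof eventually_elim
    case (elim m)
    interpret kernel "M m" "r m" by (rule M)
    have "(\<integral>\<^sup>+x\<in>cball 0 R. ennreal ((norm (avg (M m) f x - f x))\<^sup>2) \<partial>lborel) \<le>
      (\<integral>\<^sup>+s. (\<integral>\<^sup>+x\<in>cball 0 R. ennreal ((norm (f (x + s) - f x))\<^sup>2) \<partial>lborel) \<partial>M m)"
      by (rule nn_integral_avg_error[OF locally_L2_imp_locally_integrable[OF f]])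
    also have "\<dots> \<le> (\<integral>\<^sup>+s. ennreal e \<partial>M m)"
      using support by (intro nn_integral_mono_AE, eventually_elim) (use elim d in auto)
    also have "\<dots> = ennreal e" by (simp add: emeasure_space_1)
    finally show ?case using e by simp
  qed
qed simp

section \<open>Periodic functions\<close>

definition ivec :: "int^'n \<Rightarrow> real^'n" where "ivec w = (\<chi> i. of_int (w $ i))"

definition periodic :: "nat \<Rightarrow> (real^'n \<Rightarrow> 'b) \<Rightarrow> bool" where
  "periodic k f \<longleftrightarrow> (\<forall>w x. f (x + real k *\<^sub>R ivec w) = f x)"

text \<open>
  The translate of \<open>x\<close> by periods that lies in the cell. Composition with this map makes a function periodic
  everywhere when it was periodic almost everywhere.
\<close>

definition cell_part :: "nat \<Rightarrow> real^'n \<Rightarrow> real^'n" where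
  "cell_part k x = x + real k *\<^sub>R ivec (\<chi> i. - \<lfloor>x $ i / real k\<rfloor>)"

lemma cell_periodic_iff: "cell_periodic k u \<longleftrightarrow> (\<forall>w. AE y in lebesgue. u (y + real k *\<^sub>R ivec w) = u y)"
proof -
  have "(\<forall>i. z $ i \<in> \<int>) \<longleftrightarrow> (\<exists>w. z = ivec w)" for z :: "real^'a"
  proof
    assume "\<forall>i. z $ i \<in> \<int>"
    then have "z = ivec (\<chi> i. \<lfloor>z $ i\<rfloor>)" by (simp add: vec_eq_iff ivec_def)
    then show "\<exists>w. z = ivec w" by blast
  qed (auto simp: ivec_def)
  then show ?thesis by (auto simp: cell_periodic_def)
qed

lemma periodic_imp_cell_periodic: "periodic k f \<Longrightarrow> cell_periodic k f"
  by (simp add: periodic_def cell_periodic_iff)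

lemma periodic_cell_part: "periodic k f \<Longrightarrow> f (cell_part k x) = f x"
  by (simp add: periodic_def cell_part_def)

lemma lattice_point_in_cell:
  assumes "k \<ge> 1"
  shows "x + real k *\<^sub>R ivec w \<in> cell k \<longleftrightarrow> w = (\<chi> i. - \<lfloor>x $ i / real k\<rfloor>)"
proof -
  have k: "real k > 0" using assms by simp
  have "0 \<le> x $ i + real k * of_int (w $ i) \<and> x $ i + real k * of_int (w $ i) < real k \<longleftrightarrow> w $ i = - \<lfloor>x $ i / real k\<rfloor>" for i
  proof -
    have "w $ i = - \<lfloor>x $ i / real k\<rfloor> \<longleftrightarrow> \<lfloor>x $ i / real k\<rfloor> = - w $ i" by auto
    also have "\<dots> \<longleftrightarrow> real_of_int (- w $ i) \<le> x $ i / real k \<and> x $ i / real k < real_of_int (- w $ i) + 1"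
      by (rule floor_eq_iff)
    also have "\<dots> \<longleftrightarrow> 0 \<le> x $ i + real k * of_int (w $ i) \<and> x $ i + real k * of_int (w $ i) < real k"
      unfolding pos_le_divide_eq[OF k] pos_divide_less_eq[OF k] by (auto simp: algebra_simps)
    finally show ?thesis by simp
  qed
  then show ?thesis by (simp add: cell_def ivec_def vec_eq_iff)
qed

lemma cell_part_in_cell: "k \<ge> 1 \<Longrightarrow> cell_part k x \<in> cell k"
  unfolding cell_part_def by (simp add: lattice_point_in_cell)

lemma borel_measurable_vecI:
  fixes f :: "'a \<Rightarrow> real^'n"
  assumes "\<And>i. (\<lambda>x. f x $ i) \<in> borel_measurable M"
  shows "f \<in> borel_measurable M"
proof (subst borel_measurable_euclidean_space, intro ballI)
  fix b :: "real^'n" assume "b \<in> Basis"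
  then obtain i where "b = axis i 1" by (auto simp: Basis_vec_def)
  then show "(\<lambda>x. f x \<bullet> b) \<in> borel_measurable M" using assms by (simp add: inner_axis)
qed

lemma borel_measurable_cell_part [measurable]: "cell_part k \<in> borel_measurable borel"
  by (rule borel_measurable_vecI) (simp add: cell_part_def ivec_def)

lemma cell_part_periodic: "k \<ge> 1 \<Longrightarrow> periodic k (cell_part k)"
  unfolding periodic_def
proof (intro allI)
  fix w and x :: "real^'a" assume k: "k \<ge> 1"
  have "(x $ i + real k * real_of_int (w $ i)) / real k = x $ i / real k + of_int (w $ i)" for i
    using k by (simp add: add_divide_distrib)
  then show "cell_part k (x + real k *\<^sub>R ivec w) = cell_part k x"
    by (simp add: cell_part_def ivec_def vec_eq_iff algebra_simps)
qed

lemma sets_cell [measurable]: "cell k \<in> sets borel"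
proof -
  have "cell k = (\<Inter>i. {y :: real^'a. 0 \<le> y $ i} \<inter> {y. y $ i < real k})"
    by (auto simp: cell_def)
  also have "\<dots> \<in> sets borel"
    by (intro sets.countable_INT'') auto
  finally show ?thesis .
qed

lemma emeasure_cell: "emeasure lborel (cell k :: (real^'n) set) = ennreal (real k ^ CARD('n))"
proof (rule antisym)
  have p: "(\<Prod>b\<in>Basis. (vec (real k) - 0 :: real^'n) \<bullet> b) = real k ^ CARD('n)"
  proof -
    have B: "Basis = range (\<lambda>i. axis i (1 :: real) :: real^'n)" by (auto simp: Basis_vec_def)
    have "inj (\<lambda>i. axis i (1 :: real) :: real^'n)" by (auto simp: inj_on_def axis_eq_axis)
    then show ?thesis unfolding B by (subst prod.reindex) (simp_all add: inner_axis)
  qed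
  have b: "(0 :: real^'n) \<bullet> b \<le> vec (real k) \<bullet> b" if "b \<in> Basis" for b :: "real^'n"
    using that by (auto simp: Basis_vec_def inner_axis)
  have "emeasure lborel (cell k :: (real^'n) set) \<le> emeasure lborel (cbox 0 (vec (real k)) :: (real^'n) set)"
    by (rule emeasure_mono) (auto simp: cell_def mem_box_cart less_imp_le)
  also have "\<dots> = ennreal (real k ^ CARD('n))"
    using emeasure_lborel_cbox[OF b] p by simp
  finally show "emeasure lborel (cell k :: (real^'n) set) \<le> ennreal (real k ^ CARD('n))" .
  have "ennreal (real k ^ CARD('n)) = emeasure lborel (box 0 (vec (real k)) :: (real^'n) set)"
    using emeasure_lborel_box[OF b] p by simp
  also have "\<dots> \<le> emeasure lborel (cell k :: (real^'n) set)"
    by (rule emeasure_mono) (auto simp: cell_def mem_box_cart less_imp_le)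
  finally show "ennreal (real k ^ CARD('n)) \<le> emeasure lborel (cell k :: (real^'n) set)" .
qed

text \<open>
  Each point has exactly one translate by periods in the cell. Inserting this count and exchanging the integral with
  the sum over the lattice moves the domain of integration from \<open>D\<close> to the cell, weighted with the number of
  translates that lie in \<open>D\<close>.
\<close>

lemma nn_integral_periodic_unfold:
  fixes f :: "real^'n \<Rightarrow> ennreal"
  assumes k: "k \<ge> 1" and f[measurable]: "f \<in> borel_measurable borel" and per: "periodic k f" and D[measurable]: "D \<in> sets borel"
  shows "(\<integral>\<^sup>+x\<in>D. f x \<partial>lborel) =
    (\<integral>\<^sup>+x\<in>cell k. f x * emeasure (count_space UNIV) {w. x + real k *\<^sub>R ivec w \<in> D} \<partial>lborel)"
proof -
  interpret C: sigma_finite_measure "count_space (UNIV :: (int^'n) set)"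
    by (rule sigma_finite_measure_count_space_countable) simp
  interpret P: pair_sigma_finite "count_space (UNIV :: (int^'n) set)" "lborel :: (real^'n) measure" ..
  have pm: "(\<lambda>(w, x). h w x) \<in> borel_measurable (count_space (UNIV :: (int^'n) set) \<Otimes>\<^sub>M (lborel :: (real^'n) measure))"
    if "\<And>w. h w \<in> borel_measurable borel" for h :: "int^'n \<Rightarrow> real^'n \<Rightarrow> ennreal"
    by (rule measurable_pair_measure_countable1) (use that in auto)
  have count: "(\<integral>\<^sup>+w. c * indicator A w \<partial>count_space UNIV) = c * emeasure (count_space UNIV) A" for c and A :: "(int^'n) set"
    by (simp add: nn_integral_cmult_indicator)
  have one: "emeasure (count_space UNIV) {w. y - real k *\<^sub>R ivec w \<in> cell k} = 1" for y :: "real^'n"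
  proof -
    have neg: "y - real k *\<^sub>R ivec w = y + real k *\<^sub>R ivec (- w)" for w by (simp add: ivec_def vec_eq_iff)
    have "{w. y - real k *\<^sub>R ivec w \<in> cell k} = {(\<chi> i. \<lfloor>y $ i / real k\<rfloor>)}"
      unfolding neg lattice_point_in_cell[OF k] by (auto simp: vec_eq_iff minus_equation_iff[of "_ $ _"])
    then show ?thesis by simp
  qed
  have "(\<integral>\<^sup>+x\<in>cell k. f x * emeasure (count_space UNIV) {w. x + real k *\<^sub>R ivec w \<in> D} \<partial>lborel) =
    (\<integral>\<^sup>+x. \<integral>\<^sup>+w. f x * indicator (cell k) x * indicator D (x + real k *\<^sub>R ivec w) \<partial>count_space UNIV \<partial>lborel)"
  proof (rule nn_integral_cong)
    fix x
    show "f x * emeasure (count_space UNIV) {w. x + real k *\<^sub>R ivec w \<in> D} * indicator (cell k) x =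
      (\<integral>\<^sup>+w. f x * indicator (cell k) x * indicator D (x + real k *\<^sub>R ivec w) \<partial>count_space UNIV)"
      using count[of "f x * indicator (cell k) x" "{w. x + real k *\<^sub>R ivec w \<in> D}"]
      by (simp add: indicator_def mult_ac)
  qed
  also have "\<dots> = (\<integral>\<^sup>+w. \<integral>\<^sup>+x. f x * indicator (cell k) x * indicator D (x + real k *\<^sub>R ivec w) \<partial>lborel \<partial>count_space UNIV)"
    by (rule P.Fubini'[OF pm]) measurable
  also have "\<dots> = (\<integral>\<^sup>+w. \<integral>\<^sup>+x. f x * indicator D x * indicator (cell k) (x - real k *\<^sub>R ivec w) \<partial>lborel \<partial>count_space UNIV)"
  proof (rule nn_integral_cong)
    fix w :: "int^'n"
    show "(\<integral>\<^sup>+x. f x * indicator (cell k) x * indicator D (x + real k *\<^sub>R ivec w) \<partial>lborel) =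
       (\<integral>\<^sup>+x. f x * indicator D x * indicator (cell k) (x - real k *\<^sub>R ivec w) \<partial>lborel)"
      using nn_integral_translate[of "\<lambda>x. f x * indicator D x * indicator (cell k) (x - real k *\<^sub>R ivec w)" "real k *\<^sub>R ivec w"] per
      by (simp add: periodic_def mult_ac)
  qed
  also have "\<dots> = (\<integral>\<^sup>+x. \<integral>\<^sup>+w. f x * indicator D x * indicator (cell k) (x - real k *\<^sub>R ivec w) \<partial>count_space UNIV \<partial>lborel)"
    by (rule P.Fubini'[OF pm, symmetric]) measurable
  also have "\<dots> = (\<integral>\<^sup>+x\<in>D. f x \<partial>lborel)"
  proof (rule nn_integral_cong)
    fix x
    show "(\<integral>\<^sup>+w. f x * indicator D x * indicator (cell k) (x - real k *\<^sub>R ivec w) \<partial>count_space UNIV) = f x * indicator D x"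
      using count[of "f x * indicator D x" "{w. x - real k *\<^sub>R ivec w \<in> cell k}"] unfolding one
      by (simp add: indicator_def)
  qed
  finally show ?thesis by simp
qed

section \<open>The torus\<close>

text \<open>
  Normalised, so that integrals are means over the cell and those of \<open>periodic 1\<close> functions do not depend on
  \<open>k\<close>.
\<close>

definition torus :: "nat \<Rightarrow> (real^'n) measure" where
  "torus k = uniform_measure lborel (cell k)"

lemma sets_torus [measurable_cong, simp]: "sets (torus k) = sets borel"
  by (simp add: torus_def)

lemma space_torus [simp]: "space (torus k) = UNIV"
  by (simp add: torus_def)

lemma prob_space_torus: "k \<ge> 1 \<Longrightarrow> prob_space (torus k)"
  unfolding torus_def by (rule prob_space_uniform_measure) (simp_all add: emeasure_cell ennreal_eq_0_iff not_le)

lemma AE_torusI: "AE x in lborel. P x \<Longrightarrow> AE x in torus k. P x"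
  unfolding torus_def by (rule AE_uniform_measureI) (auto elim: eventually_mono)

lemma nn_integral_torus:
  fixes f :: "real^'n \<Rightarrow> ennreal"
  assumes "f \<in> borel_measurable borel"
  shows "(\<integral>\<^sup>+x. f x \<partial>torus k) = (\<integral>\<^sup>+x\<in>cell k. f x \<partial>lborel) / ennreal (real k ^ CARD('n))"
  unfolding torus_def using assms by (subst nn_integral_uniform_measure) (simp_all add: emeasure_cell)

text \<open>
  A translate of the cell contains exactly one translate by periods of each point as well.
\<close>

lemma nn_integral_torus_translate:
  fixes f :: "real^'n \<Rightarrow> ennreal"
  assumes k: "k \<ge> 1" and f[measurable]: "f \<in> borel_measurable borel" and per: "periodic k f"
  shows "(\<integral>\<^sup>+x. f (x + s) \<partial>torus k) = (\<integral>\<^sup>+x. f x \<partial>torus k)"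
proof -
  have D[measurable]: "{x. x - s \<in> cell k} \<in> sets borel" by measurable
  have "(\<integral>\<^sup>+x\<in>cell k. f (x + s) \<partial>lborel) = (\<integral>\<^sup>+x\<in>{x. x - s \<in> cell k}. f x \<partial>lborel)"
    using nn_integral_translate[of "\<lambda>x. f x * indicator {x. x - s \<in> cell k} x" s]
    by (simp add: indicator_def)
  also have "\<dots> = (\<integral>\<^sup>+x\<in>cell k. f x * emeasure (count_space UNIV) {w. x + real k *\<^sub>R ivec w \<in> {x. x - s \<in> cell k}} \<partial>lborel)"
    by (rule nn_integral_periodic_unfold[OF k f per D])
  also have "\<dots> = (\<integral>\<^sup>+x\<in>cell k. f x \<partial>lborel)"
  proof (rule nn_integral_cong)
    fix x
    have "{w. x + real k *\<^sub>R ivec w \<in> {x. x - s \<in> cell k}} = {w. (x - s) + real k *\<^sub>R ivec w \<in> cell k}"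
      by (simp add: algebra_simps)
    also have "\<dots> = {(\<chi> i. - \<lfloor>(x - s) $ i / real k\<rfloor>)}"
      unfolding lattice_point_in_cell[OF k] by simp
    finally show "f x * emeasure (count_space UNIV) {w. x + real k *\<^sub>R ivec w \<in> {x. x - s \<in> cell k}} * indicator (cell k) x = f x * indicator (cell k) x"
      by simp
  qed
  finally show ?thesis by (simp add: nn_integral_torus)
qed

text \<open>
  The larger cell contains the same number \<open>c\<close> of translates of each point of the smaller cell; the constant
  function \<open>1\<close> identifies \<open>c\<close> as the ratio of the volumes.
\<close>

lemma nn_integral_torus_mult:
  fixes f :: "real^'n \<Rightarrow> ennreal"
  assumes k: "k \<ge> 1" and m: "m \<ge> 1" and f[measurable]: "f \<in> borel_measurable borel" and per: "periodic k f"
  shows "(\<integral>\<^sup>+x. f x \<partial>torus (k * m)) = (\<integral>\<^sup>+x. f x \<partial>torus k)"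
proof -
  define c where "c = emeasure (count_space UNIV) {w :: int^'n. \<forall>i. 0 \<le> w $ i \<and> w $ i < int m}"
  have eq: "{w. x + real k *\<^sub>R ivec w \<in> cell (k * m)} = {w :: int^'n. \<forall>i. 0 \<le> w $ i \<and> w $ i < int m}" if x: "x \<in> cell k" for x :: "real^'n"
  proof -
    have "0 \<le> x $ i + real k * of_int (w $ i) \<and> x $ i + real k * of_int (w $ i) < real (k * m) \<longleftrightarrow> 0 \<le> w $ i \<and> w $ i < int m" for w :: "int^'n" and i
    proof -
      have xi: "0 \<le> x $ i" "x $ i < real k" using x by (auto simp: cell_def)
      have 1: "x $ i + real k * of_int (w $ i) < 0" if "w $ i < 0"
      proof -
        have "real k * of_int (w $ i) \<le> real k * (- 1)" using that by (intro mult_left_mono) auto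
        then show ?thesis using xi by simp
      qed
      have 2: "x $ i + real k * of_int (w $ i) \<ge> real (k * m)" if "w $ i \<ge> int m"
      proof -
        have "real m \<le> real_of_int (w $ i)" using that by linarith
        then have "real k * of_int (w $ i) \<ge> real k * real m" by (intro mult_left_mono) auto
        then show ?thesis using xi unfolding of_nat_mult by linarith
      qed
      have 3: "x $ i + real k * of_int (w $ i) < real (k * m)" if "w $ i < int m"
      proof -
        have "real_of_int (w $ i) \<le> real m - 1" using that by linarith
        then have "real k * of_int (w $ i) \<le> real k * (real m - 1)" by (intro mult_left_mono) auto
        then show ?thesis using xi by (simp add: algebra_simps)
      qed
      have 4: "0 \<le> x $ i + real k * of_int (w $ i)" if "0 \<le> w $ i" using that xi by simp
      show ?thesis using 1 2 3 4 by (meson not_le)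
    qed
    then show ?thesis by (auto simp: cell_def ivec_def)
  qed
  have u: "(\<integral>\<^sup>+x\<in>cell (k * m). g x \<partial>lborel) = c * (\<integral>\<^sup>+x\<in>cell k. g x \<partial>lborel)"
    if [measurable]: "g \<in> borel_measurable borel" and "periodic k g" for g :: "real^'n \<Rightarrow> ennreal"
  proof -
    have "(\<integral>\<^sup>+x\<in>cell (k * m). g x \<partial>lborel) = (\<integral>\<^sup>+x. c * (g x * indicator (cell k) x) \<partial>lborel)"
      unfolding nn_integral_periodic_unfold[OF k that sets_cell]
      by (intro nn_integral_cong) (auto simp: indicator_def eq c_def mult_ac)
    then show ?thesis by (simp add: nn_integral_cmult)
  qed
  have km: "ennreal (real (k * m) ^ CARD('n)) = c * ennreal (real k ^ CARD('n))"
    using u[of "\<lambda>_. 1"] by (simp add: periodic_def emeasure_cell)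
  have pos: "0 < real (k * m) ^ CARD('n)" "0 < real k ^ CARD('n)" using k m by simp_all
  have "c \<noteq> top"
  proof
    assume "c = top"
    then have "ennreal (real (k * m) ^ CARD('n)) = top"
      unfolding km using pos(2) by (simp add: ennreal_top_mult)
    then show False by simp
  qed
  then obtain c' where c': "c = ennreal c'" "c' \<ge> 0" by (cases c) auto
  then have eq': "real (k * m) ^ CARD('n) = c' * real k ^ CARD('n)"
    using km pos by (simp flip: ennreal_mult)
  then have "c' > 0" using pos c'(2) by (metis less_eq_real_def mult_zero_left)
  have "c * A / ennreal (real (k * m) ^ CARD('n)) = A / ennreal (real k ^ CARD('n))" for A
  proof -
    have "c * A / ennreal (real (k * m) ^ CARD('n)) = A * (ennreal c' * ennreal (inverse (c' * real k ^ CARD('n))))"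
      using pos unfolding eq' c'(1) divide_ennreal_def by (subst inverse_ennreal) (simp_all add: mult_ac)
    also have "ennreal c' * ennreal (inverse (c' * real k ^ CARD('n))) = ennreal (inverse (real k ^ CARD('n)))"
      using \<open>c' > 0\<close> pos by (subst ennreal_mult[symmetric]) (simp_all add: field_simps)
    finally show ?thesis using pos by (simp add: divide_ennreal_def inverse_ennreal)
  qed
  then show ?thesis unfolding nn_integral_torus[OF f] u[OF f per] .
qed

text \<open>
  A periodic function factors through \<open>cell_part\<close>, so both integrals are taken with respect to an image measure
  under this map. The hypothesis on nonnegative integrals says that the two image measures agree, and hence it extends
  to vector-valued functions.
\<close>

lemma integral_torus_cell_part:
  fixes f :: "real^'n \<Rightarrow> 'b::{banach, second_countable_topology}"
  assumes k: "k \<ge> 1" and [measurable]: "f \<in> borel_measurable borel" "T \<in> borel_measurable borel"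
    and eq: "\<And>g :: real^'n \<Rightarrow> ennreal. g \<in> borel_measurable borel \<Longrightarrow> periodic k g \<Longrightarrow> (\<integral>\<^sup>+x. g (T x) \<partial>M) = (\<integral>\<^sup>+x. g x \<partial>torus k)"
    and per: "periodic k f" and M: "sets M = sets borel"
  shows "(\<integral>x. f (T x) \<partial>M) = (\<integral>x. f x \<partial>torus k)"
    and "integrable M (\<lambda>x. f (T x)) \<longleftrightarrow> integrable (torus k) f"
proof -
  note [measurable_cong] = M
  have d: "distr M borel (\<lambda>x. cell_part k (T x)) = distr (torus k) borel (cell_part k)"
  proof (rule measure_eqI)
    fix A assume "A \<in> sets (distr M borel (\<lambda>x. cell_part k (T x)))"
    then have [measurable]: "A \<in> sets borel" by simp
    have "periodic k (\<lambda>x. indicator A (cell_part k x) :: ennreal)"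
      using cell_part_periodic[OF k] unfolding periodic_def by metis
    then have "(\<integral>\<^sup>+x. indicator A (cell_part k (T x)) \<partial>M) = (\<integral>\<^sup>+x. indicator A (cell_part k x) \<partial>torus k)"
      by (intro eq) measurable
    then show "emeasure (distr M borel (\<lambda>x. cell_part k (T x))) A = emeasure (distr (torus k) borel (cell_part k)) A"
      by (simp add: nn_integral_distr flip: nn_integral_indicator)
  qed simp
  have fc: "f (cell_part k x) = f x" for x by (rule periodic_cell_part[OF per])
  have "(\<integral>x. f (T x) \<partial>M) = (\<integral>x. f x \<partial>distr M borel (\<lambda>x. cell_part k (T x)))"
    by (subst integral_distr) (auto simp: fc)
  also have "\<dots> = (\<integral>x. f x \<partial>torus k)"
    unfolding d by (subst integral_distr) (auto simp: fc)
  finally show "(\<integral>x. f (T x) \<partial>M) = (\<integral>x. f x \<partial>torus k)" .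
  have "integrable M (\<lambda>x. f (T x)) \<longleftrightarrow> integrable (distr M borel (\<lambda>x. cell_part k (T x))) f"
    by (subst integrable_distr_eq) (auto simp: fc)
  also have "\<dots> \<longleftrightarrow> integrable (torus k) f"
    unfolding d by (subst integrable_distr_eq) (auto simp: fc)
  finally show "integrable M (\<lambda>x. f (T x)) \<longleftrightarrow> integrable (torus k) f" .
qed

lemma integral_torus_translate:
  fixes f :: "real^'n \<Rightarrow> 'b::{banach, second_countable_topology}"
  assumes "k \<ge> 1" "f \<in> borel_measurable borel" "periodic k f"
  shows "(\<integral>x. f (x + s) \<partial>torus k) = (\<integral>x. f x \<partial>torus k)"
    and "integrable (torus k) (\<lambda>x. f (x + s)) \<longleftrightarrow> integrable (torus k) f"
proof -
  have T: "(\<lambda>x. x + s) \<in> borel_measurable borel" by measurable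
  note * = integral_torus_cell_part[OF assms(1,2) T nn_integral_torus_translate[OF assms(1)] assms(3) sets_torus]
  show "(\<integral>x. f (x + s) \<partial>torus k) = (\<integral>x. f x \<partial>torus k)" by (rule *(1))
  show "integrable (torus k) (\<lambda>x. f (x + s)) \<longleftrightarrow> integrable (torus k) f" by (rule *(2))
qed

lemma integral_torus_mult:
  fixes f :: "real^'n \<Rightarrow> 'b::{banach, second_countable_topology}"
  assumes "k \<ge> 1" "m \<ge> 1" "f \<in> borel_measurable borel" "periodic k f"
  shows "(\<integral>x. f x \<partial>torus (k * m)) = (\<integral>x. f x \<partial>torus k)"
    and "integrable (torus (k * m)) f \<longleftrightarrow> integrable (torus k) f"
proof -
  have T: "(\<lambda>x. x) \<in> borel_measurable borel" by measurable
  note * = integral_torus_cell_part[OF assms(1,3) T nn_integral_torus_mult[OF assms(1,2)] assms(4) sets_torus]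
  show "(\<integral>x. f x \<partial>torus (k * m)) = (\<integral>x. f x \<partial>torus k)" by (rule *(1))
  show "integrable (torus (k * m)) f \<longleftrightarrow> integrable (torus k) f" by (rule *(2))
qed

text \<open>
  A ball with any centre is contained in a translate of a cell that is large enough for its radius.
\<close>

lemma nn_integral_cball_le_torus:
  fixes R :: real
  assumes k: "k \<ge> 1"
  obtains C where "C \<ge> 0" "\<And>f t. f \<in> borel_measurable borel \<Longrightarrow> periodic k f \<Longrightarrow>
    (\<integral>\<^sup>+x\<in>cball (t :: real^'n) R. f x \<partial>lborel) \<le> ennreal C * (\<integral>\<^sup>+x. f x \<partial>torus k)"
proof -
  obtain m :: nat where m: "2 * R < real m" using reals_Archimedean2 by blast
  define m' where "m' = max m 1"
  have m1: "m' \<ge> 1" by (simp add: m'_def)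
  have "m' \<le> k * m'" using k by simp
  then have "real m' \<le> real (k * m')" by (rule of_nat_mono)
  then have R: "2 * R < real (k * m')" using m by (simp add: m'_def)
  have km: "k * m' \<ge> 1" using k m1 by simp
  show thesis
  proof (rule that[of "real (k * m') ^ CARD('n)"])
    fix f :: "real^'n \<Rightarrow> ennreal" and t :: "real^'n" assume [measurable]: "f \<in> borel_measurable borel" and per: "periodic k f"
    have per': "periodic (k * m') f"
      unfolding periodic_def
    proof (intro allI)
      fix w :: "int^'n" and x
      have "real (k * m') *\<^sub>R ivec w = real k *\<^sub>R ivec (\<chi> i. int m' * w $ i)" by (simp add: ivec_def vec_eq_iff)
      then show "f (x + real (k * m') *\<^sub>R ivec w) = f x" using per by (simp add: periodic_def)
    qed
    define s where "s = t - vec R"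
    have sub: "x - s \<in> cell (k * m')" if "x \<in> cball t R" for x
    proof -
      have "\<bar>x $ i - t $ i\<bar> \<le> R" for i
        using component_le_norm_cart[of "x - t" i] that by (simp add: dist_norm norm_minus_commute)
      then have "0 \<le> x $ i - t $ i + R \<and> x $ i - t $ i + R < real (k * m')" for i
        using R by (smt (verit))
      then show ?thesis by (simp add: cell_def s_def algebra_simps)
    qed
    have "(\<integral>\<^sup>+x\<in>cball t R. f x \<partial>lborel) \<le> (\<integral>\<^sup>+x. f x * indicator (cell (k * m')) (x - s) \<partial>lborel)"
      using sub by (intro nn_integral_mono mult_left_mono) (auto simp: indicator_def simp del: mem_cball)
    also have "\<dots> = (\<integral>\<^sup>+x\<in>cell (k * m'). f (x + s) \<partial>lborel)"
      using nn_integral_translate[of "\<lambda>x. f x * indicator (cell (k * m')) (x - s)" s] by simp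
    also have "\<dots> = ennreal (real (k * m') ^ CARD('n)) * (\<integral>\<^sup>+x. f (x + s) \<partial>torus (k * m'))"
    proof (subst nn_integral_torus)
      have p: "ennreal (real (k * m') ^ CARD('n)) \<noteq> 0"
        using km by (auto simp: ennreal_eq_0_iff not_le)
      show "(\<integral>\<^sup>+x\<in>cell (k * m'). f (x + s) \<partial>lborel) = ennreal (real (k * m') ^ CARD('n)) * ((\<integral>\<^sup>+x\<in>cell (k * m'). f (x + s) \<partial>lborel) / ennreal (real (k * m') ^ CARD('n)))"
        unfolding ennreal_times_divide mult.commute[of "ennreal (real (k * m') ^ CARD('n))"]
        by (rule ennreal_mult_divide_eq[OF p, symmetric]) simp
    qed simp
    also have "(\<integral>\<^sup>+x. f (x + s) \<partial>torus (k * m')) = (\<integral>\<^sup>+x. f x \<partial>torus k)"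
      using nn_integral_torus_translate[OF km _ per'] nn_integral_torus_mult[OF k m1 _ per] by simp
    finally show "(\<integral>\<^sup>+x\<in>cball t R. f x \<partial>lborel) \<le> ennreal (real (k * m') ^ CARD('n)) * (\<integral>\<^sup>+x. f x \<partial>torus k)" .
  qed simp
qed

section \<open>Periodic weak gradients\<close>

lemma AE_lebesgue_iff: "(AE x in lebesgue. P x) \<longleftrightarrow> (AE x in lborel. P x)"
  by (rule AE_completion_iff)

lemma periodic_representative:
  fixes f :: "real^'n \<Rightarrow> 'b::euclidean_space"
  assumes f: "f \<in> borel_measurable lebesgue" and per: "cell_periodic k f" and k: "k \<ge> 1"
  shows "\<exists>g. g \<in> borel_measurable borel \<and> periodic k g \<and> (AE x in lborel. f x = g x)"
proof -
  obtain g where g[measurable]: "g \<in> borel_measurable borel" and fg: "AE x in lborel. f x = g x"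
    using measurable_imp_borel_representative[OF f] by blast
  have "AE x in lborel. \<forall>w. f (x + real k *\<^sub>R ivec w) = f x"
    using per unfolding AE_all_countable cell_periodic_iff AE_lebesgue_iff by blast
  moreover have "AE x in lborel. \<forall>w. f (x + real k *\<^sub>R ivec w) = g (x + real k *\<^sub>R ivec w)"
    unfolding AE_all_countable using AE_translate[OF fg] by blast
  ultimately have "AE x in lborel. f x = g (cell_part k x)"
    by eventually_elim (simp add: cell_part_def)
  moreover have "periodic k (\<lambda>x. g (cell_part k x))"
    using cell_part_periodic[OF k] unfolding periodic_def by metis
  moreover have "(\<lambda>x. g (cell_part k x)) \<in> borel_measurable borel" by measurable
  ultimately show ?thesis by (intro exI[of _ "\<lambda>x. g (cell_part k x)"] conjI)
qed

lemma Lp_loc_cong_AE: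
  assumes "Lp_loc p f" "AE x in lborel. f x = g x" "g \<in> borel_measurable borel"
  shows "Lp_loc p g"
proof -
  have g: "g \<in> borel_measurable lebesgue" using assms(3) by (simp add: measurable_completion)
  have "set_integrable lebesgue K (\<lambda>y. norm (g y) powr p)" if K: "compact K" for K
  proof -
    have "K \<in> sets lebesgue" using K by (simp add: lmeasurable_compact fmeasurableD)
    then have m: "(\<lambda>x. indicat_real K x *\<^sub>R norm (g x) powr p) \<in> borel_measurable lebesgue"
      using g by measurable
    have i: "integrable lebesgue (\<lambda>x. indicat_real K x *\<^sub>R norm (f x) powr p)"
      using assms(1) K by (simp add: Lp_loc_def set_integrable_def)
    have "AE x in lebesgue. indicat_real K x *\<^sub>R norm (f x) powr p = indicat_real K x *\<^sub>R norm (g x) powr p"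
      using assms(2) unfolding AE_lebesgue_iff by eventually_elim simp
    from integrable_cong_AE_imp[OF i m this] show ?thesis by (simp add: set_integrable_def)
  qed
  with g show ?thesis by (simp add: Lp_loc_def)
qed

lemma has_weak_gradient_cong_AE:
  fixes \<phi> \<phi>' :: "real^'n \<Rightarrow> real^'n"
  assumes wg: "has_weak_gradient \<phi> \<Phi>"
    and eq: "AE x in lborel. \<phi> x = \<phi>' x" "AE x in lborel. \<Phi> x = \<Phi>' x"
    and m: "\<phi>' \<in> borel_measurable borel" "\<Phi>' \<in> borel_measurable borel"
  shows "has_weak_gradient \<phi>' \<Phi>'"
  unfolding has_weak_gradient_def
proof (intro conjI allI impI)
  have L: "Lp_loc 1 \<phi>" "Lp_loc 1 \<Phi>" using wg by (auto simp: has_weak_gradient_def)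
  show "Lp_loc 1 \<phi>'" by (rule Lp_loc_cong_AE[OF L(1) eq(1) m(1)])
  show "Lp_loc 1 \<Phi>'" by (rule Lp_loc_cong_AE[OF L(2) eq(2) m(2)])
  fix \<psi> :: "real^'n \<Rightarrow> real" and i j :: 'n assume t: "test_function \<psi>"
  have c: "(\<lambda>x :: real^'n. x $ i) \<in> borel_measurable borel" "(\<lambda>x :: real^'n^'n. x $ i $ j) \<in> borel_measurable borel"
    by (auto intro!: borel_measurable_continuous_onI continuous_intros)
  have \<psi>: "\<psi> \<in> borel_measurable lebesgue" "(\<lambda>y. frechet_derivative \<psi> (at y) (axis j 1)) \<in> borel_measurable lebesgue"
    using t by (auto intro!: measurable_completion borel_measurable_continuous_onI test_function_continuous)
  have \<phi>: "\<phi> \<in> borel_measurable lebesgue" "\<Phi> \<in> borel_measurable lebesgue" using L by (auto simp: Lp_loc_def)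
  have \<phi>': "\<phi>' \<in> borel_measurable lebesgue" "\<Phi>' \<in> borel_measurable lebesgue" using m by (auto intro!: measurable_completion)
  have "(LINT y|lebesgue. \<phi>' y $ i * frechet_derivative \<psi> (at y) (axis j 1)) = (LINT y|lebesgue. \<phi> y $ i * frechet_derivative \<psi> (at y) (axis j 1))"
    by (intro integral_cong_AE borel_measurable_times \<psi> measurable_compose[OF \<phi>(1) c(1)] measurable_compose[OF \<phi>'(1) c(1)])
      (use eq(1) in \<open>auto simp: AE_lebesgue_iff elim: eventually_mono\<close>)
  moreover have "(LINT y|lebesgue. \<Phi>' y $ i $ j * \<psi> y) = (LINT y|lebesgue. \<Phi> y $ i $ j * \<psi> y)"
    by (intro integral_cong_AE borel_measurable_times \<psi> measurable_compose[OF \<phi>(2) c(2)] measurable_compose[OF \<phi>'(2) c(2)])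
      (use eq(2) in \<open>auto simp: AE_lebesgue_iff elim: eventually_mono\<close>)
  ultimately show "(LINT y|lebesgue. \<phi>' y $ i * frechet_derivative \<psi> (at y) (axis j 1)) = - (LINT y|lebesgue. \<Phi>' y $ i $ j * \<psi> y)"
    using wg t unfolding has_weak_gradient_def by simp
qed

lemma kernel_return: "kernel (return borel s) (norm s)"
proof -
  interpret prob_space "return borel s" by (rule prob_space_return) simp
  show ?thesis by unfold_locales (simp_all add: AE_return)
qed

text \<open>
  A translation is an average with respect to a point mass.
\<close>

lemma has_weak_gradient_translate:
  fixes \<phi> :: "real^'n \<Rightarrow> real^'n"
  assumes [measurable]: "\<phi> \<in> borel_measurable borel" "\<Phi> \<in> borel_measurable borel" and "has_weak_gradient \<phi> \<Phi>"
  shows "has_weak_gradient (\<lambda>x. \<phi> (x + s)) (\<lambda>x. \<Phi> (x + s))"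
proof -
  have "avg (return borel s) f x = f (x + s)" if [measurable]: "f \<in> borel_measurable borel" for f :: "real^'n \<Rightarrow> 'c::euclidean_space" and x
    unfolding avg_def by (rule integral_return) simp_all
  then show ?thesis
    using kernel.has_weak_gradient_avg[OF kernel_return assms, of s] by (simp add: avg_def[abs_def] integral_return)
qed

text \<open>
  The translate of the weak gradient by a period is the weak gradient of the translate, so uniqueness makes it
  periodic. Passing to representatives that are Borel and periodic everywhere removes null sets from all later
  arguments.
\<close>

lemma periodic_weak_gradient_representatives:
  fixes \<phi> :: "real^'n \<Rightarrow> real^'n"
  assumes wg: "has_weak_gradient \<phi> \<Phi>" and per: "cell_periodic k \<phi>" and k: "k \<ge> 1"
  obtains \<phi>' \<Phi>' where "\<phi>' \<in> borel_measurable borel" "\<Phi>' \<in> borel_measurable borel" "periodic k \<phi>'" "periodic k \<Phi>'"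
    "has_weak_gradient \<phi>' \<Phi>'" "AE x in lborel. \<phi> x = \<phi>' x" "AE x in lborel. \<Phi> x = \<Phi>' x"
proof -
  have m: "\<phi> \<in> borel_measurable lebesgue" "\<Phi> \<in> borel_measurable lebesgue"
    using wg by (auto simp: has_weak_gradient_def Lp_loc_def)
  obtain \<phi>' where \<phi>': "\<phi>' \<in> borel_measurable borel" "periodic k \<phi>'" "AE x in lborel. \<phi> x = \<phi>' x"
    using periodic_representative[OF m(1) per k] by blast
  obtain \<Psi> where \<Psi>: "\<Psi> \<in> borel_measurable borel" "AE x in lborel. \<Phi> x = \<Psi> x"
    using measurable_imp_borel_representative[OF m(2)] by blast
  have wg': "has_weak_gradient \<phi>' \<Psi>"
    by (rule has_weak_gradient_cong_AE[OF wg \<phi>'(3) \<Psi>(2) \<phi>'(1) \<Psi>(1)])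
  have "cell_periodic k \<Psi>"
    unfolding cell_periodic_iff
  proof
    fix w
    have "has_weak_gradient (\<lambda>x. \<phi>' (x + real k *\<^sub>R ivec w)) (\<lambda>x. \<Psi> (x + real k *\<^sub>R ivec w))"
      by (rule has_weak_gradient_translate[OF \<phi>'(1) \<Psi>(1) wg'])
    then have "has_weak_gradient \<phi>' (\<lambda>x. \<Psi> (x + real k *\<^sub>R ivec w))"
      using \<phi>'(2) by (simp add: periodic_def)
    from has_weak_gradient_unique[OF this wg'] show "AE y in lebesgue. \<Psi> (y + real k *\<^sub>R ivec w) = \<Psi> y" by simp
  qed
  then obtain \<Phi>' where \<Phi>': "\<Phi>' \<in> borel_measurable borel" "periodic k \<Phi>'" "AE x in lborel. \<Psi> x = \<Phi>' x"
  proof -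
    have "\<Psi> \<in> borel_measurable lebesgue" using \<Psi>(1) by (simp add: measurable_completion)
    from periodic_representative[OF this \<open>cell_periodic k \<Psi>\<close> k] show ?thesis using that by blast
  qed
  have "has_weak_gradient \<phi>' \<Phi>'"
    by (rule has_weak_gradient_cong_AE[OF wg' _ \<Phi>'(3) \<phi>'(1) \<Phi>'(1)]) simp
  moreover have "AE x in lborel. \<Phi> x = \<Phi>' x" using \<Psi>(2) \<Phi>'(3) by eventually_elim simp
  ultimately show thesis using that \<phi>' \<Phi>' by blast
qed

text \<open>
  A class of potentials and gradients that is dense in the mean square, closed under all operations used below,
  and in which products of components are integrable.
\<close>

definition bounded_torus_gradient :: "nat \<Rightarrow> (real^'n \<Rightarrow> real^'n) \<Rightarrow> (real^'n \<Rightarrow> real^'n^'n) \<Rightarrow> bool" where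
  "bounded_torus_gradient k \<phi> \<Phi> \<longleftrightarrow> \<phi> \<in> borel_measurable borel \<and> \<Phi> \<in> borel_measurable borel \<and>
    bounded (range \<phi>) \<and> bounded (range \<Phi>) \<and> periodic k \<phi> \<and> periodic k \<Phi> \<and> has_weak_gradient \<phi> \<Phi>"

lemma bounded_imp_Lp_loc:
  fixes f :: "real^'n \<Rightarrow> 'b::euclidean_space"
  assumes f[measurable]: "f \<in> borel_measurable borel" and "bounded (range f)" and "p > 0"
  shows "Lp_loc p f"
proof -
  obtain B where B: "norm (f x) \<le> B" for x using assms(2) by (auto simp: bounded_iff)
  have "set_integrable lebesgue K (\<lambda>y. norm (f y) powr p)" if K: "compact K" for K
    unfolding set_integrable_def
  proof (rule Bochner_Integration.integrable_bound)
    have "K \<in> lmeasurable" using K by (rule lmeasurable_compact)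
    then show "integrable lebesgue (\<lambda>x. indicator K x *\<^sub>R (B powr p))"
      unfolding lmeasurable_iff_integrable by (rule integrable_scaleR_left)
    have "K \<in> sets lebesgue" using K by (simp add: lmeasurable_compact fmeasurableD)
    moreover have "f \<in> borel_measurable lebesgue" by (simp add: measurable_completion)
    ultimately show "(\<lambda>x. indicat_real K x *\<^sub>R norm (f x) powr p) \<in> borel_measurable lebesgue"
      by measurable
    have "norm (f x) powr p \<le> B powr p" for x using B[of x] \<open>p > 0\<close> by (intro powr_mono2) auto
    then show "AE x in lebesgue. norm (indicat_real K x *\<^sub>R norm (f x) powr p) \<le> norm (indicat_real K x *\<^sub>R B powr p)"
      by (auto simp: indicator_def)
  qed
  then show ?thesis by (simp add: Lp_loc_def measurable_completion)
qed

lemma bounded_torus_gradient_W1p_per: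
  assumes "bounded_torus_gradient k \<phi> \<Phi>" "p > 0"
  shows "\<phi> \<in> W1p_per p k"
  using assms unfolding W1p_per_def bounded_torus_gradient_def
  by (auto intro!: periodic_imp_cell_periodic bounded_imp_Lp_loc)

lemma emeasure_cball_pos:
  assumes "h > 0"
  shows "emeasure lborel (cball (0 :: 'a::euclidean_space) h) \<noteq> 0"
proof -
  have "emeasure lborel (ball (0 :: 'a) h) \<le> emeasure lborel (cball (0 :: 'a) h)"
    using ball_subset_cball by (intro emeasure_mono) auto
  moreover have "emeasure lborel (ball (0 :: 'a) h) > 0"
    using assms content_ball_pos[of h "0 :: 'a"] by (simp add: measure_def enn2real_positive_iff)
  ultimately show ?thesis by auto
qed

lemma kernel_uniform_cball:
  assumes "h > 0"
  shows "kernel (uniform_measure lborel (cball (0 :: real^'n) h)) h"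
proof -
  interpret prob_space "uniform_measure lborel (cball (0 :: real^'n) h)"
    by (rule prob_space_uniform_measure[OF emeasure_cball_pos[OF assms]])
      (use emeasure_lborel_cball_finite[of "0 :: real^'n" h] in auto)
  show ?thesis
    by unfold_locales (auto intro!: AE_uniform_measureI)
qed

text \<open>
  The mean over a ball is at most the integral over finitely many cells divided by the volume of the ball, wherever
  its centre is.
\<close>

lemma avg_uniform_cball_bounded:
  fixes f :: "real^'n \<Rightarrow> 'b::euclidean_space"
  assumes [measurable]: "f \<in> borel_measurable borel" and per: "periodic k f" and k: "k \<ge> 1" and h: "h > 0"
    and fin: "(\<integral>\<^sup>+x. ennreal (norm (f x)) \<partial>torus k) < \<infinity>"
  shows "bounded (range (avg (uniform_measure lborel (cball 0 h)) f))"
proof -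
  let ?M = "uniform_measure lborel (cball (0 :: real^'n) h)"
  obtain C where C: "C \<ge> 0" "\<And>f t. f \<in> borel_measurable borel \<Longrightarrow> periodic k f \<Longrightarrow>
    (\<integral>\<^sup>+x\<in>cball (t :: real^'n) h. f x \<partial>lborel) \<le> ennreal C * (\<integral>\<^sup>+x. f x \<partial>torus k)"
    using nn_integral_cball_le_torus[OF k] by blast
  define B where "B = ennreal C * (\<integral>\<^sup>+x. ennreal (norm (f x)) \<partial>torus k) / emeasure lborel (cball (0 :: real^'n) h)"
  have p: "emeasure lborel (cball (0 :: real^'n) h) \<noteq> 0" by (rule emeasure_cball_pos[OF h])
  have "B < \<infinity>" using fin p unfolding B_def by (simp add: ennreal_divide_eq_top_iff ennreal_mult_less_top less_top[symmetric] ennreal_mult_eq_top_iff)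
  have [measurable]: "cball (0 :: real^'n) h \<in> sets borel" by simp
  have nb: "ennreal (norm (avg ?M f x)) \<le> B" for x
  proof -
    have "ennreal (norm (avg ?M f x)) \<le> (\<integral>\<^sup>+s. norm (f (x + s)) \<partial>?M)"
    proof (cases "integrable ?M (\<lambda>s. f (x + s))")
      case True
      then show ?thesis unfolding avg_def by (rule integral_norm_bound_ennreal)
    next
      case False
      then show ?thesis unfolding avg_def by (simp add: not_integrable_integral_eq)
    qed
    also have "\<dots> = (\<integral>\<^sup>+s. ennreal (norm (f (x + s))) * indicator (cball 0 h) s \<partial>lborel) / emeasure lborel (cball (0 :: real^'n) h)"
      by (subst nn_integral_uniform_measure) auto
    also have "(\<integral>\<^sup>+s. ennreal (norm (f (x + s))) * indicator (cball 0 h) s \<partial>lborel) = (\<integral>\<^sup>+s. ennreal (norm (f s)) * indicator (cball x h) s \<partial>lborel)"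
      using nn_integral_translate[of "\<lambda>s. ennreal (norm (f s)) * indicator (cball x h) s" x]
      by (simp add: add.commute indicator_def dist_norm)
    also have "\<dots> \<le> ennreal C * (\<integral>\<^sup>+x. ennreal (norm (f x)) \<partial>torus k)"
      using per by (intro C(2)) (auto simp: periodic_def)
    finally show ?thesis unfolding B_def by (simp add: divide_right_mono_ennreal)
  qed
  obtain b where b: "B = ennreal b" "b \<ge> 0" using \<open>B < \<infinity>\<close> by (cases B) auto
  have "norm (avg ?M f x) \<le> b" for x
    using nb[of x] b by simp
  then show ?thesis by (auto simp: bounded_iff)
qed

lemma nn_integral_torus_le_cball:
  assumes k: "k \<ge> 1"
  obtains R where "\<And>f. f \<in> borel_measurable borel \<Longrightarrow> (\<integral>\<^sup>+x. f x \<partial>torus k) \<le> (\<integral>\<^sup>+x\<in>cball (0 :: real^'n) R. f x \<partial>lborel)"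
proof -
  have "bounded (cell k :: (real^'n) set)"
    by (rule bounded_subset[OF bounded_cbox[of 0 "vec (real k)"]]) (auto simp: cell_def mem_box_cart less_imp_le)
  from bounded_subset_ballD[OF this, of 0] obtain R where "cell k \<subseteq> ball (0 :: real^'n) R" by blast
  then have R: "cell k \<subseteq> cball (0 :: real^'n) R" using ball_subset_cball by blast
  show thesis
  proof (rule that[of R])
    fix f :: "real^'n \<Rightarrow> ennreal" assume [measurable]: "f \<in> borel_measurable borel"
    have "(\<integral>\<^sup>+x\<in>cell k. f x \<partial>lborel) \<le> (\<integral>\<^sup>+x\<in>cball 0 R. f x \<partial>lborel)"
      using R by (intro nn_integral_mono mult_left_mono) (auto simp: indicator_def simp del: mem_cball)
    moreover have "(\<integral>\<^sup>+x. f x \<partial>torus k) \<le> (\<integral>\<^sup>+x\<in>cell k. f x \<partial>lborel)"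
    proof -
      have c: "1 \<le> ennreal (real k ^ CARD('n))" using k by simp
      then have "0 < ennreal (real k ^ CARD('n))" by (rule less_le_trans[rotated]) simp
      then have "(\<integral>\<^sup>+x\<in>cell k. f x \<partial>lborel) / ennreal (real k ^ CARD('n)) \<le> (\<integral>\<^sup>+x\<in>cell k. f x \<partial>lborel)"
        using mult_left_mono[OF c, of "\<integral>\<^sup>+x\<in>cell k. f x \<partial>lborel"]
        by (intro divide_le_posI_ennreal) (auto simp: mult.commute)
      then show ?thesis by (simp add: nn_integral_torus)
    qed
    ultimately show "(\<integral>\<^sup>+x. f x \<partial>torus k) \<le> (\<integral>\<^sup>+x\<in>cball 0 R. f x \<partial>lborel)" by simp
  qed
qed

text \<open>
  The approximations are the means over balls of radius \<open>1 / (m + 1)\<close>.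
\<close>

lemma bounded_torus_gradient_approximation:
  fixes \<phi> :: "real^'n \<Rightarrow> real^'n"
  assumes k: "k \<ge> 1" and m[measurable]: "\<phi> \<in> borel_measurable borel" "\<Phi> \<in> borel_measurable borel"
    and per: "periodic k \<phi>" "periodic k \<Phi>" and wg: "has_weak_gradient \<phi> \<Phi>"
    and fin: "(\<integral>\<^sup>+x. ennreal ((norm (\<Phi> x))\<^sup>2) \<partial>torus k) < \<infinity>"
  shows "\<exists>\<phi>' \<Phi>'. (\<forall>m. bounded_torus_gradient k (\<phi>' m) (\<Phi>' m)) \<and>
    (\<lambda>m. \<integral>\<^sup>+x. ennreal ((norm (\<Phi>' m x - \<Phi> x))\<^sup>2) \<partial>torus k) \<longlonglongrightarrow> 0"
proof -
  define M where "M m = uniform_measure lborel (cball (0 :: real^'n) (1 / real (Suc m)))" for m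
  have ker: "kernel (M m) (1 / real (Suc m))" for m
    unfolding M_def by (rule kernel_uniform_cball) simp
  have L2: "locally_L2 \<Phi>"
    unfolding locally_L2_def
  proof (intro conjI allI m)
    fix R
    obtain C where C: "C \<ge> 0" "\<And>f t. f \<in> borel_measurable borel \<Longrightarrow> periodic k f \<Longrightarrow>
      (\<integral>\<^sup>+x\<in>cball (t :: real^'n) R. f x \<partial>lborel) \<le> ennreal C * (\<integral>\<^sup>+x. f x \<partial>torus k)"
      using nn_integral_cball_le_torus[OF k] by blast
    have "(\<integral>\<^sup>+x\<in>cball 0 R. ennreal ((norm (\<Phi> x))\<^sup>2) \<partial>lborel) \<le> ennreal C * (\<integral>\<^sup>+x. ennreal ((norm (\<Phi> x))\<^sup>2) \<partial>torus k)"
      using per by (intro C(2)) (auto simp: periodic_def)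
    also have "\<dots> < \<infinity>" using fin by (simp add: ennreal_mult_less_top)
    finally show "(\<integral>\<^sup>+x\<in>cball 0 R. ennreal ((norm (\<Phi> x))\<^sup>2) \<partial>lborel) < \<infinity>" .
  qed
  have li: "locally_integrable \<phi>" "locally_integrable \<Phi>"
    using wg unfolding has_weak_gradient_borel_iff[OF m] by auto
  have fin1: "(\<integral>\<^sup>+x. ennreal (norm (f x)) \<partial>torus k) < \<infinity>" if "locally_integrable f" for f :: "real^'n \<Rightarrow> 'c::euclidean_space"
  proof -
    have [measurable]: "f \<in> borel_measurable borel" using that by (simp add: locally_integrable_def)
    obtain R where R: "\<And>f. f \<in> borel_measurable borel \<Longrightarrow> (\<integral>\<^sup>+x. f x \<partial>torus k) \<le> (\<integral>\<^sup>+x\<in>cball (0 :: real^'n) R. f x \<partial>lborel)"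
      using nn_integral_torus_le_cball[OF k] by blast
    have "(\<integral>\<^sup>+x. ennreal (norm (f x)) \<partial>torus k) \<le> (\<integral>\<^sup>+x\<in>cball 0 R. ennreal (norm (f x)) \<partial>lborel)"
      by (intro R) measurable
    also have "\<dots> = (\<integral>\<^sup>+x. ennreal (norm (indicator (cball 0 R) x *\<^sub>R f x)) \<partial>lborel)"
      by (intro nn_integral_cong) (auto simp: indicator_def)
    also have "\<dots> < \<infinity>"
      using that unfolding locally_integrable_def set_integrable_def integrable_iff_bounded by blast
    finally show ?thesis .
  qed
  have pavg: "periodic k (avg (M m) f)" if "periodic k f" for f :: "real^'n \<Rightarrow> 'c::euclidean_space" and m
  proof -
    have "f (x + real k *\<^sub>R ivec w + s) = f (x + s)" for x w s
      using that unfolding periodic_def by (metis add.assoc add.commute)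
    then show ?thesis by (simp add: periodic_def avg_def)
  qed
  show ?thesis
  proof (intro exI[of _ "\<lambda>m. avg (M m) \<phi>"] exI[of _ "\<lambda>m. avg (M m) \<Phi>"] conjI allI)
    show "bounded_torus_gradient k (avg (M m) \<phi>) (avg (M m) \<Phi>)" for m
      unfolding bounded_torus_gradient_def
    proof (intro conjI)
      show "bounded (range (avg (M m) \<phi>))" "bounded (range (avg (M m) \<Phi>))"
        unfolding M_def by (rule avg_uniform_cball_bounded[OF _ _ k _ fin1]; use per m li in simp)+
    qed (rule kernel.borel_measurable_avg[OF ker] kernel.has_weak_gradient_avg[OF ker] pavg per m wg)+
    obtain R where R: "\<And>f. f \<in> borel_measurable borel \<Longrightarrow> (\<integral>\<^sup>+x. f x \<partial>torus k) \<le> (\<integral>\<^sup>+x\<in>cball (0 :: real^'n) R. f x \<partial>lborel)"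
      using nn_integral_torus_le_cball[OF k] by blast
    have lim: "(\<lambda>m. \<integral>\<^sup>+x\<in>cball 0 R. ennreal ((norm (avg (M m) \<Phi> x - \<Phi> x))\<^sup>2) \<partial>lborel) \<longlonglongrightarrow> 0"
      by (rule avg_L2_tendsto[OF L2 ker]) (use LIMSEQ_inverse_real_of_nat in \<open>simp add: inverse_eq_divide\<close>)
    show "(\<lambda>m. \<integral>\<^sup>+x. ennreal ((norm (avg (M m) \<Phi> x - \<Phi> x))\<^sup>2) \<partial>torus k) \<longlonglongrightarrow> 0"
    proof (rule tendsto_sandwich[OF _ _ tendsto_const lim])
      show "\<forall>\<^sub>F m in sequentially. (\<integral>\<^sup>+x. ennreal ((norm (avg (M m) \<Phi> x - \<Phi> x))\<^sup>2) \<partial>torus k) \<le>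
        (\<integral>\<^sup>+x\<in>cball 0 R. ennreal ((norm (avg (M m) \<Phi> x - \<Phi> x))\<^sup>2) \<partial>lborel)"
      proof (intro always_eventually allI R)
        fix m
        have [measurable]: "avg (M m) \<Phi> \<in> borel_measurable borel" by (rule kernel.borel_measurable_avg[OF ker]) simp
        show "(\<lambda>x. ennreal ((norm (avg (M m) \<Phi> x - \<Phi> x))\<^sup>2)) \<in> borel_measurable borel" by measurable
      qed
    qed simp
  qed
qed

section \<open>Square integrable functions and fields of bilinear forms\<close>

definition square_integrable :: "'a measure \<Rightarrow> ('a \<Rightarrow> 'b::euclidean_space) \<Rightarrow> bool" where
  "square_integrable M f \<longleftrightarrow> f \<in> borel_measurable M \<and> integrable M (\<lambda>x. (norm (f x))\<^sup>2)"

lemma square_integrable_iff_nn: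
  "f \<in> borel_measurable M \<Longrightarrow> square_integrable M f \<longleftrightarrow> (\<integral>\<^sup>+x. ennreal ((norm (f x))\<^sup>2) \<partial>M) < \<infinity>"
  by (auto simp: square_integrable_def integrable_iff_bounded)

lemma nn_integral_square:
  "square_integrable M f \<Longrightarrow> (\<integral>\<^sup>+x. ennreal ((norm (f x))\<^sup>2) \<partial>M) = ennreal (\<integral>x. (norm (f x))\<^sup>2 \<partial>M)"
  unfolding square_integrable_def by (intro nn_integral_eq_integral) auto

lemma square_integrable_add:
  assumes "square_integrable M f" "square_integrable M g"
  shows "square_integrable M (\<lambda>x. f x + g x)"
proof -
  have [measurable]: "f \<in> borel_measurable M" "g \<in> borel_measurable M"
    using assms by (auto simp: square_integrable_def)
  have "integrable M (\<lambda>x. 2 * (norm (f x))\<^sup>2 + 2 * (norm (g x))\<^sup>2)"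
    using assms by (auto simp: square_integrable_def)
  then have "integrable M (\<lambda>x. (norm (f x + g x))\<^sup>2)"
  proof (rule Bochner_Integration.integrable_bound)
    show "AE x in M. norm ((norm (f x + g x))\<^sup>2) \<le> norm (2 * (norm (f x))\<^sup>2 + 2 * (norm (g x))\<^sup>2)"
      using norm_add_square_le[of "f x" "g x" for x] by (intro AE_I2) (simp add: norm_add_square_le)
  qed measurable
  then show ?thesis by (simp add: square_integrable_def)
qed

lemma square_integrable_scaleR:
  "square_integrable M f \<Longrightarrow> square_integrable M (\<lambda>x. c *\<^sub>R f x)"
  by (auto simp: square_integrable_def power_mult_distrib)

lemma square_integrable_diff:
  assumes "square_integrable M f" "square_integrable M g"
  shows "square_integrable M (\<lambda>x. f x - g x)"
  using square_integrable_add[OF assms(1) square_integrable_scaleR[OF assms(2), of "-1"]] by simp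

lemma (in finite_measure) square_integrable_bounded:
  assumes "f \<in> borel_measurable M" "\<And>x. norm (f x) \<le> B"
  shows "square_integrable M f"
proof -
  have "(norm (f x))\<^sup>2 \<le> B\<^sup>2" for x using assms(2) by (intro power_mono) auto
  then have "integrable M (\<lambda>x. (norm (f x))\<^sup>2)"
    using assms(1) by (intro integrable_const_bound[of _ "B\<^sup>2"]) auto
  then show ?thesis using assms(1) by (simp add: square_integrable_def)
qed

lemma square_integrable_product:
  assumes "square_integrable M f" "square_integrable M g"
  shows "integrable M (\<lambda>x. norm (f x) * norm (g x))"
    and "(\<integral>x. norm (f x) * norm (g x) \<partial>M) \<le> sqrt (\<integral>x. (norm (f x))\<^sup>2 \<partial>M) * sqrt (\<integral>x. (norm (g x))\<^sup>2 \<partial>M)"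
proof -
  have [measurable]: "f \<in> borel_measurable M" "g \<in> borel_measurable M"
    using assms by (auto simp: square_integrable_def)
  have "integrable M (\<lambda>x. (norm (f x))\<^sup>2 + (norm (g x))\<^sup>2)"
    using assms by (auto simp: square_integrable_def)
  then show i: "integrable M (\<lambda>x. norm (f x) * norm (g x))"
  proof (rule Bochner_Integration.integrable_bound)
    have "norm (f x) * norm (g x) \<le> (norm (f x))\<^sup>2 + (norm (g x))\<^sup>2" for x
    proof -
      have "0 \<le> norm (f x) * norm (g x)" by simp
      then show ?thesis using sum_squares_bound[of "norm (f x)" "norm (g x)"] by linarith
    qed
    then show "AE x in M. norm (norm (f x) * norm (g x)) \<le> norm ((norm (f x))\<^sup>2 + (norm (g x))\<^sup>2)"
      by (intro AE_I2) simp
  qed measurable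
  have "(\<integral>\<^sup>+x. ennreal (norm (f x)) * ennreal (norm (g x)) \<partial>M)\<^sup>2 \<le>
    (\<integral>\<^sup>+x. (ennreal (norm (f x)))\<^sup>2 \<partial>M) * (\<integral>\<^sup>+x. (ennreal (norm (g x)))\<^sup>2 \<partial>M)"
    by (rule Cauchy_Schwarz_nn_integral) measurable
  then have "ennreal ((\<integral>x. norm (f x) * norm (g x) \<partial>M)\<^sup>2) \<le> ennreal ((\<integral>x. (norm (f x))\<^sup>2 \<partial>M) * (\<integral>x. (norm (g x))\<^sup>2 \<partial>M))"
    using nn_integral_square[OF assms(1)] nn_integral_square[OF assms(2)] nn_integral_eq_integral[OF i]
    by (simp add: ennreal_power ennreal_mult[symmetric])
  then have "(\<integral>x. norm (f x) * norm (g x) \<partial>M)\<^sup>2 \<le> (\<integral>x. (norm (f x))\<^sup>2 \<partial>M) * (\<integral>x. (norm (g x))\<^sup>2 \<partial>M)"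
    by (subst (asm) ennreal_le_iff) (auto intro!: mult_nonneg_nonneg)
  then have "sqrt ((\<integral>x. norm (f x) * norm (g x) \<partial>M)\<^sup>2) \<le> sqrt ((\<integral>x. (norm (f x))\<^sup>2 \<partial>M) * (\<integral>x. (norm (g x))\<^sup>2 \<partial>M))"
    by (rule real_sqrt_le_mono)
  then show "(\<integral>x. norm (f x) * norm (g x) \<partial>M) \<le> sqrt (\<integral>x. (norm (f x))\<^sup>2 \<partial>M) * sqrt (\<integral>x. (norm (g x))\<^sup>2 \<partial>M)"
    by (simp add: real_sqrt_mult)
qed

definition L2_tendsto :: "'a measure \<Rightarrow> (nat \<Rightarrow> 'a \<Rightarrow> 'b::euclidean_space) \<Rightarrow> ('a \<Rightarrow> 'b) \<Rightarrow> bool" where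
  "L2_tendsto M f g \<longleftrightarrow> (\<forall>m. square_integrable M (f m)) \<and> square_integrable M g \<and>
    (\<lambda>m. \<integral>x. (norm (f m x - g x))\<^sup>2 \<partial>M) \<longlonglongrightarrow> 0"

lemma L2_tendstoI_nn:
  assumes "\<And>m. square_integrable M (f m)" "square_integrable M g"
    and "(\<lambda>m. \<integral>\<^sup>+x. ennreal ((norm (f m x - g x))\<^sup>2) \<partial>M) \<longlonglongrightarrow> 0"
  shows "L2_tendsto M f g"
proof -
  have "(\<lambda>m. ennreal (\<integral>x. (norm (f m x - g x))\<^sup>2 \<partial>M)) \<longlonglongrightarrow> ennreal 0"
    using assms(3) nn_integral_square[OF square_integrable_diff[OF assms(1,2)]] by simp
  then have "(\<lambda>m. \<integral>x. (norm (f m x - g x))\<^sup>2 \<partial>M) \<longlonglongrightarrow> 0"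
    by (subst (asm) tendsto_ennreal_iff) auto
  then show ?thesis using assms by (simp add: L2_tendsto_def)
qed

lemma L2_tendsto_const: "square_integrable M g \<Longrightarrow> L2_tendsto M (\<lambda>m. g) g"
  by (simp add: L2_tendsto_def)

text \<open>
  The bound is asked for almost everywhere only, since this is how essential bounds on integrands are stated.
\<close>

definition bilinear_field :: "'a measure \<Rightarrow> ('a \<Rightarrow> 'b::euclidean_space \<Rightarrow> 'c::euclidean_space \<Rightarrow> real) \<Rightarrow> real \<Rightarrow> bool" where
  "bilinear_field M b c \<longleftrightarrow> (\<forall>x. bilinear (b x)) \<and> (\<forall>u v. (\<lambda>x. b x u v) \<in> borel_measurable M) \<and>
    (AE x in M. \<forall>u v. \<bar>b x u v\<bar> \<le> c * norm u * norm v)"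

lemma bilinear_Basis_expansion:
  fixes B :: "'a::euclidean_space \<Rightarrow> 'b::euclidean_space \<Rightarrow> real"
  assumes "bilinear B"
  shows "B u v = (\<Sum>i\<in>Basis. \<Sum>j\<in>Basis. (u \<bullet> i) * (v \<bullet> j) * B i j)"
proof -
  have l: "linear (\<lambda>u. B u v)" "linear (\<lambda>v. B u v)" for u v using assms by (auto simp: bilinear_def)
  have "B u v = B (\<Sum>i\<in>Basis. (u \<bullet> i) *\<^sub>R i) (\<Sum>j\<in>Basis. (v \<bullet> j) *\<^sub>R j)"
    by (simp add: euclidean_representation)
  also have "\<dots> = (\<Sum>i\<in>Basis. (u \<bullet> i) *\<^sub>R B i (\<Sum>j\<in>Basis. (v \<bullet> j) *\<^sub>R j))"
    by (simp only: linear_sum[OF l(1)] linear_cmul[OF l(1)])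
  also have "\<dots> = (\<Sum>i\<in>Basis. (u \<bullet> i) *\<^sub>R (\<Sum>j\<in>Basis. (v \<bullet> j) *\<^sub>R B i j))"
    by (simp only: linear_sum[OF l(2)] linear_cmul[OF l(2)])
  finally show ?thesis by (simp add: sum_distrib_left mult.assoc)
qed

text \<open>
  In coordinates the composition is a finite sum of products of measurable functions.
\<close>

lemma bilinear_field_measurable:
  assumes b: "bilinear_field M b c" and [measurable]: "f \<in> borel_measurable M" "g \<in> borel_measurable M"
  shows "(\<lambda>x. b x (f x) (g x)) \<in> borel_measurable M"
proof -
  have [measurable]: "(\<lambda>x. b x u v) \<in> borel_measurable M" for u v using b by (simp add: bilinear_field_def)
  have "b x (f x) (g x) = (\<Sum>i\<in>Basis. \<Sum>j\<in>Basis. (f x \<bullet> i) * (g x \<bullet> j) * b x i j)" for x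
    using b by (intro bilinear_Basis_expansion) (simp add: bilinear_field_def)
  then have "(\<lambda>x. b x (f x) (g x)) = (\<lambda>x. \<Sum>i\<in>Basis. \<Sum>j\<in>Basis. (f x \<bullet> i) * (g x \<bullet> j) * b x i j)" by (rule ext)
  also have "\<dots> \<in> borel_measurable M"
    by (intro borel_measurable_sum borel_measurable_times borel_measurable_inner) auto
  finally show ?thesis .
qed

lemma bilinear_field_integral:
  assumes b: "bilinear_field M b c" and f: "square_integrable M f" and g: "square_integrable M g"
  shows "integrable M (\<lambda>x. b x (f x) (g x))"
    and "\<bar>\<integral>x. b x (f x) (g x) \<partial>M\<bar> \<le> \<bar>c\<bar> * (sqrt (\<integral>x. (norm (f x))\<^sup>2 \<partial>M) * sqrt (\<integral>x. (norm (g x))\<^sup>2 \<partial>M))"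
proof -
  have m: "f \<in> borel_measurable M" "g \<in> borel_measurable M" using f g by (auto simp: square_integrable_def)
  have p: "integrable M (\<lambda>x. \<bar>c\<bar> * (norm (f x) * norm (g x)))"
    by (intro integrable_mult_right square_integrable_product f g)
  have ae: "AE x in M. norm (b x (f x) (g x)) \<le> \<bar>c\<bar> * (norm (f x) * norm (g x))"
  proof -
    have "AE x in M. \<forall>u v. \<bar>b x u v\<bar> \<le> c * norm u * norm v" using b by (simp add: bilinear_field_def)
    then show ?thesis
    proof eventually_elim
      case (elim x)
      have "c * (norm (f x) * norm (g x)) \<le> \<bar>c\<bar> * (norm (f x) * norm (g x))" by (intro mult_right_mono) auto
      then show ?case using elim by (simp add: mult.assoc order_trans[OF elim[rule_format]])
    qed
  qed
  show i: "integrable M (\<lambda>x. b x (f x) (g x))"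
    by (rule Bochner_Integration.integrable_bound[OF p bilinear_field_measurable[OF b m]])
      (use ae in \<open>auto elim!: eventually_mono\<close>)
  have "\<bar>\<integral>x. b x (f x) (g x) \<partial>M\<bar> \<le> (\<integral>x. norm (b x (f x) (g x)) \<partial>M)"
    using integral_norm_bound[of M "\<lambda>x. b x (f x) (g x)"] by simp
  also have "\<dots> \<le> (\<integral>x. \<bar>c\<bar> * (norm (f x) * norm (g x)) \<partial>M)"
    by (intro integral_mono_AE integrable_norm i p ae)
  also have "\<dots> = \<bar>c\<bar> * (\<integral>x. norm (f x) * norm (g x) \<partial>M)" by simp
  also have "\<dots> \<le> \<bar>c\<bar> * (sqrt (\<integral>x. (norm (f x))\<^sup>2 \<partial>M) * sqrt (\<integral>x. (norm (g x))\<^sup>2 \<partial>M))"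
    by (intro mult_left_mono square_integrable_product f g) auto
  finally show "\<bar>\<integral>x. b x (f x) (g x) \<partial>M\<bar> \<le> \<bar>c\<bar> * (sqrt (\<integral>x. (norm (f x))\<^sup>2 \<partial>M) * sqrt (\<integral>x. (norm (g x))\<^sup>2 \<partial>M))" .
qed

lemma bilinear_field_tendsto:
  assumes b: "bilinear_field M b c" and F: "L2_tendsto M F f" and G: "L2_tendsto M G g"
  shows "(\<lambda>m. \<integral>x. b x (F m x) (G m x) \<partial>M) \<longlonglongrightarrow> (\<integral>x. b x (f x) (g x) \<partial>M)"
proof -
  define nf where "nf h = sqrt (\<integral>x. (norm (h x))\<^sup>2 \<partial>M)" for h :: "'a \<Rightarrow> 'b"
  define ng where "ng h = sqrt (\<integral>x. (norm (h x))\<^sup>2 \<partial>M)" for h :: "'a \<Rightarrow> 'c"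
  have sq: "square_integrable M (F m)" "square_integrable M f" "square_integrable M (G m)" "square_integrable M g" for m
    using F G by (auto simp: L2_tendsto_def)
  have dF: "(\<lambda>m. nf (\<lambda>x. F m x - f x)) \<longlonglongrightarrow> 0" and dG: "(\<lambda>m. ng (\<lambda>x. G m x - g x)) \<longlonglongrightarrow> 0"
    using F G tendsto_real_sqrt[of _ 0] by (auto simp: L2_tendsto_def nf_def ng_def)
  have "(\<lambda>m. (\<integral>x. b x (F m x) (G m x) \<partial>M) - (\<integral>x. b x (f x) (g x) \<partial>M)) \<longlonglongrightarrow> 0"
  proof (rule Lim_null_comparison)
    let ?d = "\<lambda>m. \<bar>c\<bar> * (nf (\<lambda>x. F m x - f x) * ng (\<lambda>x. G m x - g x)) + \<bar>c\<bar> * (nf (\<lambda>x. F m x - f x) * ng g)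
      + \<bar>c\<bar> * (nf f * ng (\<lambda>x. G m x - g x))"
    have "norm ((\<integral>x. b x (F m x) (G m x) \<partial>M) - (\<integral>x. b x (f x) (g x) \<partial>M)) \<le> ?d m" for m
    proof -
      have bl: "bilinear (b x)" for x using b by (simp add: bilinear_field_def)
      have "b x (F m x) (G m x) - b x (f x) (g x) =
        b x (F m x - f x) (G m x - g x) + b x (F m x - f x) (g x) + b x (f x) (G m x - g x)" for x
        by (simp add: bilinear_lsub[OF bl] bilinear_rsub[OF bl])
      then have "(\<integral>x. b x (F m x) (G m x) \<partial>M) - (\<integral>x. b x (f x) (g x) \<partial>M) =
        (\<integral>x. b x (F m x - f x) (G m x - g x) + b x (F m x - f x) (g x) + b x (f x) (G m x - g x) \<partial>M)"
        by (subst Bochner_Integration.integral_diff[symmetric]) (simp_all add: bilinear_field_integral(1)[OF b] sq)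
      also have "\<dots> = (\<integral>x. b x (F m x - f x) (G m x - g x) \<partial>M) + (\<integral>x. b x (F m x - f x) (g x) \<partial>M) + (\<integral>x. b x (f x) (G m x - g x) \<partial>M)"
        by (simp add: bilinear_field_integral(1)[OF b] sq square_integrable_diff)
      finally show ?thesis
        using bilinear_field_integral(2)[OF b square_integrable_diff[OF sq(1)[of m] sq(2)] square_integrable_diff[OF sq(3)[of m] sq(4)]]
          bilinear_field_integral(2)[OF b square_integrable_diff[OF sq(1)[of m] sq(2)] sq(4)]
          bilinear_field_integral(2)[OF b sq(2) square_integrable_diff[OF sq(3)[of m] sq(4)]]
        unfolding nf_def ng_def real_norm_def by linarith
    qed
    then show "\<forall>\<^sub>F m in sequentially. norm ((\<integral>x. b x (F m x) (G m x) \<partial>M) - (\<integral>x. b x (f x) (g x) \<partial>M)) \<le> ?d m"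
      by simp
    have "?d \<longlonglongrightarrow> \<bar>c\<bar> * (0 * 0) + \<bar>c\<bar> * (0 * ng g) + \<bar>c\<bar> * (nf f * 0)"
      by (intro tendsto_add tendsto_mult dF dG tendsto_const)
    then show "?d \<longlonglongrightarrow> 0" by simp
  qed
  then show ?thesis by (rule LIM_zero_cancel)
qed

section \<open>Difference quotients\<close>

text \<open>
  The distribution of \<open>t *\<^sub>R v\<close> for \<open>t\<close> uniform in the unit interval.
\<close>

definition segment_measure :: "real^'n \<Rightarrow> (real^'n) measure" where
  "segment_measure v = distr (uniform_measure lborel {0..1::real}) borel (\<lambda>t. t *\<^sub>R v)"

lemma kernel_segment: "kernel (segment_measure v) (norm v)"
proof -
  interpret U: prob_space "uniform_measure lborel {0..1::real}" by (rule prob_space_uniform_measure) auto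
  interpret prob_space "segment_measure v" unfolding segment_measure_def by (rule U.prob_space_distr) simp
  show ?thesis
  proof unfold_locales
    have "norm (t *\<^sub>R v) \<le> norm v" if "t \<in> {0..1}" for t using that by (simp add: mult_left_le_one_le)
    then have "AE t in uniform_measure lborel {0..1}. norm (t *\<^sub>R v) \<le> norm v"
      by (intro AE_uniform_measureI) auto
    then show "AE s in segment_measure v. norm s \<le> norm v"
      unfolding segment_measure_def by (subst AE_distr_iff) auto
  qed (simp add: segment_measure_def)
qed

lemma integral_segment:
  fixes g :: "real^'n \<Rightarrow> real"
  assumes [measurable]: "g \<in> borel_measurable borel"
  shows "(\<integral>s. g s \<partial>segment_measure v) = (LINT t:{0..1}|lborel. g (t *\<^sub>R v))"
proof -
  have "(\<integral>s. g s \<partial>segment_measure v) = (\<integral>t. g (t *\<^sub>R v) \<partial>uniform_measure lborel {0..1})"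
    unfolding segment_measure_def by (subst integral_distr) auto
  also have "uniform_measure lborel {0..1::real} = density lborel (\<lambda>t. ennreal (indicator {0..1} t))"
    unfolding uniform_measure_def by (intro density_cong) (auto simp: indicator_def)
  also have "(\<integral>t. g (t *\<^sub>R v) \<partial>density lborel (\<lambda>t. ennreal (indicator {0..1} t))) = (LINT t:{0..1}|lborel. g (t *\<^sub>R v))"
    unfolding set_lebesgue_integral_def by (subst integral_density) auto
  finally show ?thesis .
qed

text \<open>
  The fundamental theorem of calculus along a segment.
\<close>

lemma test_function_segment:
  assumes t: "test_function \<psi>"
  shows "(\<integral>s. frechet_derivative \<psi> (at (x - s)) v \<partial>segment_measure v) = \<psi> x - \<psi> (x - v)"
proof -
  note c = test_function_continuous[OF t]
  have [measurable]: "(\<lambda>y. frechet_derivative \<psi> (at y) v) \<in> borel_measurable borel"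
    by (intro borel_measurable_continuous_onI c)
  have "(\<integral>s. frechet_derivative \<psi> (at (x - s)) v \<partial>segment_measure v) =
    (LINT t:{0..1}|lborel. frechet_derivative \<psi> (at (x - t *\<^sub>R v)) v)"
    by (rule integral_segment[of "\<lambda>s. frechet_derivative \<psi> (at (x - s)) v"]) measurable
  also have "\<dots> = integral {0..1} (\<lambda>t. frechet_derivative \<psi> (at (x - t *\<^sub>R v)) v)"
  proof (rule set_borel_integral_eq_integral(2))
    have "continuous_on {0..1} (\<lambda>t. frechet_derivative \<psi> (at (x - t *\<^sub>R v)) v)"
      by (rule continuous_on_compose2[OF c(2)]) (auto intro!: continuous_intros)
    then show "set_integrable lborel {0..1} (\<lambda>t. frechet_derivative \<psi> (at (x - t *\<^sub>R v)) v)"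
      by (rule borel_integrable_atLeastAtMost')
  qed
  also have "\<dots> = (- \<psi> (x - 1 *\<^sub>R v)) - (- \<psi> (x - 0 *\<^sub>R v))"
  proof (rule integral_unique, rule fundamental_theorem_of_calculus)
    fix t :: real
    have d: "((\<lambda>t. x - t *\<^sub>R v) has_derivative (\<lambda>h. - (h *\<^sub>R v))) (at t within {0..1})"
      by (auto intro!: derivative_eq_intros)
    have lin: "linear (frechet_derivative \<psi> (at (x - t *\<^sub>R v)))"
      using c(3) by (rule has_derivative_linear)
    have "((\<lambda>t. \<psi> (x - t *\<^sub>R v)) has_derivative (\<lambda>h. frechet_derivative \<psi> (at (x - t *\<^sub>R v)) (- (h *\<^sub>R v)))) (at t within {0..1})"
      using has_derivative_compose[OF d c(3)] .
    then have "((\<lambda>t. - \<psi> (x - t *\<^sub>R v)) has_derivative (\<lambda>h. h *\<^sub>R frechet_derivative \<psi> (at (x - t *\<^sub>R v)) v)) (at t within {0..1})"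
      by (auto dest: has_derivative_minus simp: linear_neg[OF lin] linear_cmul[OF lin])
    then show "((\<lambda>t. - \<psi> (x - t *\<^sub>R v)) has_vector_derivative frechet_derivative \<psi> (at (x - t *\<^sub>R v)) v) (at t within {0..1})"
      by (simp add: has_vector_derivative_def)
  qed simp
  finally show ?thesis by simp
qed

context kernel
begin

text \<open>
  Fubini's theorem in the other order than in \<open>integral_avg_mult\<close>, so that the average acts on \<open>g\<close>.
\<close>

lemma integral_avg_mult_swap:
  fixes f :: "real^'n \<Rightarrow> real"
  assumes f: "locally_integrable f" and g: "continuous_on UNIV g" "\<And>x. x \<notin> cball 0 R \<Longrightarrow> g x = 0"
  shows "(\<integral>x. avg M f x * g x \<partial>lborel) = (\<integral>x. f x * (\<integral>s. g (x - s) \<partial>M) \<partial>lborel)"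
proof -
  have [measurable]: "f \<in> borel_measurable borel" using assms by (simp add: locally_integrable_def)
  have [measurable]: "g \<in> borel_measurable borel" using g by (simp add: borel_measurable_continuous_onI)
  have int: "integrable (lborel \<Otimes>\<^sub>M M) (\<lambda>(x, s). f (x + s) * g x)"
    by (rule integrable_translates_mult[OF f g])
  have "integrable (lborel \<Otimes>\<^sub>M M) (\<lambda>(x, s). f x * g (x - s))"
  proof (rule integrableI_bounded)
    show m: "(\<lambda>(x, s). f x * g (x - s)) \<in> borel_measurable (lborel \<Otimes>\<^sub>M M)"
      by (rule measurable_pair_borel) measurable
    have m': "(\<lambda>(x, s). f (x + s) * g x) \<in> borel_measurable (lborel \<Otimes>\<^sub>M M)"
      by (rule measurable_pair_borel) measurable
    have "(\<integral>\<^sup>+z. ennreal (norm (case z of (x, s) \<Rightarrow> f x * g (x - s))) \<partial>(lborel \<Otimes>\<^sub>M M)) =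
      (\<integral>\<^sup>+s. \<integral>\<^sup>+x. ennreal (norm (f x * g (x - s))) \<partial>lborel \<partial>M)"
      using P.nn_integral_snd[of "\<lambda>z. ennreal (norm (case z of (x, s) \<Rightarrow> f x * g (x - s)))"] m by simp
    also have "\<dots> = (\<integral>\<^sup>+s. \<integral>\<^sup>+x. ennreal (norm (f (x + s) * g x)) \<partial>lborel \<partial>M)"
    proof (rule nn_integral_cong)
      fix s
      show "(\<integral>\<^sup>+x. ennreal (norm (f x * g (x - s))) \<partial>lborel) = (\<integral>\<^sup>+x. ennreal (norm (f (x + s) * g x)) \<partial>lborel)"
        using nn_integral_translate[of "\<lambda>x. ennreal (norm (f x * g (x - s)))" s] by simp
    qed
    also have "\<dots> = (\<integral>\<^sup>+z. ennreal (norm (case z of (x, s) \<Rightarrow> f (x + s) * g x)) \<partial>(lborel \<Otimes>\<^sub>M M))"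
      using P.nn_integral_snd[of "\<lambda>z. ennreal (norm (case z of (x, s) \<Rightarrow> f (x + s) * g x))"] m' by simp
    also have "\<dots> < \<infinity>" using int by (simp add: integrable_iff_bounded)
    finally show "(\<integral>\<^sup>+z. ennreal (norm (case z of (x, s) \<Rightarrow> f x * g (x - s))) \<partial>(lborel \<Otimes>\<^sub>M M)) < \<infinity>" .
  qed
  from P.Fubini_integral[OF this]
  have "(\<integral>s. \<integral>x. f x * g (x - s) \<partial>lborel \<partial>M) = (\<integral>x. f x * (\<integral>s. g (x - s) \<partial>M) \<partial>lborel)"
    by simp
  with integral_avg_mult[OF f g] show ?thesis by (rule trans)
qed

end

text \<open>
  The special case of \<open>integrable_translates_mult\<close> in which the shift is \<open>0\<close>.
\<close>

lemma integrable_mult_compact_support: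
  fixes f :: "real^'n \<Rightarrow> real"
  assumes f: "locally_integrable f" and g: "continuous_on UNIV g" "\<And>x. x \<notin> cball 0 R \<Longrightarrow> g x = 0"
  shows "integrable lborel (\<lambda>x. f x * g x)"
proof -
  have [measurable]: "f \<in> borel_measurable borel" using f by (simp add: locally_integrable_def)
  interpret K: kernel "return borel 0 :: (real^'n) measure" "norm (0 :: real^'n)" by (rule kernel_return)
  have "integrable (lborel \<Otimes>\<^sub>M return borel 0) (\<lambda>(x, s). f (x + s) * g x)"
    by (rule K.integrable_translates_mult[OF f g])
  from K.P.integrable_fst[OF this] have "integrable lborel (\<lambda>x. \<integral>s. f (x + s) * g x \<partial>return borel 0)" .
  moreover have "(\<integral>s. f (x + s) * g x \<partial>return borel 0) = f x * g x" for x
    by (subst integral_return) auto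
  ultimately show ?thesis by (simp only:)
qed

lemma integrable_mult_test:
  fixes f :: "real^'n \<Rightarrow> real"
  assumes f: "locally_integrable f" and t: "test_function \<psi>"
  shows "integrable lborel (\<lambda>x. f x * \<psi> x)"
    and "integrable lborel (\<lambda>x. f x * frechet_derivative \<psi> (at x) v)"
proof -
  obtain R where R: "\<forall>x. x \<notin> cball 0 R \<longrightarrow> \<psi> x = 0 \<and> (\<forall>v. frechet_derivative \<psi> (at x) v = 0)"
    using test_function_support[OF t] by (rule exE)
  show "integrable lborel (\<lambda>x. f x * \<psi> x)"
    by (rule integrable_mult_compact_support[OF f test_function_continuous(1)[OF t], of R]) (use R in \<open>simp del: mem_cball\<close>)
  show "integrable lborel (\<lambda>x. f x * frechet_derivative \<psi> (at x) v)"
    by (rule integrable_mult_compact_support[OF f test_function_continuous(2)[OF t], of R]) (use R in \<open>simp del: mem_cball\<close>)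
qed

text \<open>
  Tested with \<open>\<psi>\<close>, the right-hand side becomes an integral of \<open>\<phi>\<close> against the mean of a derivative of
  \<open>\<psi>\<close> along a segment, which is a difference of values of \<open>\<psi>\<close>; a translation moves this difference back to
  \<open>\<phi>\<close>.
\<close>

lemma difference_quotient_eq_avg:
  fixes \<phi> :: "real^'n \<Rightarrow> real^'n"
  assumes m[measurable]: "\<phi> \<in> borel_measurable borel" "\<Phi> \<in> borel_measurable borel" and wg: "has_weak_gradient \<phi> \<Phi>"
  shows "AE x in lborel. \<phi> (x + h *\<^sub>R axis j 1) $ i - \<phi> x $ i = h * avg (segment_measure (h *\<^sub>R axis j 1)) \<Phi> x $ i $ j"
proof -
  let ?v = "h *\<^sub>R axis j (1 :: real) :: real^'n"
  let ?M = "segment_measure ?v"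
  interpret kernel ?M "norm ?v" by (rule kernel_segment)
  have L: "locally_integrable \<phi>" "locally_integrable \<Phi>"
    using wg unfolding has_weak_gradient_borel_iff[OF m] by auto
  have bl: "bounded_linear (\<lambda>x :: real^'n. x $ i)" "bounded_linear (\<lambda>x :: real^'n^'n. x $ i $ j)"
    by (auto intro: bounded_linear_compose[OF bounded_linear_vec_nth bounded_linear_vec_nth] bounded_linear_vec_nth)
  have mA[measurable]: "avg ?M \<Phi> \<in> borel_measurable borel" "avg ?M \<phi> \<in> borel_measurable borel" by (simp_all add: borel_measurable_avg)
  have wA: "has_weak_gradient (avg ?M \<phi>) (avg ?M \<Phi>)" by (rule has_weak_gradient_avg[OF m wg])
  have L\<phi>: "locally_integrable (\<lambda>x. \<phi> x $ i)" by (rule locally_integrable_bounded_linear[OF L(1) bl(1)])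
  have Ls: "locally_integrable (\<lambda>x. \<phi> (x + ?v) $ i)"
  proof -
    have "has_weak_gradient (\<lambda>x. \<phi> (x + ?v)) (\<lambda>x. \<Phi> (x + ?v))" by (rule has_weak_gradient_translate[OF m wg])
    then have "locally_integrable (\<lambda>x. \<phi> (x + ?v))"
      by (subst (asm) has_weak_gradient_borel_iff) auto
    then show ?thesis by (rule locally_integrable_bounded_linear[OF _ bl(1)])
  qed
  have LA: "locally_integrable (\<lambda>x. avg ?M \<Phi> x $ i $ j)"
    by (rule locally_integrable_bounded_linear[OF avg_locally_integrable[OF L(2)] bl(2)])
  have "AE x in lebesgue. (\<phi> (x + ?v) $ i - \<phi> x $ i) - h * avg ?M \<Phi> x $ i $ j = 0"
  proof (rule AE_zero_if_test_integrals_zero)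
    have "locally_integrable (\<lambda>x. (\<phi> (x + ?v) $ i - \<phi> x $ i) - h * avg ?M \<Phi> x $ i $ j)"
      using Ls L\<phi> LA unfolding locally_integrable_def by (auto intro!: set_integral_diff set_integrable_mult_right)
    then show "Lp_loc 1 (\<lambda>x. (\<phi> (x + ?v) $ i - \<phi> x $ i) - h * avg ?M \<Phi> x $ i $ j)"
      by (subst Lp_loc_1_iff_locally_integrable) (auto simp: locally_integrable_def)
    fix \<psi> :: "real^'n \<Rightarrow> real" assume t: "test_function \<psi>"
    note c = test_function_continuous[OF t]
    obtain R where R: "\<forall>x. x \<notin> cball 0 R \<longrightarrow> \<psi> x = 0 \<and> (\<forall>v. frechet_derivative \<psi> (at x) v = 0)"
      using test_function_support[OF t] by (rule exE)
    have lin: "frechet_derivative \<psi> (at y) ?v = h * frechet_derivative \<psi> (at y) (axis j 1)" for y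
      using linear_cmul[OF has_derivative_linear[OF c(3)]] by simp
    have [measurable]: "\<psi> \<in> borel_measurable borel" by (intro borel_measurable_continuous_onI c)
    have "(\<integral>x. avg ?M \<Phi> x $ i $ j * \<psi> x \<partial>lborel) = - (\<integral>x. avg ?M \<phi> x $ i * frechet_derivative \<psi> (at x) (axis j 1) \<partial>lborel)"
    proof -
      from wA have "\<forall>\<psi> i j. test_function \<psi> \<longrightarrow> (\<integral>y. avg ?M \<phi> y $ i * frechet_derivative \<psi> (at y) (axis j 1) \<partial>lborel) =
          - (\<integral>y. avg ?M \<Phi> y $ i $ j * \<psi> y \<partial>lborel)"
        unfolding has_weak_gradient_borel_iff[OF mA(2,1)] by (elim conjE)
      from this[rule_format, OF t, of i j] show ?thesis by simp
    qed
    then have "(\<integral>x. (h * avg ?M \<Phi> x $ i $ j) * \<psi> x \<partial>lborel) = - (\<integral>x. avg ?M \<phi> x $ i * frechet_derivative \<psi> (at x) ?v \<partial>lborel)"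
      unfolding lin by (simp add: mult_ac)
    also have "(\<integral>x. avg ?M \<phi> x $ i * frechet_derivative \<psi> (at x) ?v \<partial>lborel) = (\<integral>x. avg ?M (\<lambda>x. \<phi> x $ i) x * frechet_derivative \<psi> (at x) ?v \<partial>lborel)"
    proof (rule integral_cong_AE)
      have [measurable]: "(\<lambda>x. frechet_derivative \<psi> (at x) ?v) \<in> borel_measurable borel"
        by (intro borel_measurable_continuous_onI c)
      have [measurable]: "avg ?M (\<lambda>x. \<phi> x $ i) \<in> borel_measurable borel" by (intro borel_measurable_avg) measurable
      show "(\<lambda>x. avg ?M \<phi> x $ i * frechet_derivative \<psi> (at x) ?v) \<in> borel_measurable lborel"
        "(\<lambda>x. avg ?M (\<lambda>x. \<phi> x $ i) x * frechet_derivative \<psi> (at x) ?v) \<in> borel_measurable lborel" by measurable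
      show "AE x in lborel. avg ?M \<phi> x $ i * frechet_derivative \<psi> (at x) ?v = avg ?M (\<lambda>x. \<phi> x $ i) x * frechet_derivative \<psi> (at x) ?v"
        using avg_bounded_linear[OF L(1) bl(1)] by eventually_elim simp
    qed
    also have "\<dots> = (\<integral>x. \<phi> x $ i * (\<integral>s. frechet_derivative \<psi> (at (x - s)) ?v \<partial>?M) \<partial>lborel)"
      by (rule integral_avg_mult_swap[OF L\<phi> c(2), of R]) (use R in \<open>simp del: mem_cball\<close>)
    also have "\<dots> = (\<integral>x. \<phi> x $ i * \<psi> x - \<phi> x $ i * \<psi> (x - ?v) \<partial>lborel)"
      unfolding test_function_segment[OF t] right_diff_distrib ..
    also have "\<dots> = (\<integral>x. \<phi> x $ i * \<psi> x \<partial>lborel) - (\<integral>x. \<phi> x $ i * \<psi> (x - ?v) \<partial>lborel)"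
      using integrable_mult_test(1)[OF L\<phi> t] integrable_mult_test(1)[OF L\<phi> test_function_translate(1)[OF t, of "- ?v"]] by simp
    also have "(\<integral>x. \<phi> x $ i * \<psi> (x - ?v) \<partial>lborel) = (\<integral>x. \<phi> (x + ?v) $ i * \<psi> x \<partial>lborel)"
      using integral_translate[of "\<lambda>x. \<phi> x $ i * \<psi> (x - ?v)" ?v] by simp
    finally have "(\<integral>x. (h * avg ?M \<Phi> x $ i $ j) * \<psi> x \<partial>lborel) = (\<integral>x. \<phi> (x + ?v) $ i * \<psi> x \<partial>lborel) - (\<integral>x. \<phi> x $ i * \<psi> x \<partial>lborel)"
      by simp
    moreover have "integrable lborel (\<lambda>x. (h * avg ?M \<Phi> x $ i $ j) * \<psi> x)"
      using integrable_mult_right[OF integrable_mult_test(1)[OF LA t], of h] by (simp add: mult.assoc)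
    ultimately have "(\<integral>x. ((\<phi> (x + ?v) $ i - \<phi> x $ i) - h * avg ?M \<Phi> x $ i $ j) * \<psi> x \<partial>lborel) = 0"
      using integrable_mult_test(1)[OF L\<phi> t] integrable_mult_test(1)[OF Ls t] by (simp add: left_diff_distrib)
    moreover have "(\<integral>x. ((\<phi> (x + ?v) $ i - \<phi> x $ i) - h * avg ?M \<Phi> x $ i $ j) * \<psi> x \<partial>lebesgue) =
      (\<integral>x. ((\<phi> (x + ?v) $ i - \<phi> x $ i) - h * avg ?M \<Phi> x $ i $ j) * \<psi> x \<partial>lborel)"
    proof (rule integral_completion)
      have [measurable]: "(\<lambda>x. \<phi> (x + ?v) $ i) \<in> borel_measurable borel" "(\<lambda>x. \<phi> x $ i) \<in> borel_measurable borel"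
        "(\<lambda>x. avg ?M \<Phi> x $ i $ j) \<in> borel_measurable borel"
        using Ls L\<phi> LA by (simp_all add: locally_integrable_def)
      have "(\<lambda>x. ((\<phi> (x + ?v) $ i - \<phi> x $ i) - h * avg ?M \<Phi> x $ i $ j) * \<psi> x) \<in> borel_measurable borel"
        by (intro borel_measurable_times borel_measurable_diff borel_measurable_const) fact+
      then show "(\<lambda>x. ((\<phi> (x + ?v) $ i - \<phi> x $ i) - h * avg ?M \<Phi> x $ i $ j) * \<psi> x) \<in> borel_measurable lborel" by simp
    qed
    ultimately show "(LINT x|lebesgue. ((\<phi> (x + ?v) $ i - \<phi> x $ i) - h * avg ?M \<Phi> x $ i $ j) * \<psi> x) = 0" by simp
  qed
  then show ?thesis unfolding AE_lebesgue_iff by eventually_elim simp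
qed

section \<open>Null Lagrangians on the torus\<close>

text \<open>
  The discrete counterpart of the identity that the mean of \<open>\<partial>\<^sub>p u * \<partial>\<^sub>q v\<close> is symmetric in
  \<open>p\<close> and \<open>q\<close>. Both sides expand into correlations of \<open>u\<close> and \<open>v\<close>, which depend on the difference
  of the two shifts only. The shifts of \<open>u\<close> and \<open>v\<close> have opposite signs: with equal signs the correlations
  with the shifts \<open>p - q\<close> and \<open>q - p\<close> would not match.
\<close>

lemma discrete_null_lagrangian:
  fixes u v :: "real^'n \<Rightarrow> real"
  assumes k: "k \<ge> 1" and m[measurable]: "u \<in> borel_measurable borel" "v \<in> borel_measurable borel"
    and per: "periodic k u" "periodic k v" and bd: "\<And>x. \<bar>u x\<bar> \<le> B" "\<And>x. \<bar>v x\<bar> \<le> B"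
  shows "(\<integral>x. (u (x + p) - u x) * (v (x - q) - v x) \<partial>torus k) = (\<integral>x. (u (x + q) - u x) * (v (x - p) - v x) \<partial>torus k)"
proof -
  interpret prob_space "torus k :: (real^'n) measure" by (rule prob_space_torus[OF k])
  define I where "I a b = (\<integral>x. u (x + a) * v (x + b) \<partial>torus k)" for a b
  have int: "integrable (torus k) (\<lambda>x. u (x + a) * v (x + b))" for a b
  proof (rule integrable_const_bound[of _ "B * B"])
    have "B \<ge> 0" using bd(1)[of 0] by linarith
    then show "AE x in torus k. norm (u (x + a) * v (x + b)) \<le> B * B"
      using bd by (intro AE_I2) (auto simp: abs_mult intro!: mult_mono)
  qed measurable
  have shift: "I (a + t) (b + t) = I a b" for a b t
  proof -
    have "periodic k (\<lambda>x. u (x + a) * v (x + b))"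
      unfolding periodic_def
    proof (intro allI)
      fix w and x :: "real^'n"
      have "u (x + real k *\<^sub>R ivec w + a) = u (x + a)" "v (x + real k *\<^sub>R ivec w + b) = v (x + b)"
        using per unfolding periodic_def by (metis add.assoc add.commute)+
      then show "u (x + real k *\<^sub>R ivec w + a) * v (x + real k *\<^sub>R ivec w + b) = u (x + a) * v (x + b)" by simp
    qed
    then have "(\<integral>x. u ((x + t) + a) * v ((x + t) + b) \<partial>torus k) = I a b"
      unfolding I_def using integral_torus_translate(1)[OF k, of "\<lambda>x. u (x + a) * v (x + b)" t] by simp
    then show ?thesis by (simp add: I_def ac_simps)
  qed
  have expand: "(\<integral>x. (u (x + a) - u x) * (v (x - b) - v x) \<partial>torus k) = I a (- b) - I a 0 - I 0 (- b) + I 0 0" for a b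
  proof -
    have "(\<integral>x. (u (x + a) - u x) * (v (x - b) - v x) \<partial>torus k) =
      (\<integral>x. u (x + a) * v (x + (- b)) - u (x + a) * v (x + 0) - u (x + 0) * v (x + (- b)) + u (x + 0) * v (x + 0) \<partial>torus k)"
      by (intro Bochner_Integration.integral_cong) (simp_all add: algebra_simps)
    also have "\<dots> = I a (- b) - I a 0 - I 0 (- b) + I 0 0"
      unfolding I_def using int
      by (subst Bochner_Integration.integral_add Bochner_Integration.integral_diff; (intro Bochner_Integration.integrable_diff int)?)+ simp
    finally show ?thesis .
  qed
  have "I p (- q) = I q (- p)"
    using shift[of p q "- q"] shift[of q p "- p"] by (simp add: add.commute)
  moreover have "I p 0 = I 0 (- p)" "I q 0 = I 0 (- q)"
    using shift[of p "- p" 0] shift[of q "- q" 0] by simp_all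
  ultimately show ?thesis unfolding expand by simp
qed

lemma (in kernel) norm_avg_le:
  assumes [measurable]: "f \<in> borel_measurable borel" and bd: "\<And>x. norm (f x) \<le> B"
  shows "norm (avg M f x) \<le> B"
proof -
  have i: "integrable M (\<lambda>s. f (x + s))"
    using bd by (intro integrable_const_bound[of _ B]) auto
  have "norm (avg M f x) \<le> (\<integral>s. norm (f (x + s)) \<partial>M)" unfolding avg_def by (rule integral_norm_bound)
  also have "\<dots> \<le> (\<integral>s. B \<partial>M)" using i bd by (intro integral_mono) auto
  finally show ?thesis by (simp add: prob_space)
qed

lemma avg_L2_tendsto_torus:
  fixes f :: "real^'n \<Rightarrow> 'b::euclidean_space"
  assumes k: "k \<ge> 1" and m[measurable]: "f \<in> borel_measurable borel" and bd: "bounded (range f)"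
    and M: "\<And>m. kernel (M m) (r m)" and r: "r \<longlonglongrightarrow> 0"
  shows "L2_tendsto (torus k) (\<lambda>m. avg (M m) f) f"
proof -
  interpret prob_space "torus k :: (real^'n) measure" by (rule prob_space_torus[OF k])
  obtain B where B: "\<And>x. norm (f x) \<le> B" using bd by (auto simp: bounded_iff)
  have mA[measurable]: "avg (M m) f \<in> borel_measurable borel" for m by (rule kernel.borel_measurable_avg[OF M m])
  have L2: "locally_L2 f"
    unfolding locally_L2_def
  proof (intro conjI allI m)
    fix R
    have "(\<integral>\<^sup>+x\<in>cball 0 R. ennreal ((norm (f x))\<^sup>2) \<partial>lborel) \<le> (\<integral>\<^sup>+x. ennreal (B\<^sup>2) * indicator (cball (0 :: real^'n) R) x \<partial>lborel)"
    proof (rule nn_integral_mono)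
      fix x
      have "(norm (f x))\<^sup>2 \<le> B\<^sup>2" using B[of x] by (intro power_mono) auto
      then show "ennreal ((norm (f x))\<^sup>2) * indicator (cball 0 R) x \<le> ennreal (B\<^sup>2) * indicator (cball 0 R) x"
        by (intro mult_right_mono ennreal_leI) auto
    qed
    also have "\<dots> = ennreal (B\<^sup>2) * emeasure lborel (cball (0 :: real^'n) R)"
      by (simp add: nn_integral_cmult_indicator)
    also have "\<dots> < \<infinity>" using emeasure_lborel_cball_finite[of "0 :: real^'n" R] by (simp add: ennreal_mult_less_top)
    finally show "(\<integral>\<^sup>+x\<in>cball 0 R. ennreal ((norm (f x))\<^sup>2) \<partial>lborel) < \<infinity>" .
  qed
  show ?thesis
  proof (rule L2_tendstoI_nn)
    show "square_integrable (torus k) (avg (M m) f)" for m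
      by (rule square_integrable_bounded[of _ B]) (use kernel.norm_avg_le[OF M m B] in auto)
    show "square_integrable (torus k) f"
      by (rule square_integrable_bounded[of _ B]) (use B in auto)
    obtain R where R: "\<And>f. f \<in> borel_measurable borel \<Longrightarrow> (\<integral>\<^sup>+x. f x \<partial>torus k) \<le> (\<integral>\<^sup>+x\<in>cball (0 :: real^'n) R. f x \<partial>lborel)"
      using nn_integral_torus_le_cball[OF k] by blast
    show "(\<lambda>m. \<integral>\<^sup>+x. ennreal ((norm (avg (M m) f x - f x))\<^sup>2) \<partial>torus k) \<longlonglongrightarrow> 0"
    proof (rule tendsto_sandwich[OF _ _ tendsto_const avg_L2_tendsto[OF L2 M r, of R]])
      show "\<forall>\<^sub>F m in sequentially. (\<integral>\<^sup>+x. ennreal ((norm (avg (M m) f x - f x))\<^sup>2) \<partial>torus k) \<le>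
        (\<integral>\<^sup>+x\<in>cball 0 R. ennreal ((norm (avg (M m) f x - f x))\<^sup>2) \<partial>lborel)"
        by (intro always_eventually allI R) measurable
    qed simp
  qed
qed

lemma bilinear_coordinates: "bilinear (\<lambda>u v :: real^'n^'n. u $ a $ i * v $ b $ j)"
  unfolding bilinear_def by (auto intro!: linearI simp: algebra_simps)

lemma bilinear_field_const:
  assumes "bilinear b"
  obtains c where "bilinear_field M (\<lambda>x. b) c"
proof -
  obtain c where "\<And>u v. norm (b u v) \<le> c * norm u * norm v"
    using bilinear_bounded[OF assms] by metis
  then show thesis using assms by (intro that[of c]) (simp add: bilinear_field_def)
qed

text \<open>
  Difference quotients are averages of the gradient along short segments and converge to its components in the mean
  square, so the discrete identities pass to the limit.
\<close>

lemma bounded_torus_gradient_mean_and_minors: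
  fixes \<phi> :: "real^'n \<Rightarrow> real^'n"
  assumes k: "k \<ge> 1" and g: "bounded_torus_gradient k \<phi> \<Phi>"
  shows "(\<integral>x. \<Phi> x $ a $ i \<partial>torus k) = 0"
    and "(\<integral>x. \<Phi> x $ a $ i * \<Phi> x $ b $ j \<partial>torus k) = (\<integral>x. \<Phi> x $ a $ j * \<Phi> x $ b $ i \<partial>torus k)"
proof -
  interpret prob_space "torus k :: (real^'n) measure" by (rule prob_space_torus[OF k])
  have m[measurable]: "\<phi> \<in> borel_measurable borel" "\<Phi> \<in> borel_measurable borel"
    and bd: "bounded (range \<phi>)" "bounded (range \<Phi>)" and per: "periodic k \<phi>" "periodic k \<Phi>" and wg: "has_weak_gradient \<phi> \<Phi>"
    using g by (auto simp: bounded_torus_gradient_def)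
  obtain B where B: "\<And>x. norm (\<phi> x) \<le> B" using bd(1) by (auto simp: bounded_iff)
  have uB: "\<bar>\<phi> x $ c\<bar> \<le> B" for x c using component_le_norm_cart[of "\<phi> x" c] B[of x] by linarith
  have um: "(\<lambda>x. \<phi> x $ c) \<in> borel_measurable borel" and up: "periodic k (\<lambda>x. \<phi> x $ c)" for c
    using per by (auto simp: periodic_def)
  define A where "A s l = avg (segment_measure (s *\<^sub>R axis l (1::real))) \<Phi>" for s :: real and l :: 'n
  have dq: "AE x in torus k. \<phi> (x + s *\<^sub>R axis l 1) $ c - \<phi> x $ c = s * A s l x $ c $ l" for s l c
    unfolding A_def by (intro AE_torusI difference_quotient_eq_avg[OF m wg])
  have mA[measurable]: "A s l \<in> borel_measurable borel" for s l
    unfolding A_def by (rule kernel.borel_measurable_avg[OF kernel_segment m(2)])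
  define h where "h m = 1 / real (Suc m)" for m
  have h: "h \<longlonglongrightarrow> 0" unfolding h_def using LIMSEQ_inverse_real_of_nat by (simp add: inverse_eq_divide)
  have h0: "h m \<noteq> 0" for m by (simp add: h_def)
  have lim: "L2_tendsto (torus k) (\<lambda>m. A (s * h m) l) \<Phi>" for s l
    unfolding A_def
  proof (rule avg_L2_tendsto_torus[OF k m(2) bd(2) kernel_segment])
    have "(\<lambda>m. \<bar>s\<bar> * \<bar>h m\<bar>) \<longlonglongrightarrow> \<bar>s\<bar> * \<bar>0\<bar>" by (intro tendsto_intros h)
    then show "(\<lambda>m. norm ((s * h m) *\<^sub>R (axis l 1 :: real^'n))) \<longlonglongrightarrow> 0" by (simp add: abs_mult)
  qed
  show "(\<integral>x. \<Phi> x $ a $ i \<partial>torus k) = 0"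
  proof -
    have "bilinear (\<lambda>(u :: real^'n^'n) (v :: real). u $ a $ i * v)"
      unfolding bilinear_def by (auto intro!: linearI simp: algebra_simps)
    then obtain c where c: "bilinear_field (torus k :: (real^'n) measure) (\<lambda>x (u :: real^'n^'n) (v :: real). u $ a $ i * v) c"
      by (rule bilinear_field_const)
    have "square_integrable (torus k) (\<lambda>x :: real^'n. 1 :: real)"
      by (rule square_integrable_bounded[of _ 1]) auto
    from bilinear_field_tendsto[OF c lim[of 1 i] L2_tendsto_const[OF this]]
    have "(\<lambda>m. \<integral>x. A (h m) i x $ a $ i \<partial>torus k) \<longlonglongrightarrow> (\<integral>x. \<Phi> x $ a $ i \<partial>torus k)" by simp
    moreover have "(\<integral>x. A (h m) i x $ a $ i \<partial>torus k) = 0" for m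
    proof -
      have int: "integrable (torus k) (\<lambda>x. \<phi> x $ a)"
        using uB by (intro integrable_const_bound[of _ B]) auto
      have "h m * (\<integral>x. A (h m) i x $ a $ i \<partial>torus k) = (\<integral>x. h m * A (h m) i x $ a $ i \<partial>torus k)" by simp
      also have "\<dots> = (\<integral>x. \<phi> (x + h m *\<^sub>R axis i 1) $ a - \<phi> x $ a \<partial>torus k)"
      proof (rule integral_cong_AE)
        show "AE x in torus k. h m * A (h m) i x $ a $ i = \<phi> (x + h m *\<^sub>R axis i 1) $ a - \<phi> x $ a"
          using dq[of "h m" i a] by eventually_elim simp
      qed measurable
      also have "\<dots> = 0"
        using integral_torus_translate[OF k um[of a] up[of a], of "h m *\<^sub>R axis i 1"] int by simp
      finally show ?thesis using h0 by simp
    qed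
    ultimately show ?thesis by (auto dest: LIMSEQ_unique[OF tendsto_const])
  qed
  have tend: "(\<lambda>m. \<integral>x. A (h m) i x $ a $ i * A (- h m) j x $ b $ j \<partial>torus k) \<longlonglongrightarrow> (\<integral>x. \<Phi> x $ a $ i * \<Phi> x $ b $ j \<partial>torus k)" for i j
  proof -
    obtain c where c: "bilinear_field (torus k :: (real^'n) measure) (\<lambda>x (u :: real^'n^'n) v. u $ a $ i * v $ b $ j) c"
      using bilinear_field_const[OF bilinear_coordinates] .
    show ?thesis using bilinear_field_tendsto[OF c lim[of 1 i] lim[of "-1" j]] by simp
  qed
  have eq: "- (h m)\<^sup>2 * (\<integral>x. A (h m) i x $ a $ i * A (- h m) j x $ b $ j \<partial>torus k) =
    (\<integral>x. (\<phi> (x + h m *\<^sub>R axis i 1) $ a - \<phi> x $ a) * (\<phi> (x - h m *\<^sub>R axis j 1) $ b - \<phi> x $ b) \<partial>torus k)" for m i j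
  proof -
    have "(\<integral>x. (\<phi> (x + h m *\<^sub>R axis i 1) $ a - \<phi> x $ a) * (\<phi> (x - h m *\<^sub>R axis j 1) $ b - \<phi> x $ b) \<partial>torus k) =
      (\<integral>x. (- (h m)\<^sup>2) * (A (h m) i x $ a $ i * A (- h m) j x $ b $ j) \<partial>torus k)"
    proof (rule integral_cong_AE)
      show "AE x in torus k. (\<phi> (x + h m *\<^sub>R axis i 1) $ a - \<phi> x $ a) * (\<phi> (x - h m *\<^sub>R axis j 1) $ b - \<phi> x $ b) =
        (- (h m)\<^sup>2) * (A (h m) i x $ a $ i * A (- h m) j x $ b $ j)"
        using dq[of "h m" i a] dq[of "- h m" j b]
        by eventually_elim (simp add: power2_eq_square)
    qed measurable
    then show ?thesis by simp
  qed
  have "(\<integral>x. A (h m) i x $ a $ i * A (- h m) j x $ b $ j \<partial>torus k) = (\<integral>x. A (h m) j x $ a $ j * A (- h m) i x $ b $ i \<partial>torus k)" for m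
  proof -
    have "- (h m)\<^sup>2 * (\<integral>x. A (h m) i x $ a $ i * A (- h m) j x $ b $ j \<partial>torus k) = - (h m)\<^sup>2 * (\<integral>x. A (h m) j x $ a $ j * A (- h m) i x $ b $ i \<partial>torus k)"
      unfolding eq by (rule discrete_null_lagrangian[OF k um um up up uB uB])
    then show ?thesis using h0[of m] by simp
  qed
  then show "(\<integral>x. \<Phi> x $ a $ i * \<Phi> x $ b $ j \<partial>torus k) = (\<integral>x. \<Phi> x $ a $ j * \<Phi> x $ b $ i \<partial>torus k)"
    using LIMSEQ_unique[OF tend[of i j]] tend[of j i] by simp
qed

lemma minor_form_sum:
  fixes X :: "real^'n^'n"
  shows "minor_form X X = (\<Sum>a\<in>UNIV. \<Sum>b\<in>UNIV. X $ a $ a * X $ b $ b - X $ a $ b * X $ b $ a)"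
  by (simp add: minor_form_def trace_def matrix_matrix_mult_def sum_product sum_subtractf)

lemma torus_gradient_approximation:
  fixes \<phi> :: "real^'n \<Rightarrow> real^'n"
  assumes k: "k \<ge> 1" and m[measurable]: "\<phi> \<in> borel_measurable borel" "\<Phi> \<in> borel_measurable borel"
    and per: "periodic k \<phi>" "periodic k \<Phi>" and wg: "has_weak_gradient \<phi> \<Phi>"
    and sq: "square_integrable (torus k) \<Phi>"
  shows "\<exists>\<phi>' \<Phi>'. (\<forall>m. bounded_torus_gradient k (\<phi>' m) (\<Phi>' m)) \<and> L2_tendsto (torus k) \<Phi>' \<Phi>"
proof -
  interpret prob_space "torus k :: (real^'n) measure" by (rule prob_space_torus[OF k])
  have fin: "(\<integral>\<^sup>+x. ennreal ((norm (\<Phi> x))\<^sup>2) \<partial>torus k) < \<infinity>"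
    using nn_integral_square[OF sq] by simp
  from bounded_torus_gradient_approximation[OF k m per wg fin]
  obtain \<phi>' \<Phi>' where a: "\<forall>m. bounded_torus_gradient k (\<phi>' m) (\<Phi>' m)"
    "(\<lambda>m. \<integral>\<^sup>+x. ennreal ((norm (\<Phi>' m x - \<Phi> x))\<^sup>2) \<partial>torus k) \<longlonglongrightarrow> 0"
    by (elim exE conjE)
  have "L2_tendsto (torus k) \<Phi>' \<Phi>"
  proof (rule L2_tendstoI_nn[OF _ sq a(2)])
    fix m
    obtain B where "\<And>x. norm (\<Phi>' m x) \<le> B" using a(1)[rule_format, of m] by (auto simp: bounded_torus_gradient_def bounded_iff)
    then show "square_integrable (torus k) (\<Phi>' m)"
      using a(1)[rule_format, of m] by (intro square_integrable_bounded[of _ B]) (auto simp: bounded_torus_gradient_def)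
  qed
  with a(1) show ?thesis by blast
qed

text \<open>
  For bounded gradients the terms linear in the gradient have mean zero and the quadratic ones cancel in pairs of
  minors. The form is continuous in the mean square, which covers the general case.
\<close>

lemma null_lagrangian:
  fixes \<phi> :: "real^'n \<Rightarrow> real^'n"
  assumes k: "k \<ge> 1" and m[measurable]: "\<phi> \<in> borel_measurable borel" "\<Phi> \<in> borel_measurable borel"
    and per: "periodic k \<phi>" "periodic k \<Phi>" and wg: "has_weak_gradient \<phi> \<Phi>"
    and sq: "square_integrable (torus k) \<Phi>"
  shows "(\<integral>x. minor_form (G + \<Phi> x) (G + \<Phi> x) \<partial>torus k) = minor_form G G"
proof -
  interpret prob_space "torus k :: (real^'n) measure" by (rule prob_space_torus[OF k])
  have bdd: "(\<integral>x. minor_form (G + \<Psi> x) (G + \<Psi> x) \<partial>torus k) = minor_form G G" if g: "bounded_torus_gradient k \<psi> \<Psi>" for \<psi> \<Psi>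
  proof -
    have [measurable]: "\<Psi> \<in> borel_measurable borel" using g by (simp add: bounded_torus_gradient_def)
    obtain B where B: "\<And>x. norm (\<Psi> x) \<le> B" using g by (auto simp: bounded_torus_gradient_def bounded_iff)
    have B': "\<bar>\<Psi> x $ a $ b\<bar> \<le> B" for x a b
      using component_le_norm_cart[of "\<Psi> x $ a" b] Finite_Cartesian_Product.norm_nth_le[of "\<Psi> x" a] B[of x] by linarith
    have "B \<ge> 0" using B[of 0] norm_ge_zero order_trans by blast
    have i1: "integrable (torus k) (\<lambda>x. \<Psi> x $ a $ b)" for a b
      using B' by (intro integrable_const_bound[of _ B]) auto
    have i2: "integrable (torus k) (\<lambda>x. \<Psi> x $ a $ b * \<Psi> x $ c $ d)" for a b c d
      using B' \<open>B \<ge> 0\<close> by (intro integrable_const_bound[of _ "B * B"]) (auto simp: abs_mult intro!: mult_mono)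
    note z = bounded_torus_gradient_mean_and_minors[OF k g]
    let ?e = "\<lambda>x a b. (G $ a $ a * G $ b $ b - G $ a $ b * G $ b $ a) +
        (G $ a $ a * \<Psi> x $ b $ b + G $ b $ b * \<Psi> x $ a $ a - G $ a $ b * \<Psi> x $ b $ a - G $ b $ a * \<Psi> x $ a $ b) +
        (\<Psi> x $ a $ a * \<Psi> x $ b $ b - \<Psi> x $ a $ b * \<Psi> x $ b $ a)"
    have "(\<integral>x. minor_form (G + \<Psi> x) (G + \<Psi> x) \<partial>torus k) = (\<integral>x. (\<Sum>a\<in>UNIV. \<Sum>b\<in>UNIV. ?e x a b) \<partial>torus k)"
      unfolding minor_form_sum by (intro Bochner_Integration.integral_cong refl sum.cong) (simp add: algebra_simps)
    also have "\<dots> = (\<Sum>a\<in>UNIV. \<Sum>b\<in>UNIV. (\<integral>x. ?e x a b \<partial>torus k))"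
      by (simp add: Bochner_Integration.integral_sum i1 i2 del: Bochner_Integration.integral_add Bochner_Integration.integral_diff)
    also have "\<dots> = (\<Sum>a\<in>UNIV. \<Sum>b\<in>UNIV. G $ a $ a * G $ b $ b - G $ a $ b * G $ b $ a)"
    proof (intro sum.cong refl)
      fix a b
      show "(\<integral>x. ?e x a b \<partial>torus k) = G $ a $ a * G $ b $ b - G $ a $ b * G $ b $ a"
        using z(2)[of a a b b] prob_space by (simp add: i1 i2 z(1))
    qed
    finally show ?thesis by (simp add: minor_form_sum)
  qed
  from torus_gradient_approximation[OF k m per wg sq]
  obtain \<phi>' \<Phi>' where a: "\<forall>m. bounded_torus_gradient k (\<phi>' m) (\<Phi>' m)" "L2_tendsto (torus k) \<Phi>' \<Phi>"
    by (elim exE conjE)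
  have cst: "square_integrable (torus k) (\<lambda>x :: real^'n. G)"
    by (rule square_integrable_bounded[of _ "norm G"]) auto
  have L: "L2_tendsto (torus k) (\<lambda>m x. G + \<Phi>' m x) (\<lambda>x. G + \<Phi> x)"
    using a(2) cst by (auto simp: L2_tendsto_def intro!: square_integrable_add)
  obtain c where c: "bilinear_field (torus k :: (real^'n) measure) (\<lambda>x. minor_form :: real^'n^'n \<Rightarrow> _) c"
    using bilinear_field_const[OF bilinear_minor_form] .
  have "(\<lambda>m. \<integral>x. minor_form (G + \<Phi>' m x) (G + \<Phi>' m x) \<partial>torus k) \<longlonglongrightarrow> (\<integral>x. minor_form (G + \<Phi> x) (G + \<Phi> x) \<partial>torus k)"
    by (rule bilinear_field_tendsto[OF c L L])
  then show ?thesis unfolding bdd[OF a(1)[rule_format]] by (rule LIMSEQ_unique[OF _ tendsto_const])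
qed

section \<open>Operations on torus gradients\<close>

lemma locally_integrable_add:
  "locally_integrable f \<Longrightarrow> locally_integrable g \<Longrightarrow> locally_integrable (\<lambda>x. f x + g x)"
  unfolding locally_integrable_def by (auto intro: set_integral_add)

lemma locally_integrable_scaleR:
  fixes f :: "real^'n \<Rightarrow> 'b::euclidean_space"
  assumes "locally_integrable f" shows "locally_integrable (\<lambda>x. c *\<^sub>R f x)"
  by (rule locally_integrable_bounded_linear[OF assms bounded_linear_scaleR_right])

lemma bounded_linear_matrix_nth: "bounded_linear (\<lambda>x :: real^'n^'n. x $ i $ j)"
  by (rule bounded_linear_compose[OF bounded_linear_vec_nth bounded_linear_vec_nth])

lemma has_weak_gradient_add:
  fixes \<phi> \<psi> :: "real^'n \<Rightarrow> real^'n"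
  assumes m[measurable]: "\<phi> \<in> borel_measurable borel" "\<Phi> \<in> borel_measurable borel" "\<psi> \<in> borel_measurable borel" "\<Psi> \<in> borel_measurable borel"
    and wg: "has_weak_gradient \<phi> \<Phi>" "has_weak_gradient \<psi> \<Psi>"
  shows "has_weak_gradient (\<lambda>x. \<phi> x + \<psi> x) (\<lambda>x. \<Phi> x + \<Psi> x)"
proof -
  have m': "(\<lambda>x. \<phi> x + \<psi> x) \<in> borel_measurable borel" "(\<lambda>x. \<Phi> x + \<Psi> x) \<in> borel_measurable borel" by measurable
  have 1: "locally_integrable \<phi> \<and> locally_integrable \<Phi> \<and> (\<forall>\<tau> i j. test_function \<tau> \<longrightarrow>
        (\<integral>y. \<phi> y $ i * frechet_derivative \<tau> (at y) (axis j 1) \<partial>lborel) = - (\<integral>y. \<Phi> y $ i $ j * \<tau> y \<partial>lborel))"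
    using wg(1) unfolding has_weak_gradient_borel_iff[OF m(1,2)] .
  have 2: "locally_integrable \<psi> \<and> locally_integrable \<Psi> \<and> (\<forall>\<tau> i j. test_function \<tau> \<longrightarrow>
        (\<integral>y. \<psi> y $ i * frechet_derivative \<tau> (at y) (axis j 1) \<partial>lborel) = - (\<integral>y. \<Psi> y $ i $ j * \<tau> y \<partial>lborel))"
    using wg(2) unfolding has_weak_gradient_borel_iff[OF m(3,4)] .
  show ?thesis
    unfolding has_weak_gradient_borel_iff[OF m']
  proof (intro conjI allI impI)
    show "locally_integrable (\<lambda>x. \<phi> x + \<psi> x)" "locally_integrable (\<lambda>x. \<Phi> x + \<Psi> x)"
      using 1 2 by (auto intro: locally_integrable_add)
    fix \<tau> :: "real^'n \<Rightarrow> real" and i j :: 'n assume t: "test_function \<tau>"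
    have c: "locally_integrable (\<lambda>x. \<phi> x $ i)" "locally_integrable (\<lambda>x. \<psi> x $ i)"
      "locally_integrable (\<lambda>x. \<Phi> x $ i $ j)" "locally_integrable (\<lambda>x. \<Psi> x $ i $ j)"
      using 1 2 by (auto intro: locally_integrable_bounded_linear[OF _ bounded_linear_vec_nth] locally_integrable_bounded_linear[OF _ bounded_linear_matrix_nth])
    show "(\<integral>y. (\<phi> y + \<psi> y) $ i * frechet_derivative \<tau> (at y) (axis j 1) \<partial>lborel) = - (\<integral>y. (\<Phi> y + \<Psi> y) $ i $ j * \<tau> y \<partial>lborel)"
      using integrable_mult_test(2)[OF c(1) t] integrable_mult_test(2)[OF c(2) t] integrable_mult_test(1)[OF c(3) t] integrable_mult_test(1)[OF c(4) t]
        1 2 t by (simp add: distrib_right)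
  qed
qed

lemma has_weak_gradient_scaleR:
  fixes \<phi> :: "real^'n \<Rightarrow> real^'n"
  assumes m[measurable]: "\<phi> \<in> borel_measurable borel" "\<Phi> \<in> borel_measurable borel"
    and wg: "has_weak_gradient \<phi> \<Phi>"
  shows "has_weak_gradient (\<lambda>x. c *\<^sub>R \<phi> x) (\<lambda>x. c *\<^sub>R \<Phi> x)"
proof -
  have m': "(\<lambda>x. c *\<^sub>R \<phi> x) \<in> borel_measurable borel" "(\<lambda>x. c *\<^sub>R \<Phi> x) \<in> borel_measurable borel" by measurable
  have 1: "locally_integrable \<phi> \<and> locally_integrable \<Phi> \<and> (\<forall>\<tau> i j. test_function \<tau> \<longrightarrow>
        (\<integral>y. \<phi> y $ i * frechet_derivative \<tau> (at y) (axis j 1) \<partial>lborel) = - (\<integral>y. \<Phi> y $ i $ j * \<tau> y \<partial>lborel))"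
    using wg unfolding has_weak_gradient_borel_iff[OF m(1,2)] .
  show ?thesis
    unfolding has_weak_gradient_borel_iff[OF m']
    using 1 by (auto intro: locally_integrable_scaleR simp: mult.assoc)
qed

definition L2_torus_gradient :: "nat \<Rightarrow> (real^'n \<Rightarrow> real^'n) \<Rightarrow> (real^'n \<Rightarrow> real^'n^'n) \<Rightarrow> bool" where
  "L2_torus_gradient k \<phi> \<Phi> \<longleftrightarrow> \<phi> \<in> borel_measurable borel \<and> \<Phi> \<in> borel_measurable borel \<and>
    periodic k \<phi> \<and> periodic k \<Phi> \<and> has_weak_gradient \<phi> \<Phi> \<and> square_integrable (torus k) \<Phi>"

lemma bounded_imp_square_integrable:
  assumes k: "k \<ge> 1" and "f \<in> borel_measurable borel" "bounded (range f)"
  shows "square_integrable (torus k) f"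
proof -
  interpret prob_space "torus k :: (real^'n) measure" by (rule prob_space_torus[OF k])
  obtain B where "\<forall>x. norm (f x) \<le> B" using assms(3) by (auto simp: bounded_iff)
  then show ?thesis using assms by (intro square_integrable_bounded[of _ B]) auto
qed

lemma bounded_imp_L2_torus_gradient:
  "k \<ge> 1 \<Longrightarrow> bounded_torus_gradient k \<phi> \<Phi> \<Longrightarrow> L2_torus_gradient k \<phi> \<Phi>"
  by (simp add: bounded_torus_gradient_def L2_torus_gradient_def bounded_imp_square_integrable)

lemma L2_torus_gradient_add:
  fixes \<phi> :: "real^'n \<Rightarrow> real^'n"
  assumes "L2_torus_gradient k \<phi> \<Phi>" "L2_torus_gradient k \<psi> \<Psi>"
  shows "L2_torus_gradient k (\<lambda>x. \<phi> x + \<psi> x) (\<lambda>x. \<Phi> x + \<Psi> x)"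
  using assms has_weak_gradient_add[of \<phi> \<Phi> \<psi> \<Psi>]
  by (simp add: L2_torus_gradient_def periodic_def square_integrable_add borel_measurable_add)

lemma L2_torus_gradient_scaleR:
  fixes \<phi> :: "real^'n \<Rightarrow> real^'n"
  assumes "L2_torus_gradient k \<phi> \<Phi>"
  shows "L2_torus_gradient k (\<lambda>x. c *\<^sub>R \<phi> x) (\<lambda>x. c *\<^sub>R \<Phi> x)"
  using assms has_weak_gradient_scaleR[of \<phi> \<Phi>]
  by (simp add: L2_torus_gradient_def periodic_def square_integrable_scaleR borel_measurable_scaleR)

lemma bounded_torus_gradient_add:
  fixes \<phi> :: "real^'n \<Rightarrow> real^'n"
  assumes "bounded_torus_gradient k \<phi> \<Phi>" "bounded_torus_gradient k \<psi> \<Psi>"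
  shows "bounded_torus_gradient k (\<lambda>x. \<phi> x + \<psi> x) (\<lambda>x. \<Phi> x + \<Psi> x)"
  using assms has_weak_gradient_add[of \<phi> \<Phi> \<psi> \<Psi>] bounded_plus_comp[of \<phi> UNIV \<psi>] bounded_plus_comp[of \<Phi> UNIV \<Psi>]
  by (simp add: bounded_torus_gradient_def periodic_def borel_measurable_add)

lemma bounded_torus_gradient_scaleR:
  fixes \<phi> :: "real^'n \<Rightarrow> real^'n"
  assumes "bounded_torus_gradient k \<phi> \<Phi>"
  shows "bounded_torus_gradient k (\<lambda>x. c *\<^sub>R \<phi> x) (\<lambda>x. c *\<^sub>R \<Phi> x)"
  using assms has_weak_gradient_scaleR[of \<phi> \<Phi>]
  by (simp add: bounded_torus_gradient_def periodic_def borel_measurable_scaleR bounded_scaleR_comp)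

lemma bounded_torus_gradient_0: "bounded_torus_gradient k (\<lambda>x. 0) (\<lambda>x. 0 :: real^'n^'n)"
proof -
  have "has_weak_gradient (\<lambda>x. 0) (\<lambda>x. 0 :: real^'n^'n)"
    by (subst has_weak_gradient_borel_iff) (auto simp: locally_integrable_def set_integrable_def)
  then show ?thesis by (simp add: bounded_torus_gradient_def periodic_def)
qed

lemma bounded_torus_gradient_sum:
  assumes "finite I" "\<And>i. i \<in> I \<Longrightarrow> bounded_torus_gradient k (\<phi> i) (\<Phi> i)"
  shows "bounded_torus_gradient k (\<lambda>x. \<Sum>i\<in>I. \<phi> i x) (\<lambda>x. \<Sum>i\<in>I. \<Phi> i x)"
  using assms
  by (induction I rule: finite_induct) (simp_all add: bounded_torus_gradient_0 bounded_torus_gradient_add)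

lemma bounded_torus_gradient_translate:
  fixes \<phi> :: "real^'n \<Rightarrow> real^'n"
  assumes "bounded_torus_gradient k \<phi> \<Phi>"
  shows "bounded_torus_gradient k (\<lambda>x. \<phi> (x + s)) (\<lambda>x. \<Phi> (x + s))"
proof -
  have m[measurable]: "\<phi> \<in> borel_measurable borel" "\<Phi> \<in> borel_measurable borel"
    and "bounded (range \<phi>)" "bounded (range \<Phi>)" and per: "periodic k \<phi>" "periodic k \<Phi>" and wg: "has_weak_gradient \<phi> \<Phi>"
    using assms by (auto simp: bounded_torus_gradient_def)
  moreover have "(\<lambda>x. \<phi> (x + s)) \<in> borel_measurable borel" "(\<lambda>x. \<Phi> (x + s)) \<in> borel_measurable borel" by measurable
  moreover have "range (\<lambda>x. \<phi> (x + s)) \<subseteq> range \<phi>" "range (\<lambda>x. \<Phi> (x + s)) \<subseteq> range \<Phi>" by auto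
  moreover have "periodic k (\<lambda>x. \<phi> (x + s))" "periodic k (\<lambda>x. \<Phi> (x + s))"
    using per unfolding periodic_def by (metis add.assoc add.commute)+
  ultimately show ?thesis
    using has_weak_gradient_translate[OF m wg, of s] unfolding bounded_torus_gradient_def
    by (blast intro: bounded_subset)
qed

section \<open>Folding a function on the large torus to the unit torus\<close>

definition lattice_cell :: "nat \<Rightarrow> (int^'n) set" where
  "lattice_cell k = {w. \<forall>i. 0 \<le> w $ i \<and> w $ i < int k}"

text \<open>
  The mean over lattice translates inside the large cell. It turns test fields on the large torus into test fields on
  the unit torus without changing the pairing with \<open>periodic 1\<close> fields (\<open>energy_fold\<close> below).
\<close>

definition fold_torus :: "nat \<Rightarrow> (real^'n \<Rightarrow> 'b::real_vector) \<Rightarrow> real^'n \<Rightarrow> 'b" where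
  "fold_torus k f x = (\<Sum>w\<in>lattice_cell k. f (x + ivec w)) /\<^sub>R real (card (lattice_cell k :: (int^'n) set))"

lemma finite_lattice_cell: "finite (lattice_cell k)"
proof -
  have "lattice_cell k = vec_lambda ` (PiE UNIV (\<lambda>_. {0..<int k}))"
    by (auto simp: lattice_cell_def image_iff PiE_iff intro!: bexI[of _ "vec_nth _"] simp: vec_nth_inverse)
  then show ?thesis by (metis finite_PiE finite_atLeastLessThan_int finite_class.finite_UNIV finite_imageI)
qed

lemma card_lattice_cell_pos: "k \<ge> 1 \<Longrightarrow> card (lattice_cell k) > 0"
  using finite_lattice_cell by (subst card_gt_0_iff) (auto simp: lattice_cell_def intro!: exI[of _ 0])

text \<open>
  A shift by a lattice vector permutes the points of \<open>lattice_cell k\<close> modulo \<open>k\<close>, and \<open>f\<close> does not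
  distinguish points that agree modulo \<open>k\<close>.
\<close>

lemma fold_torus_periodic:
  assumes k: "k \<ge> 1" and per: "periodic k f"
  shows "periodic 1 (fold_torus k f)"
  unfolding periodic_def
proof (intro allI)
  fix v :: "int^'a" and x
  define \<sigma> where "\<sigma> w = (\<chi> i. (w $ i + v $ i) mod int k)" for w
  have inj: "inj_on \<sigma> (lattice_cell k)"
  proof (rule inj_onI)
    fix w w' :: "int^'a" assume w: "w \<in> lattice_cell k" "w' \<in> lattice_cell k" and e: "\<sigma> w = \<sigma> w'"
    have "w $ i = w' $ i" for i
    proof -
      have "(w $ i + v $ i) mod int k = (w' $ i + v $ i) mod int k" using e by (simp add: \<sigma>_def vec_eq_iff)
      then have "w $ i mod int k = w' $ i mod int k" by (simp add: mod_eq_dvd_iff)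
      then show ?thesis using w by (simp add: lattice_cell_def)
    qed
    then show "w = w'" by (simp add: vec_eq_iff)
  qed
  have sub: "\<sigma> ` lattice_cell k \<subseteq> lattice_cell k" using k by (auto simp: \<sigma>_def lattice_cell_def)
  have bij: "bij_betw \<sigma> (lattice_cell k) (lattice_cell k)"
    unfolding bij_betw_def using inj endo_inj_surj[OF finite_lattice_cell sub inj] by (rule conjI)
  have "(\<Sum>w\<in>lattice_cell k. f (x + real 1 *\<^sub>R ivec v + ivec w)) = (\<Sum>w\<in>lattice_cell k. f (x + ivec (\<sigma> w)))"
  proof (rule sum.cong)
    fix w
    have "x + real 1 *\<^sub>R ivec v + ivec w = x + ivec (\<sigma> w) + real k *\<^sub>R ivec (\<chi> i. (w $ i + v $ i) div int k)"
    proof -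
      have "real_of_int (v $ i) + real_of_int (w $ i) = real_of_int ((w $ i + v $ i) mod int k) + real k * real_of_int ((w $ i + v $ i) div int k)" for i
      proof -
        have "w $ i + v $ i = (w $ i + v $ i) mod int k + int k * ((w $ i + v $ i) div int k)" by simp
        then have "real_of_int (w $ i + v $ i) = real_of_int ((w $ i + v $ i) mod int k + int k * ((w $ i + v $ i) div int k))" by (rule arg_cong)
        then show ?thesis by (simp only: of_int_add of_int_mult of_int_of_nat_eq add.commute)
      qed
      then show ?thesis by (simp add: ivec_def \<sigma>_def vec_eq_iff)
    qed
    then show "f (x + real 1 *\<^sub>R ivec v + ivec w) = f (x + ivec (\<sigma> w))"
      using per unfolding periodic_def by (simp only:)
  qed simp
  also have "\<dots> = (\<Sum>w\<in>lattice_cell k. f (x + ivec w))"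
    by (rule sum.reindex_bij_betw[OF bij])
  finally show "fold_torus k f (x + real 1 *\<^sub>R ivec v) = fold_torus k f x" by (simp add: fold_torus_def)
qed

lemma bounded_torus_gradient_fold:
  fixes \<phi> :: "real^'n \<Rightarrow> real^'n"
  assumes k: "k \<ge> 1" and g: "bounded_torus_gradient k \<phi> \<Phi>"
  shows "bounded_torus_gradient 1 (fold_torus k \<phi>) (fold_torus k \<Phi>)"
proof -
  have "bounded_torus_gradient k (fold_torus k \<phi>) (fold_torus k \<Phi>)"
    unfolding fold_torus_def[abs_def]
    by (intro bounded_torus_gradient_scaleR bounded_torus_gradient_sum finite_lattice_cell bounded_torus_gradient_translate g)
  moreover have "periodic 1 (fold_torus k \<phi>)" "periodic 1 (fold_torus k \<Phi>)"
    using g unfolding bounded_torus_gradient_def by (blast intro: fold_torus_periodic[OF k])+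
  ultimately show ?thesis unfolding bounded_torus_gradient_def by blast
qed

lemma periodic_1_imp: "periodic 1 f \<Longrightarrow> periodic k f"
proof -
  assume p: "periodic 1 f"
  have "real k *\<^sub>R ivec w = ivec (\<chi> i. int k * w $ i)" for w :: "int^'a" by (simp add: ivec_def vec_eq_iff)
  then show ?thesis using p by (simp add: periodic_def)
qed

lemma integral_torus_1:
  fixes f :: "real^'n \<Rightarrow> 'b::{banach, second_countable_topology}"
  assumes "k \<ge> 1" "f \<in> borel_measurable borel" "periodic 1 f"
  shows "(\<integral>x. f x \<partial>torus k) = (\<integral>x. f x \<partial>torus 1)"
  using integral_torus_mult(1)[of 1 k f] assms by simp

text \<open>
  The Cauchy-Schwarz inequality for the mean over translates, each of which has the same mean square as \<open>f\<close>.
\<close>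

lemma norm_fold_torus_le:
  fixes f :: "real^'n \<Rightarrow> 'b::euclidean_space"
  assumes k: "k \<ge> 1" and m[measurable]: "f \<in> borel_measurable borel" and per: "periodic k f" and bd: "bounded (range f)"
  shows "(\<integral>x. (norm (fold_torus k f x))\<^sup>2 \<partial>torus 1) \<le> (\<integral>x. (norm (f x))\<^sup>2 \<partial>torus k)"
proof -
  let ?Z = "lattice_cell k :: (int^'n) set"
  let ?c = "real (card ?Z)"
  have c: "?c > 0" using card_lattice_cell_pos[OF k, where 'a='n] by simp
  have mf[measurable]: "fold_torus k f \<in> borel_measurable borel"
    unfolding fold_torus_def[abs_def] by (intro borel_measurable_scaleR borel_measurable_sum) measurable
  have pt: "(norm (fold_torus k f x))\<^sup>2 \<le> (\<Sum>w\<in>?Z. (norm (f (x + ivec w)))\<^sup>2) / ?c" for x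
  proof -
    have "norm (\<Sum>w\<in>?Z. f (x + ivec w)) \<le> (\<Sum>w\<in>?Z. norm (f (x + ivec w)))" by (rule norm_sum)
    then have "(norm (\<Sum>w\<in>?Z. f (x + ivec w)))\<^sup>2 \<le> (\<Sum>w\<in>?Z. norm (f (x + ivec w)))\<^sup>2" by (intro power_mono) auto
    also have "\<dots> \<le> (\<Sum>w\<in>?Z. (norm (f (x + ivec w)))\<^sup>2) * ?c"
      using Cauchy_Schwarz_ineq_sum[of "\<lambda>w. norm (f (x + ivec w))" "\<lambda>_. 1" ?Z] by simp
    finally have "(norm (\<Sum>w\<in>?Z. f (x + ivec w)))\<^sup>2 / ?c\<^sup>2 \<le> (\<Sum>w\<in>?Z. (norm (f (x + ivec w)))\<^sup>2) * ?c / ?c\<^sup>2"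
      by (rule divide_right_mono) simp
    moreover have "norm (fold_torus k f x) = norm (\<Sum>w\<in>?Z. f (x + ivec w)) / ?c"
      by (simp add: fold_torus_def divide_inverse mult.commute)
    moreover have "y * ?c / ?c\<^sup>2 = y / ?c" for y using c by (simp add: power2_eq_square)
    ultimately show ?thesis by (simp only: power_divide)
  qed
  have i: "integrable (torus k) (\<lambda>x. (norm (f x))\<^sup>2)"
    using bounded_imp_square_integrable[OF k m bd] by (simp add: square_integrable_def)
  have p2: "periodic k (\<lambda>x. (norm (f x))\<^sup>2)" using per by (simp add: periodic_def)
  have m2: "(\<lambda>x. (norm (f x))\<^sup>2) \<in> borel_measurable borel" by measurable
  note tr = integral_torus_translate[OF k m2 p2]
  have iw: "integrable (torus k) (\<lambda>x. (norm (f (x + s)))\<^sup>2)" for s using tr(2)[of s] i by simp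
  have "(\<integral>x. (norm (fold_torus k f x))\<^sup>2 \<partial>torus 1) = (\<integral>x. (norm (fold_torus k f x))\<^sup>2 \<partial>torus k)"
    using fold_torus_periodic[OF k per] by (intro integral_torus_1[symmetric] k) (auto simp: periodic_def)
  also have "\<dots> \<le> (\<integral>x. (\<Sum>w\<in>?Z. (norm (f (x + ivec w)))\<^sup>2) / ?c \<partial>torus k)"
  proof (rule integral_mono')
    show "integrable (torus k) (\<lambda>x. (\<Sum>w\<in>?Z. (norm (f (x + ivec w)))\<^sup>2) / ?c)"
      using iw by simp
  qed (use pt order_trans[OF zero_le_power2 pt] in auto)
  also have "\<dots> = (\<Sum>w\<in>?Z. (\<integral>x. (norm (f (x + ivec w)))\<^sup>2 \<partial>torus k)) / ?c"
    using iw by (simp add: Bochner_Integration.integral_sum)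
  also have "\<dots> = (\<integral>x. (norm (f x))\<^sup>2 \<partial>torus k)"
    using c by (simp add: tr(1))
  finally show ?thesis .
qed

section \<open>Periodic quadratic integrands\<close>

text \<open>
  The bilinear form of a quadratic integrand, in a version that is Borel, bilinear and periodic everywhere. The
  remaining properties are inherited from the integrand and hold almost everywhere.
\<close>

locale periodic_form =
  fixes b :: "real^'n \<Rightarrow> real^'n^'n \<Rightarrow> real^'n^'n \<Rightarrow> real" and c :: real
  assumes c_pos: "c > 0"
    and bilinear_b: "\<And>x. bilinear (b x)"
    and measurable_b: "\<And>u v. (\<lambda>x. b x u v) \<in> borel_measurable borel"
    and periodic_b: "periodic 1 b"
    and bound_b: "AE x in lborel. \<forall>u v. \<bar>b x u v\<bar> \<le> c * norm u * norm v"
    and sym_b: "AE x in lborel. \<forall>u v. b x u v = b x v u"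
    and nonneg_b: "AE x in lborel. \<forall>u. 0 \<le> b x u u"
begin

lemma bilinear_field_b: "bilinear_field (torus k) b c"
  using bilinear_b measurable_b AE_torusI[OF bound_b] unfolding bilinear_field_def by (auto simp: measurable_cong_sets[OF sets_torus refl])

lemma measurable_b_comp:
  assumes "f \<in> borel_measurable borel" "g \<in> borel_measurable borel"
  shows "(\<lambda>x. b x (f x) (g x)) \<in> borel_measurable borel"
proof -
  have "bilinear_field (torus 1) b c" by (rule bilinear_field_b)
  from bilinear_field_measurable[OF this, of f g] assms show ?thesis
    by (simp add: measurable_cong_sets[OF sets_torus refl])
qed

definition energy :: "nat \<Rightarrow> (real^'n \<Rightarrow> real^'n^'n) \<Rightarrow> (real^'n \<Rightarrow> real^'n^'n) \<Rightarrow> real" where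
  "energy k f g = (\<integral>x. b x (f x) (g x) \<partial>torus k)"

lemma energy_integrable:
  "square_integrable (torus k) f \<Longrightarrow> square_integrable (torus k) g \<Longrightarrow> integrable (torus k) (\<lambda>x. b x (f x) (g x))"
  by (rule bilinear_field_integral(1)[OF bilinear_field_b])

lemma energy_bound:
  "square_integrable (torus k) f \<Longrightarrow> square_integrable (torus k) g \<Longrightarrow>
    \<bar>energy k f g\<bar> \<le> c * (sqrt (\<integral>x. (norm (f x))\<^sup>2 \<partial>torus k) * sqrt (\<integral>x. (norm (g x))\<^sup>2 \<partial>torus k))"
  unfolding energy_def using bilinear_field_integral(2)[OF bilinear_field_b] c_pos by simp

lemma energy_nonneg: "0 \<le> energy k f f"
proof -
  have "AE x in torus k. 0 \<le> b x (f x) (f x)"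
    using AE_torusI[OF nonneg_b] by eventually_elim simp
  then show ?thesis unfolding energy_def by (rule integral_nonneg_AE)
qed

lemma energy_sym:
  assumes "f \<in> borel_measurable borel" "g \<in> borel_measurable borel"
  shows "energy k f g = energy k g f"
  unfolding energy_def
proof (rule integral_cong_AE)
  show "AE x in torus k. b x (f x) (g x) = b x (g x) (f x)"
    using AE_torusI[OF sym_b] by eventually_elim blast
qed (use measurable_b_comp[OF assms] measurable_b_comp[OF assms(2,1)] in \<open>simp_all add: measurable_cong_sets[OF sets_torus refl]\<close>)

lemma energy_add_left:
  assumes "square_integrable (torus k) f" "square_integrable (torus k) g" "square_integrable (torus k) h"
  shows "energy k (\<lambda>x. f x + g x) h = energy k f h + energy k g h"
  unfolding energy_def using energy_integrable[OF assms(1,3)] energy_integrable[OF assms(2,3)]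
  by (simp add: bilinear_ladd[OF bilinear_b])

lemma energy_add_right:
  assumes "square_integrable (torus k) f" "square_integrable (torus k) g" "square_integrable (torus k) h"
  shows "energy k h (\<lambda>x. f x + g x) = energy k h f + energy k h g"
  unfolding energy_def using energy_integrable[OF assms(3,1)] energy_integrable[OF assms(3,2)]
  by (simp add: bilinear_radd[OF bilinear_b])

lemma energy_scaleR_left: "energy k (\<lambda>x. t *\<^sub>R f x) h = t * energy k f h"
  unfolding energy_def by (simp add: bilinear_lmul[OF bilinear_b])

lemma energy_scaleR_right: "energy k h (\<lambda>x. t *\<^sub>R f x) = t * energy k h f"
  unfolding energy_def by (simp add: bilinear_rmul[OF bilinear_b])

lemma energy_quadratic_le:
  assumes "square_integrable (torus k) f"
  shows "energy k f f \<le> c * (\<integral>x. (norm (f x))\<^sup>2 \<partial>torus k)"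
  using energy_bound[OF assms assms] by (simp add: power2_eq_square[symmetric] integral_nonneg_AE abs_le_iff)

lemma energy_square_add:
  assumes f: "square_integrable (torus k) f" "f \<in> borel_measurable borel" and g: "square_integrable (torus k) g" "g \<in> borel_measurable borel"
  shows "energy k (\<lambda>x. f x + g x) (\<lambda>x. f x + g x) = energy k f f + 2 * energy k f g + energy k g g"
  using energy_add_left[OF f(1) g(1) square_integrable_add[OF f(1) g(1)]] energy_add_right[OF f(1) g(1) f(1)]
    energy_add_right[OF f(1) g(1) g(1)] energy_sym[OF f(2) g(2)] by simp

text \<open>
  The form and \<open>A\<close> have period \<open>1\<close>, so all lattice translates of \<open>f\<close> contribute equally.
\<close>

lemma energy_fold:
  assumes k: "k \<ge> 1" and mA: "A \<in> borel_measurable borel" and pA: "periodic 1 A" and bA: "bounded (range A)"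
    and mf: "f \<in> borel_measurable borel" and pf: "periodic k f" and bf: "bounded (range f)"
  shows "energy k A f = energy 1 A (fold_torus k f)"
proof -
  let ?Z = "lattice_cell k :: (int^'n) set"
  have card: "card ?Z > 0" using card_lattice_cell_pos[OF k] .
  have sA: "square_integrable (torus k) A" by (rule bounded_imp_square_integrable[OF k mA bA])
  have mw: "(\<lambda>x. f (x + s)) \<in> borel_measurable borel" for s using mf by measurable
  have bw: "bounded (range (\<lambda>x. f (x + s)))" for s by (rule bounded_subset[OF bf]) auto
  have sw: "square_integrable (torus k) (\<lambda>x. f (x + s))" for s by (rule bounded_imp_square_integrable[OF k mw bw])
  have shift: "energy k A (\<lambda>x. f (x + ivec w)) = energy k A f" for w
  proof -
    have per: "periodic k (\<lambda>x. b x (A x) (f x))"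
      using periodic_1_imp[OF periodic_b, of k] periodic_1_imp[OF pA, of k] pf by (simp add: periodic_def)
    have "energy k A f = (\<integral>x. b (x + ivec w) (A (x + ivec w)) (f (x + ivec w)) \<partial>torus k)"
      unfolding energy_def using integral_torus_translate(1)[OF k measurable_b_comp[OF mA mf] per, of "ivec w"] by simp
    moreover have "b (x + ivec w) = b x" "A (x + ivec w) = A x" for x
      using periodic_b pA by (simp_all add: periodic_def)
    ultimately show ?thesis by (simp add: energy_def)
  qed
  have sum: "energy k A (\<lambda>x. \<Sum>w\<in>I. f (x + ivec w)) = (\<Sum>w\<in>I. energy k A (\<lambda>x. f (x + ivec w)))
      \<and> square_integrable (torus k) (\<lambda>x. \<Sum>w\<in>I. f (x + ivec w))" if "finite I" for I :: "(int^'n) set"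
    using that
  proof (induction I rule: finite_induct)
    case empty
    have "energy k A (\<lambda>x. 0 *\<^sub>R A x) = 0" unfolding energy_scaleR_right by simp
    then show ?case by (simp add: square_integrable_def)
  next
    case (insert w I)
    then show ?case using energy_add_right[OF sw[of "ivec w"] _ sA] square_integrable_add[OF sw[of "ivec w"]] by simp
  qed
  have "energy 1 A (fold_torus k f) = energy k A (fold_torus k f)"
    unfolding energy_def
  proof (rule integral_torus_1[OF k, symmetric])
    have "fold_torus k f \<in> borel_measurable borel"
      unfolding fold_torus_def[abs_def] by (intro borel_measurable_scaleR borel_measurable_sum mw) auto
    then show "(\<lambda>x. b x (A x) (fold_torus k f x)) \<in> borel_measurable borel" by (rule measurable_b_comp[OF mA])
    show "periodic 1 (\<lambda>x. b x (A x) (fold_torus k f x))"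
      using periodic_b pA fold_torus_periodic[OF k pf] by (simp add: periodic_def)
  qed
  also have "\<dots> = inverse (real (card ?Z)) * energy k A (\<lambda>x. \<Sum>w\<in>?Z. f (x + ivec w))"
    unfolding fold_torus_def[abs_def] by (rule energy_scaleR_right)
  also have "\<dots> = energy k A f"
    using sum[OF finite_lattice_cell] card by (simp add: shift)
  finally show ?thesis ..
qed

end

section \<open>Approximate correctors\<close>

text \<open>
  The discriminant of a nonnegative quadratic polynomial is not positive.
\<close>

lemma nonneg_quadratic_imp:
  fixes e q \<eta> :: real
  assumes "\<And>t. 0 \<le> \<eta>\<^sup>2 + 2 * t * e + t\<^sup>2 * q" "q \<ge> 0" "\<eta> > 0"
  shows "\<bar>e\<bar> \<le> \<eta> * sqrt q"
proof (cases "q = 0")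
  case True
  have "e = 0"
  proof (rule ccontr)
    assume "e \<noteq> 0"
    then have "0 \<le> \<eta>\<^sup>2 - 2 * \<eta>\<^sup>2" using assms(1)[of "- \<eta>\<^sup>2 / e"] True by simp
    then show False using assms(3) by simp
  qed
  then show ?thesis using assms by simp
next
  case False
  then have q: "q > 0" using assms by simp
  have "0 \<le> \<eta>\<^sup>2 - e\<^sup>2 / q"
    using assms(1)[of "- e / q"] q by (simp add: power2_eq_square)
  then have "e\<^sup>2 \<le> \<eta>\<^sup>2 * q" using q by (simp add: pos_divide_le_eq)
  then have "sqrt (e\<^sup>2) \<le> sqrt (\<eta>\<^sup>2 * q)" by (rule real_sqrt_le_mono)
  then show ?thesis using assms(3) by (simp add: real_sqrt_mult)
qed

context periodic_form
begin

lemma square_integrable_shift: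
  fixes \<Phi> :: "real^'n \<Rightarrow> real^'n^'n"
  assumes k: "k \<ge> 1" and "square_integrable (torus k) \<Phi>"
  shows "square_integrable (torus k) (\<lambda>x. G + \<Phi> x)"
proof -
  have "square_integrable (torus k) (\<lambda>x :: real^'n. G)"
    by (rule bounded_imp_square_integrable[OF k]) auto
  then show ?thesis using assms(2) by (rule square_integrable_add)
qed

text \<open>
  If the energy exceeds the infimum by less than \<open>\<eta>\<^sup>2\<close>, then it drops by less than \<open>\<eta>\<^sup>2\<close> in every direction
  \<open>t *\<^sub>R \<Psi>\<close>; the discriminant of this polynomial in \<open>t\<close> bounds the first variation.
\<close>

lemma near_minimizer:
  assumes \<eta>: "\<eta> > 0"
  shows "\<exists>\<phi> \<Phi>. bounded_torus_gradient 1 \<phi> \<Phi> \<and>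
    (\<forall>\<psi> \<Psi>. bounded_torus_gradient 1 \<psi> \<Psi> \<longrightarrow> \<bar>energy 1 (\<lambda>x. G + \<Phi> x) \<Psi>\<bar> \<le> \<eta> * sqrt (energy 1 \<Psi> \<Psi>))"
proof -
  define I where "I \<Phi> = energy 1 (\<lambda>x. G + \<Phi> x) (\<lambda>x. G + \<Phi> x)" for \<Phi>
  define S where "S = {I \<Phi> | \<phi> \<Phi>. bounded_torus_gradient 1 \<phi> \<Phi>}"
  have ne: "S \<noteq> {}" using bounded_torus_gradient_0[of 1] by (auto simp: S_def)
  have bb: "bdd_below S" by (rule bdd_belowI[of _ 0]) (auto simp: S_def I_def energy_nonneg)
  have "Inf S < Inf S + \<eta>\<^sup>2" using \<eta> by simp
  then obtain y where "y \<in> S" "y < Inf S + \<eta>\<^sup>2" using cInf_lessD[OF ne] by blast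
  then obtain \<phi> \<Phi> where g: "bounded_torus_gradient 1 \<phi> \<Phi>" and lt: "I \<Phi> < Inf S + \<eta>\<^sup>2"
    by (auto simp: S_def)
  have L2: "square_integrable (torus 1) \<Psi>" "\<Psi> \<in> borel_measurable borel" if "bounded_torus_gradient 1 \<psi> \<Psi>" for \<psi> :: "real^'n \<Rightarrow> real^'n" and \<Psi>
    using bounded_imp_L2_torus_gradient[OF _ that] by (auto simp: L2_torus_gradient_def)
  have "\<bar>energy 1 (\<lambda>x. G + \<Phi> x) \<Psi>\<bar> \<le> \<eta> * sqrt (energy 1 \<Psi> \<Psi>)" if h: "bounded_torus_gradient 1 \<psi> \<Psi>" for \<psi> \<Psi>
  proof (rule nonneg_quadratic_imp[OF _ energy_nonneg \<eta>])
    fix t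
    have mG: "(\<lambda>x. G + \<Phi> x) \<in> borel_measurable borel" using L2(2)[OF g] by measurable
    have mt: "(\<lambda>x. t *\<^sub>R \<Psi> x) \<in> borel_measurable borel" using L2(2)[OF h] by measurable
    have "bounded_torus_gradient 1 (\<lambda>x. \<phi> x + t *\<^sub>R \<psi> x) (\<lambda>x. \<Phi> x + t *\<^sub>R \<Psi> x)"
      by (intro bounded_torus_gradient_add bounded_torus_gradient_scaleR g h)
    then have "I (\<lambda>x. \<Phi> x + t *\<^sub>R \<Psi> x) \<in> S" by (auto simp: S_def)
    then have "Inf S \<le> I (\<lambda>x. \<Phi> x + t *\<^sub>R \<Psi> x)" by (rule cInf_lower[OF _ bb])
    also have "\<dots> = energy 1 (\<lambda>x. (G + \<Phi> x) + t *\<^sub>R \<Psi> x) (\<lambda>x. (G + \<Phi> x) + t *\<^sub>R \<Psi> x)"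
      by (simp add: I_def add.assoc)
    also have "\<dots> = I \<Phi> + 2 * energy 1 (\<lambda>x. G + \<Phi> x) (\<lambda>x. t *\<^sub>R \<Psi> x) + energy 1 (\<lambda>x. t *\<^sub>R \<Psi> x) (\<lambda>x. t *\<^sub>R \<Psi> x)"
      unfolding I_def by (rule energy_square_add[OF square_integrable_shift[OF _ L2(1)[OF g]] mG square_integrable_scaleR[OF L2(1)[OF h]] mt]) simp
    also have "\<dots> = I \<Phi> + 2 * t * energy 1 (\<lambda>x. G + \<Phi> x) \<Psi> + t\<^sup>2 * energy 1 \<Psi> \<Psi>"
      by (simp add: energy_scaleR_left energy_scaleR_right power2_eq_square)
    finally show "0 \<le> \<eta>\<^sup>2 + 2 * t * energy 1 (\<lambda>x. G + \<Phi> x) \<Psi> + t\<^sup>2 * energy 1 \<Psi> \<Psi>" using lt by linarith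
  qed
  with g show ?thesis by blast
qed

lemma energy_sum_left:
  assumes "finite I" "\<And>i. i \<in> I \<Longrightarrow> square_integrable (torus k) (f i)" "square_integrable (torus k) h"
  shows "energy k (\<lambda>x. \<Sum>i\<in>I. f i x) h = (\<Sum>i\<in>I. energy k (f i) h) \<and> square_integrable (torus k) (\<lambda>x. \<Sum>i\<in>I. f i x)"
  using assms(1,2)
proof (induction I rule: finite_induct)
  case empty
  have "energy k (\<lambda>x. 0 *\<^sub>R h x) h = 0" unfolding energy_scaleR_left by simp
  then show ?case by (simp add: square_integrable_def)
next
  case (insert i I)
  then show ?case using energy_add_left[of k "f i" "\<lambda>x. \<Sum>i\<in>I. f i x" h] square_integrable_add[of "torus k" "f i"] assms(3) by simp
qed

text \<open>
  The Euler-Lagrange equation for \<open>G + \<Phi>\<close> holds up to an error that is measured in the energy seminorm of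
  the test field, and the field is bounded relative to \<open>G\<close>.
\<close>

definition approximate_corrector ::
    "real \<Rightarrow> real \<Rightarrow> real^'n^'n \<Rightarrow> (real^'n \<Rightarrow> real^'n) \<Rightarrow> (real^'n \<Rightarrow> real^'n^'n) \<Rightarrow> bool" where
  "approximate_corrector \<eta> L G \<phi> \<Phi> \<longleftrightarrow> bounded_torus_gradient 1 \<phi> \<Phi> \<and> (\<forall>x. norm (G + \<Phi> x) \<le> L * norm G) \<and>
    (\<forall>\<psi> \<Psi>. bounded_torus_gradient 1 \<psi> \<Psi> \<longrightarrow> \<bar>energy 1 (\<lambda>x. G + \<Phi> x) \<Psi>\<bar> \<le> \<eta> * norm G * sqrt (energy 1 \<Psi> \<Psi>))"

text \<open>
  Near minimisers for the finitely many basis matrices, combined linearly. Linearity in \<open>G\<close> makes one constant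
  \<open>L\<close> suffice for all \<open>G\<close>.
\<close>

lemma approximate_correctors:
  assumes \<eta>: "\<eta> > 0"
  shows "\<exists>\<phi> \<Phi> L. L > 0 \<and> (\<forall>G. approximate_corrector \<eta> L G (\<phi> G) (\<Phi> G))"
proof -
  let ?B = "Basis :: (real^'n^'n) set"
  let ?N = "real (card ?B)"
  have N: "?N > 0" by simp
  have "\<forall>E. \<exists>p. bounded_torus_gradient 1 (fst p) (snd p) \<and>
    (\<forall>\<psi> \<Psi>. bounded_torus_gradient 1 \<psi> \<Psi> \<longrightarrow> \<bar>energy 1 (\<lambda>x. E + snd p x) \<Psi>\<bar> \<le> (\<eta> / ?N) * sqrt (energy 1 \<Psi> \<Psi>))"
    using near_minimizer[of "\<eta> / ?N"] \<eta> N by (metis divide_pos_pos fst_conv snd_conv)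
  then obtain P where P: "\<And>E. bounded_torus_gradient 1 (fst (P E)) (snd (P E))"
    "\<And>E \<psi> \<Psi>. bounded_torus_gradient 1 \<psi> \<Psi> \<Longrightarrow> \<bar>energy 1 (\<lambda>x. E + snd (P E) x) \<Psi>\<bar> \<le> (\<eta> / ?N) * sqrt (energy 1 \<Psi> \<Psi>)"
    by metis
  have "\<exists>l. \<forall>x. norm (E + snd (P E) x) \<le> l" for E
  proof -
    obtain B where "\<forall>x. norm (snd (P E) x) \<le> B" using P(1)[of E] by (auto simp: bounded_torus_gradient_def bounded_iff)
    then have "norm (E + snd (P E) x) \<le> norm E + B" for x using norm_triangle_ineq[of E "snd (P E) x"] by (meson add_left_mono order_trans)
    then show ?thesis by blast
  qed
  then obtain l where l: "\<And>E x. norm (E + snd (P E) x) \<le> l E" by metis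
  have l0: "l E \<ge> 0" for E using l[of E 0] norm_ge_zero order_trans by blast
  define \<phi> where "\<phi> G x = (\<Sum>E\<in>?B. (G \<bullet> E) *\<^sub>R fst (P E) x)" for G x
  define \<Phi> where "\<Phi> G x = (\<Sum>E\<in>?B. (G \<bullet> E) *\<^sub>R snd (P E) x)" for G x
  have eq: "G + \<Phi> G x = (\<Sum>E\<in>?B. (G \<bullet> E) *\<^sub>R (E + snd (P E) x))" for G x
    by (simp add: \<Phi>_def scaleR_right_distrib sum.distrib euclidean_representation)
  define L where "L = (\<Sum>E\<in>?B. l E) + 1"
  have "L > 0" unfolding L_def using l0 by (intro add_nonneg_pos sum_nonneg) auto
  moreover have "bounded_torus_gradient 1 (\<phi> G) (\<Phi> G)" for G
    unfolding \<phi>_def[abs_def] \<Phi>_def[abs_def]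
    by (intro bounded_torus_gradient_sum bounded_torus_gradient_scaleR P) simp
  moreover have "norm (G + \<Phi> G x) \<le> L * norm G" for G x
  proof -
    have "norm (G + \<Phi> G x) \<le> (\<Sum>E\<in>?B. norm ((G \<bullet> E) *\<^sub>R (E + snd (P E) x)))" unfolding eq by (rule norm_sum)
    also have "\<dots> \<le> (\<Sum>E\<in>?B. norm G * l E)"
    proof (rule sum_mono)
      fix E assume "E \<in> ?B"
      then have "\<bar>G \<bullet> E\<bar> \<le> norm G" by (rule Basis_le_norm)
      then show "norm ((G \<bullet> E) *\<^sub>R (E + snd (P E) x)) \<le> norm G * l E"
        using l[of E x] by (simp add: mult_mono)
    qed
    also have "\<dots> = norm G * (\<Sum>E\<in>?B. l E)" by (simp add: sum_distrib_left)
    also have "\<dots> \<le> L * norm G" by (simp add: L_def mult.commute mult_left_mono distrib_right)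
    finally show ?thesis .
  qed
  moreover have "\<bar>energy 1 (\<lambda>x. G + \<Phi> G x) \<Psi>\<bar> \<le> \<eta> * norm G * sqrt (energy 1 \<Psi> \<Psi>)" if h: "bounded_torus_gradient 1 \<psi> \<Psi>" for G \<psi> \<Psi>
  proof -
    have s\<Psi>: "square_integrable (torus 1) \<Psi>"
      using bounded_imp_L2_torus_gradient[OF _ h] by (simp add: L2_torus_gradient_def)
    have sE: "square_integrable (torus 1) (\<lambda>x. (G \<bullet> E) *\<^sub>R (E + snd (P E) x))" for E
      using bounded_imp_L2_torus_gradient[OF _ P(1)[of E]] by (intro square_integrable_scaleR square_integrable_shift) (simp_all add: L2_torus_gradient_def)
    have "energy 1 (\<lambda>x. G + \<Phi> G x) \<Psi> = (\<Sum>E\<in>?B. (G \<bullet> E) * energy 1 (\<lambda>x. E + snd (P E) x) \<Psi>)"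
      unfolding eq using energy_sum_left[of ?B 1 "\<lambda>E x. (G \<bullet> E) *\<^sub>R (E + snd (P E) x)" \<Psi>, OF finite_Basis sE s\<Psi>] by (simp add: energy_scaleR_left)
    also have "\<bar>\<dots>\<bar> \<le> (\<Sum>E\<in>?B. \<bar>(G \<bullet> E) * energy 1 (\<lambda>x. E + snd (P E) x) \<Psi>\<bar>)" by (rule sum_abs)
    also have "\<dots> \<le> (\<Sum>E\<in>?B. norm G * ((\<eta> / ?N) * sqrt (energy 1 \<Psi> \<Psi>)))"
      unfolding abs_mult by (intro sum_mono mult_mono Basis_le_norm P(2)[OF h]) auto
    also have "\<dots> = \<eta> * norm G * sqrt (energy 1 \<Psi> \<Psi>)" using N by simp
    finally show ?thesis .
  qed
  ultimately show ?thesis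
    unfolding approximate_corrector_def by (intro exI[of _ \<phi>] exI[of _ \<Phi>] exI[of _ L] conjI allI impI)
qed

text \<open>
  The approximate Euler-Lagrange equation on the unit cell, for bounded test fields, extends to square integrable test
  fields by density and to test fields of period \<open>k\<close> by folding. The energy seminorm on the right is kept on the
  unit cell; folding costs a passage to the norm.
\<close>

lemma stationarity_limit:
  assumes k: "k \<ge> 1" and mA: "A \<in> borel_measurable borel" and pA: "periodic 1 A" and bA: "bounded (range A)"
    and st: "\<And>\<psi> \<Psi>. bounded_torus_gradient 1 \<psi> \<Psi> \<Longrightarrow> \<bar>energy 1 A \<Psi>\<bar> \<le> s * sqrt (energy 1 \<Psi> \<Psi>)"
    and s: "s \<ge> 0" and g: "L2_torus_gradient k \<psi> \<Psi>"
  shows "\<bar>energy k A \<Psi>\<bar> \<le> s * sqrt (c * (\<integral>x. (norm (\<Psi> x))\<^sup>2 \<partial>torus k))"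
    and "k = 1 \<Longrightarrow> \<bar>energy k A \<Psi>\<bar> \<le> s * sqrt (energy k \<Psi> \<Psi>)"
proof -
  have m: "\<psi> \<in> borel_measurable borel" "\<Psi> \<in> borel_measurable borel" and per: "periodic k \<psi>" "periodic k \<Psi>"
    and wg: "has_weak_gradient \<psi> \<Psi>" and sq: "square_integrable (torus k) \<Psi>"
    using g by (auto simp: L2_torus_gradient_def)
  from torus_gradient_approximation[OF k m per wg sq]
  obtain \<psi>' \<Psi>' where a: "\<forall>m. bounded_torus_gradient k (\<psi>' m) (\<Psi>' m)" "L2_tendsto (torus k) \<Psi>' \<Psi>"
    by (elim exE conjE)
  have sA: "square_integrable (torus k) A" by (rule bounded_imp_square_integrable[OF k mA bA])
  have lim: "(\<lambda>m. \<bar>energy k A (\<Psi>' m)\<bar>) \<longlonglongrightarrow> \<bar>energy k A \<Psi>\<bar>"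
    unfolding energy_def by (intro tendsto_rabs bilinear_field_tendsto[OF bilinear_field_b L2_tendsto_const[OF sA] a(2)])
  have b': "\<Psi>' m \<in> borel_measurable borel" "periodic k (\<Psi>' m)" "bounded (range (\<Psi>' m))" for m
    using a(1)[rule_format, of m] by (auto simp: bounded_torus_gradient_def)
  have sq': "square_integrable (torus k) (\<Psi>' m)" for m by (rule bounded_imp_square_integrable[OF k b'(1,3)])
  have "bilinear_field (torus k :: (real^'n) measure) (\<lambda>x. (\<bullet>) :: real^'n^'n \<Rightarrow> _) 1"
    unfolding bilinear_field_def
    by (auto simp: bilinear_conv_bounded_bilinear bounded_bilinear_inner Cauchy_Schwarz_ineq2)
  from bilinear_field_tendsto[OF this a(2) a(2)] have limn: "(\<lambda>m. \<integral>x. (norm (\<Psi>' m x))\<^sup>2 \<partial>torus k) \<longlonglongrightarrow> (\<integral>x. (norm (\<Psi> x))\<^sup>2 \<partial>torus k)"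
    by (simp add: power2_norm_eq_inner)
  have "\<bar>energy k A (\<Psi>' m)\<bar> \<le> s * sqrt (c * (\<integral>x. (norm (\<Psi>' m x))\<^sup>2 \<partial>torus k))" for m
  proof -
    have gf: "bounded_torus_gradient 1 (fold_torus k (\<psi>' m)) (fold_torus k (\<Psi>' m))"
      by (rule bounded_torus_gradient_fold[OF k a(1)[rule_format]])
    then have "square_integrable (torus 1) (fold_torus k (\<Psi>' m))"
      using bounded_imp_L2_torus_gradient[OF _ gf] by (simp add: L2_torus_gradient_def)
    then have "energy 1 (fold_torus k (\<Psi>' m)) (fold_torus k (\<Psi>' m)) \<le> c * (\<integral>x. (norm (fold_torus k (\<Psi>' m) x))\<^sup>2 \<partial>torus 1)"
      by (rule energy_quadratic_le)
    also have "\<dots> \<le> c * (\<integral>x. (norm (\<Psi>' m x))\<^sup>2 \<partial>torus k)"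
      using c_pos by (intro mult_left_mono norm_fold_torus_le[OF k b']) auto
    finally have le: "energy 1 (fold_torus k (\<Psi>' m)) (fold_torus k (\<Psi>' m)) \<le> c * (\<integral>x. (norm (\<Psi>' m x))\<^sup>2 \<partial>torus k)" .
    have "\<bar>energy k A (\<Psi>' m)\<bar> = \<bar>energy 1 A (fold_torus k (\<Psi>' m))\<bar>"
      unfolding energy_fold[OF k mA pA bA b'] ..
    also have "\<dots> \<le> s * sqrt (energy 1 (fold_torus k (\<Psi>' m)) (fold_torus k (\<Psi>' m)))" by (rule st[OF gf])
    also have "\<dots> \<le> s * sqrt (c * (\<integral>x. (norm (\<Psi>' m x))\<^sup>2 \<partial>torus k))"
      by (intro mult_left_mono real_sqrt_le_mono le s)
    finally show ?thesis .
  qed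
  then show "\<bar>energy k A \<Psi>\<bar> \<le> s * sqrt (c * (\<integral>x. (norm (\<Psi> x))\<^sup>2 \<partial>torus k))"
    by (intro LIMSEQ_le[OF lim tendsto_mult[OF tendsto_const tendsto_real_sqrt[OF tendsto_mult[OF tendsto_const limn]]]]) auto
  assume "k = 1"
  have "(\<lambda>m. energy k (\<Psi>' m) (\<Psi>' m)) \<longlonglongrightarrow> energy k \<Psi> \<Psi>"
    unfolding energy_def by (rule bilinear_field_tendsto[OF bilinear_field_b a(2) a(2)])
  then have lim2: "(\<lambda>m. s * sqrt (energy k (\<Psi>' m) (\<Psi>' m))) \<longlonglongrightarrow> s * sqrt (energy k \<Psi> \<Psi>)"
    by (intro tendsto_mult tendsto_const tendsto_real_sqrt)
  have "\<bar>energy k A (\<Psi>' m)\<bar> \<le> s * sqrt (energy k (\<Psi>' m) (\<Psi>' m))" for m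
    using st a(1) unfolding \<open>k = 1\<close> by blast
  then show "\<bar>energy k A \<Psi>\<bar> \<le> s * sqrt (energy k \<Psi> \<Psi>)"
    by (intro LIMSEQ_le[OF lim lim2]) auto
qed

end

section \<open>Consequences of the pointwise hypotheses\<close>

text \<open>
  The exceptional sets of a countable dense set of parameters have a null union, and a closed condition on a dense set
  holds everywhere.
\<close>

lemma AE_all_of_closed:
  fixes P :: "'a \<Rightarrow> 'b::second_countable_topology \<Rightarrow> bool"
  assumes P: "\<And>G. AE x in M. P x G" and cl: "AE x in M. closed {G. P x G}"
  shows "AE x in M. \<forall>G. P x G"
proof -
  obtain D :: "'b set" where D: "countable D" "\<And>X. open X \<Longrightarrow> X \<noteq> {} \<Longrightarrow> \<exists>d\<in>D. d \<in> X"
    using countable_dense_exists by blast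
  have "AE x in M. \<forall>G\<in>D. P x G"
    unfolding AE_ball_countable[OF D(1)] using P by blast
  with cl show ?thesis
  proof eventually_elim
    case (elim x)
    have "open (- {G. P x G})" using elim(1) by (simp add: open_Compl)
    then have "- {G. P x G} = {}" using D(2)[of "- {G. P x G}"] elim(2) by blast
    then show ?case by blast
  qed
qed

text \<open>
  Polarisation makes the coefficients measurable and periodic. Periodic Borel representatives are chosen for the
  coefficients in a basis, of which there are finitely many, so that bilinearity is preserved everywhere.
\<close>

lemma quadratic_integrand_form:
  fixes Q :: "real^'n \<Rightarrow> real^'n^'n \<Rightarrow> real"
  assumes Q: "Q \<in> quadratic_integrands"
  shows "\<exists>b c. periodic_form b c \<and> (AE x in lborel. \<forall>G. Q x G = b x G G)"
proof -
  let ?B = "Basis :: (real^'n^'n) set"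
  have pc: "periodic_caratheodory Q" and qf: "\<And>y. quadratic_form (Q y)"
    using Q by (auto simp: quadratic_integrands_def)
  obtain c where c: "c > 0" and es: "\<And>G. esssup lebesgue (\<lambda>y. ereal (Q y G)) \<le> ereal (c * (norm G)\<^sup>2)"
    using Q by (auto simp: quadratic_integrands_def)
  have nn: "0 \<le> Q y G" and mQ: "(\<lambda>y. Q y G) \<in> borel_measurable lebesgue" and pQ: "cell_periodic 1 (\<lambda>y. Q y G)" for y G
    using pc by (auto simp: periodic_caratheodory_def)
  obtain B where B: "\<And>y. bilinear (B y)" "\<And>y G H. B y G H = B y H G" "\<And>y G. Q y G = B y G G"
    using qf unfolding quadratic_form_def by metis
  have pol: "B y u v = (Q y (u + v) - Q y (u - v)) / 4" for y u v
    unfolding B(3) using B(2)[of y u v]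
    by (simp add: bilinear_ladd[OF B(1)] bilinear_radd[OF B(1)] bilinear_lsub[OF B(1)] bilinear_rsub[OF B(1)])
  have mB: "(\<lambda>y. B y u v) \<in> borel_measurable lebesgue" for u v
    unfolding pol by (intro borel_measurable_divide borel_measurable_diff mQ borel_measurable_const)
  have pB: "cell_periodic 1 (\<lambda>y. B y u v)" for u v
    unfolding cell_periodic_iff
  proof
    fix w
    have "AE y in lebesgue. Q (y + real 1 *\<^sub>R ivec w) G = Q y G" for G
      using pQ unfolding cell_periodic_iff by blast
    from this[of "u + v"] this[of "u - v"]
    show "AE y in lebesgue. B (y + real 1 *\<^sub>R ivec w) u v = B y u v"
      unfolding pol by eventually_elim simp
  qed
  define \<beta> where "\<beta> u v = (SOME g. g \<in> borel_measurable borel \<and> periodic 1 g \<and> (AE x in lborel. B x u v = g x))" for u v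
  have \<beta>: "\<beta> u v \<in> borel_measurable borel" "periodic 1 (\<beta> u v)" "AE x in lborel. B x u v = \<beta> u v x" for u v
  proof -
    have "\<beta> u v \<in> borel_measurable borel \<and> periodic 1 (\<beta> u v) \<and> (AE x in lborel. B x u v = \<beta> u v x)"
      unfolding \<beta>_def by (rule someI_ex[OF periodic_representative[OF mB pB order_refl]])
    then show "\<beta> u v \<in> borel_measurable borel" "periodic 1 (\<beta> u v)" "AE x in lborel. B x u v = \<beta> u v x" by blast+
  qed
  define b where "b x u v = (\<Sum>E\<in>?B. \<Sum>F\<in>?B. (u \<bullet> E) * (v \<bullet> F) * \<beta> E F x)" for x u v
  have expand: "B x u v = (\<Sum>E\<in>?B. \<Sum>F\<in>?B. (u \<bullet> E) * (v \<bullet> F) * B x E F)" for x u v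
    by (rule bilinear_Basis_expansion[OF B(1)])
  have "AE x in lborel. \<forall>E\<in>?B. \<forall>F\<in>?B. B x E F = \<beta> E F x"
    by (intro AE_finite_allI finite_Basis \<beta>)
  then have Bb: "AE x in lborel. B x = b x"
  proof eventually_elim
    case (elim x)
    show ?case
    proof (intro ext)
      fix u v
      have "B x u v = (\<Sum>E\<in>?B. \<Sum>F\<in>?B. (u \<bullet> E) * (v \<bullet> F) * B x E F)" by (rule expand)
      also have "\<dots> = b x u v" unfolding b_def using elim by (intro sum.cong refl) simp
      finally show "B x u v = b x u v" .
    qed
  qed
  have "AE x in lborel. Q x G \<le> c * (norm G)\<^sup>2" for G
    using esssup_AE[of "\<lambda>y. ereal (Q y G)" lebesgue] unfolding AE_lebesgue_iff
  proof eventually_elim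
    case (elim x)
    then have "ereal (Q x G) \<le> ereal (c * (norm G)\<^sup>2)" using es[of G] by (rule order_trans)
    then show ?case by simp
  qed
  then have ub: "AE x in lborel. \<forall>G. Q x G \<le> c * (norm G)\<^sup>2"
  proof (rule AE_all_of_closed)
    have "bounded_bilinear (B x)" for x using B(1)[of x] by (simp add: bilinear_conv_bounded_bilinear)
    from bounded_bilinear.continuous_on[OF this continuous_on_id continuous_on_id]
    have "continuous_on UNIV (\<lambda>G. Q x G)" for x
      unfolding B(3) .
    then show "AE x in lborel. closed {G. Q x G \<le> c * (norm G)\<^sup>2}"
      by (intro AE_I2 closed_Collect_le continuous_intros)
  qed
  have bd: "\<bar>B x u v\<bar> \<le> c * norm u * norm v" if q: "\<forall>G. Q x G \<le> c * (norm G)\<^sup>2" for x u v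
  proof (cases "u = 0 \<or> v = 0")
    case True
    then show ?thesis by (auto simp: bilinear_lzero[OF B(1)] bilinear_rzero[OF B(1)])
  next
    case False
    define u' where "u' = u /\<^sub>R norm u"
    define v' where "v' = v /\<^sub>R norm v"
    have n1: "norm u' = 1" "norm v' = 1" using False by (auto simp: u'_def v'_def)
    have "Q x (u' + v') \<le> c * 4" "Q x (u' - v') \<le> c * 4"
    proof -
      have "(norm (u' + v'))\<^sup>2 \<le> 2\<^sup>2" "(norm (u' - v'))\<^sup>2 \<le> 2\<^sup>2"
        using norm_triangle_ineq[of u' v'] norm_triangle_ineq4[of u' v'] n1
        by (intro power_mono; simp)+
      then have "c * (norm (u' + v'))\<^sup>2 \<le> c * 4" "c * (norm (u' - v'))\<^sup>2 \<le> c * 4" using c by auto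
      then show "Q x (u' + v') \<le> c * 4" "Q x (u' - v') \<le> c * 4" using q order_trans by blast+
    qed
    then have "\<bar>B x u' v'\<bar> \<le> c" unfolding pol using nn[of x "u' + v'"] nn[of x "u' - v'"] by (simp add: abs_le_iff)
    moreover have "B x u v = norm u * norm v * B x u' v'"
    proof -
      have "B x u v = B x (norm u *\<^sub>R u') (norm v *\<^sub>R v')" using False by (simp add: u'_def v'_def)
      then show ?thesis by (simp add: bilinear_lmul[OF B(1)] bilinear_rmul[OF B(1)])
    qed
    ultimately show ?thesis using mult_left_mono[of "\<bar>B x u' v'\<bar>" c "norm u * norm v"] by (simp add: abs_mult mult_ac)
  qed
  have "periodic_form b c"
  proof
    show "c > 0" by (rule c)
    show "bilinear (b x)" for x
      unfolding bilinear_def b_def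
      by (auto intro!: linearI simp: inner_add_left algebra_simps sum.distrib sum_distrib_left)
    show "(\<lambda>x. b x u v) \<in> borel_measurable borel" for u v
      unfolding b_def by (intro borel_measurable_sum borel_measurable_times borel_measurable_const \<beta>)
    show "periodic 1 b"
      using \<beta>(2) unfolding periodic_def b_def by (auto simp: fun_eq_iff)
    show "AE x in lborel. \<forall>u v. \<bar>b x u v\<bar> \<le> c * norm u * norm v"
      using Bb ub by eventually_elim (metis bd)
    show "AE x in lborel. \<forall>u v. b x u v = b x v u"
      using Bb by eventually_elim (metis B(2))
    show "AE x in lborel. \<forall>u. 0 \<le> b x u u"
      using Bb by eventually_elim (metis B(3) nn)
  qed
  moreover have "AE x in lborel. \<forall>G. Q x G = b x G G"
    using Bb by eventually_elim (metis B(3))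
  ultimately show ?thesis by blast
qed

lemma nondegenerate_AE:
  assumes "W \<in> class_W0 a"
  shows "AE x in lborel. \<forall>F. 1 / a * (infdist F SO)\<^sup>2 \<le> W x F"
proof (rule AE_all_of_closed)
  show "AE x in lborel. 1 / a * (infdist F SO)\<^sup>2 \<le> W x F" for F
    using assms by (simp add: class_W0_def nondegenerate_at_SO_def AE_lebesgue_iff)
  have "AE x in lborel. continuous_on UNIV (W x)"
    using assms by (simp add: class_W0_def periodic_caratheodory_def AE_lebesgue_iff)
  then show "AE x in lborel. closed {F. 1 / a * (infdist F SO)\<^sup>2 \<le> W x F}"
  proof eventually_elim
    case (elim x)
    show ?case
      by (intro closed_Collect_le elim continuous_on_mult continuous_on_power continuous_on_infdist continuous_on_const continuous_on_id)
  qed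
qed

text \<open>
  For each matrix the essential supremum gives the estimate outside a null set; continuity in the matrix makes one null
  set suffice.
\<close>

lemma expansion_AE:
  fixes W :: "real^'n \<Rightarrow> real^'n^'n \<Rightarrow> real"
  assumes W: "W \<in> class_W0 a" and Q: "Q \<in> quadratic_integrands" and ex: "quadratic_expansion W Q" and \<epsilon>: "\<epsilon> > 0"
  shows "\<exists>d>0. AE x in lborel. \<forall>A. norm A \<le> d \<longrightarrow> \<bar>W x (mat 1 + A) - Q x A\<bar> \<le> \<epsilon> * (norm A)\<^sup>2"
proof -
  have "Limsup (at 0) (\<lambda>G. esssup lebesgue (\<lambda>y. ereal (\<bar>W y (mat 1 + G) - Q y G\<bar> / (norm G)\<^sup>2))) < ereal \<epsilon>"
    using ex \<epsilon> by (simp add: quadratic_expansion_def zero_ereal_def)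
  then have "\<forall>\<^sub>F G in at 0. esssup lebesgue (\<lambda>y. ereal (\<bar>W y (mat 1 + G) - Q y G\<bar> / (norm G)\<^sup>2)) < ereal \<epsilon>"
    by (rule Limsup_lessD)
  then obtain d where d: "d > 0" "\<And>G. G \<noteq> 0 \<Longrightarrow> norm G < d \<Longrightarrow>
    esssup lebesgue (\<lambda>y. ereal (\<bar>W y (mat 1 + G) - Q y G\<bar> / (norm G)\<^sup>2)) < ereal \<epsilon>"
    unfolding eventually_at by auto
  have Q0: "Q x 0 = 0" and cQ: "continuous_on UNIV (Q x)" for x
  proof -
    have "quadratic_form (Q x)" using Q by (simp add: quadratic_integrands_def)
    then obtain B where B: "bilinear B" "\<And>G. Q x G = B G G" unfolding quadratic_form_def by blast
    show "Q x 0 = 0" unfolding B(2) by (rule bilinear_lzero[OF B(1)])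
    have "bounded_bilinear B" using B(1) by (simp add: bilinear_conv_bounded_bilinear)
    then have "continuous_on UNIV (\<lambda>G. B G G)"
      by (rule bounded_bilinear.continuous_on[OF _ continuous_on_id continuous_on_id])
    moreover have "Q x = (\<lambda>G. B G G)" by (rule ext) (rule B(2))
    ultimately show "continuous_on UNIV (Q x)" by simp
  qed
  have "AE x in lborel. \<forall>A. d \<le> norm A \<or> \<bar>W x (mat 1 + A) - Q x A\<bar> \<le> \<epsilon> * (norm A)\<^sup>2"
  proof (rule AE_all_of_closed)
    fix A :: "real^'n^'n"
    consider "d \<le> norm A" | "A = 0" | "A \<noteq> 0" "norm A < d" by linarith
    then show "AE x in lborel. d \<le> norm A \<or> \<bar>W x (mat 1 + A) - Q x A\<bar> \<le> \<epsilon> * (norm A)\<^sup>2"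
    proof cases
      case 2
      have "AE x in lborel. W x (mat 1) = 0" using W by (simp add: class_W0_def AE_lebesgue_iff)
      then show ?thesis by eventually_elim (simp add: 2 Q0)
    next
      case 3
      have "AE y in lborel. ereal (\<bar>W y (mat 1 + A) - Q y A\<bar> / (norm A)\<^sup>2) \<le> esssup lebesgue (\<lambda>y. ereal (\<bar>W y (mat 1 + A) - Q y A\<bar> / (norm A)\<^sup>2))"
        using esssup_AE[of "\<lambda>y. ereal (\<bar>W y (mat 1 + A) - Q y A\<bar> / (norm A)\<^sup>2)" lebesgue] unfolding AE_lebesgue_iff .
      then show ?thesis
      proof eventually_elim
        case (elim x)
        then have "ereal (\<bar>W x (mat 1 + A) - Q x A\<bar> / (norm A)\<^sup>2) \<le> ereal \<epsilon>"
          using d(2)[OF 3] by (meson less_imp_le order_trans)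
        then show ?case using 3 by (simp add: pos_divide_le_eq)
      qed
    qed simp
  next
    have "AE x in lborel. continuous_on UNIV (W x)"
      using W by (simp add: class_W0_def periodic_caratheodory_def AE_lebesgue_iff)
    then show "AE x in lborel. closed {A. d \<le> norm A \<or> \<bar>W x (mat 1 + A) - Q x A\<bar> \<le> \<epsilon> * (norm A)\<^sup>2}"
    proof eventually_elim
      case (elim x)
      have "continuous_on UNIV (\<lambda>A. W x (mat 1 + A))"
        by (rule continuous_on_compose2[OF elim]) (auto intro!: continuous_intros)
      then show ?case
        by (intro closed_Collect_disj closed_Collect_le continuous_intros cQ)
    qed
  qed
  then have "AE x in lborel. \<forall>A. norm A \<le> d / 2 \<longrightarrow> \<bar>W x (mat 1 + A) - Q x A\<bar> \<le> \<epsilon> * (norm A)\<^sup>2"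
    by eventually_elim (use d(1) in force)
  \<comment> \<open>Half the radius, since the estimate is known for \<open>norm A < d\<close> and is claimed on a closed ball.\<close>
  then show ?thesis using d(1) by (intro exI[of _ "d / 2"]) simp
qed

section \<open>Bounds by approximate correctors\<close>

lemma cell_average_eq_torus:
  fixes f g :: "real^'n \<Rightarrow> real"
  assumes g: "g \<in> borel_measurable borel" and eq: "AE x in lborel. f x = g x"
  shows "(\<integral>\<^sup>+y\<in>cell k. ennreal (f y) \<partial>lebesgue) / ennreal (real k ^ CARD('n)) = (\<integral>\<^sup>+x. ennreal (g x) \<partial>torus k)"
proof -
  have "(\<integral>\<^sup>+y\<in>cell k. ennreal (f y) \<partial>lebesgue) = (\<integral>\<^sup>+y\<in>cell k. ennreal (f y) \<partial>lborel)"
    by (rule nn_integral_completion)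
  also have "\<dots> = (\<integral>\<^sup>+y\<in>cell k. ennreal (g y) \<partial>lborel)"
    by (rule nn_integral_cong_AE) (use eq in eventually_elim, simp)
  finally show ?thesis using g by (subst nn_integral_torus) auto
qed

text \<open>
  The bounds for homogenized energies compare the integrand along a competitor with a Borel function, from one side
  and almost everywhere.
\<close>

lemma cell_average_mono_torus:
  fixes f g :: "real^'n \<Rightarrow> real"
  assumes g: "g \<in> borel_measurable borel"
  shows "AE x in lborel. f x \<le> g x \<Longrightarrow>
      (\<integral>\<^sup>+y\<in>cell k. ennreal (f y) \<partial>lebesgue) / ennreal (real k ^ CARD('n)) \<le> (\<integral>\<^sup>+x. ennreal (g x) \<partial>torus k)"
    and "AE x in lborel. g x \<le> f x \<Longrightarrow>
      (\<integral>\<^sup>+x. ennreal (g x) \<partial>torus k) \<le> (\<integral>\<^sup>+y\<in>cell k. ennreal (f y) \<partial>lebesgue) / ennreal (real k ^ CARD('n))"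
proof -
  have t: "(\<integral>\<^sup>+x. ennreal (g x) \<partial>torus k) = (\<integral>\<^sup>+y\<in>cell k. ennreal (g y) \<partial>lborel) / ennreal (real k ^ CARD('n))"
    using g by (subst nn_integral_torus) auto
  have c: "(\<integral>\<^sup>+y\<in>cell k. ennreal (f y) \<partial>lebesgue) = (\<integral>\<^sup>+y\<in>cell k. ennreal (f y) \<partial>lborel)"
    by (rule nn_integral_completion)
  show "(\<integral>\<^sup>+y\<in>cell k. ennreal (f y) \<partial>lebesgue) / ennreal (real k ^ CARD('n)) \<le> (\<integral>\<^sup>+x. ennreal (g x) \<partial>torus k)"
    if "AE x in lborel. f x \<le> g x"
    unfolding t c
    by (intro divide_right_mono_ennreal nn_integral_mono_AE) (use that in eventually_elim, simp add: mult_right_mono ennreal_leI)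
  show "(\<integral>\<^sup>+x. ennreal (g x) \<partial>torus k) \<le> (\<integral>\<^sup>+y\<in>cell k. ennreal (f y) \<partial>lebesgue) / ennreal (real k ^ CARD('n))"
    if "AE x in lborel. g x \<le> f x"
    unfolding t c
    by (intro divide_right_mono_ennreal nn_integral_mono_AE) (use that in eventually_elim, simp add: mult_right_mono ennreal_leI)
qed

lemma cell_average_competitor:
  fixes \<phi> :: "real^'n \<Rightarrow> real^'n"
  assumes "\<phi> \<in> W1p_per p k" "has_weak_gradient \<phi> \<Phi>"
  shows "cell_inf p k V F \<le> (\<integral>\<^sup>+y\<in>cell k. ennreal (V y (F + \<Phi> y)) \<partial>lebesgue) / ennreal (real k ^ CARD('n))"
  unfolding cell_inf_def using assms by (intro Inf_lower) blast

lemma ennreal_integral_le: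
  assumes "integrable M h" shows "ennreal (\<integral>x. h x \<partial>M) \<le> (\<integral>\<^sup>+x. ennreal (h x) \<partial>M)"
proof -
  have i: "integrable M (\<lambda>x. max 0 (h x))" using assms by simp
  have "(\<integral>x. h x \<partial>M) \<le> (\<integral>x. max 0 (h x) \<partial>M)" using assms i by (intro integral_mono) auto
  then have "ennreal (\<integral>x. h x \<partial>M) \<le> ennreal (\<integral>x. max 0 (h x) \<partial>M)" by (rule ennreal_leI)
  also have "\<dots> = (\<integral>\<^sup>+x. ennreal (max 0 (h x)) \<partial>M)" by (rule nn_integral_eq_integral[symmetric, OF i]) simp
  also have "\<dots> = (\<integral>\<^sup>+x. ennreal (h x) \<partial>M)" by (intro nn_integral_cong) (simp add: max_def ennreal_neg)
  finally show ?thesis .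
qed

text \<open>
  Membership provides some square integrable weak gradient, and uniqueness identifies it with the given one.
\<close>

lemma W1p_per_2_weak_gradient_square_integrable:
  fixes \<phi> :: "real^'n \<Rightarrow> real^'n"
  assumes k: "k \<ge> 1" and \<phi>: "\<phi> \<in> W1p_per 2 k" and wg: "has_weak_gradient \<phi> \<Phi>"
    and \<Phi>': "\<Phi>' \<in> borel_measurable borel" "AE x in lborel. \<Phi> x = \<Phi>' x"
  shows "square_integrable (torus k) \<Phi>'"
proof -
  note [measurable] = \<Phi>'(1)
  obtain \<Psi> where \<Psi>: "Lp_loc 2 \<Psi>" "has_weak_gradient \<phi> \<Psi>" using \<phi> by (auto simp: W1p_per_def)
  have "AE x in lborel. \<Phi> x = \<Psi> x"
    using has_weak_gradient_unique[OF wg \<Psi>(2)] unfolding AE_lebesgue_iff by simp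
  with \<Phi>'(2) have e: "AE x in lborel. \<Psi> x = \<Phi>' x" by eventually_elim simp
  have L: "Lp_loc 2 \<Phi>'" by (rule Lp_loc_cong_AE[OF \<Psi>(1) e \<Phi>'(1)])
  obtain R where R: "\<And>f. f \<in> borel_measurable borel \<Longrightarrow> (\<integral>\<^sup>+x. f x \<partial>torus k) \<le> (\<integral>\<^sup>+x\<in>cball (0 :: real^'n) R. f x \<partial>lborel)"
    using nn_integral_torus_le_cball[OF k] by blast
  have "(\<integral>\<^sup>+x. ennreal ((norm (\<Phi>' x))\<^sup>2) \<partial>torus k) \<le> (\<integral>\<^sup>+x\<in>cball 0 R. ennreal ((norm (\<Phi>' x))\<^sup>2) \<partial>lborel)"
    by (intro R) measurable
  also have "\<dots> = (\<integral>\<^sup>+x. ennreal (norm (indicat_real (cball 0 R) x *\<^sub>R (norm (\<Phi>' x) powr 2))) \<partial>lborel)"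
    by (intro nn_integral_cong) (auto simp: indicator_def)
  also have "\<dots> = (\<integral>\<^sup>+x. ennreal (norm (indicat_real (cball 0 R) x *\<^sub>R (norm (\<Phi>' x) powr 2))) \<partial>lebesgue)"
    by (rule nn_integral_completion[symmetric])
  also have "\<dots> < \<infinity>"
    using L unfolding Lp_loc_def set_integrable_def integrable_iff_bounded by (metis compact_cball)
  finally show ?thesis by (subst square_integrable_iff_nn) auto
qed

context periodic_form
begin

lemma corrector_square_integrable:
  assumes "approximate_corrector \<eta> L G \<phi> \<Phi>" "k \<ge> 1"
  shows "square_integrable (torus k) \<Phi>" "\<Phi> \<in> borel_measurable borel" "periodic 1 \<Phi>" "bounded (range \<Phi>)"
    "square_integrable (torus k) (\<lambda>x. G + \<Phi> x)" "(\<lambda>x. G + \<Phi> x) \<in> borel_measurable borel"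
    "periodic 1 (\<lambda>x. G + \<Phi> x)" "bounded (range (\<lambda>x. G + \<Phi> x))"
proof -
  have 1: "\<Phi> \<in> borel_measurable borel" "periodic 1 \<Phi>" "bounded (range \<Phi>)"
    using assms(1) by (auto simp: approximate_corrector_def bounded_torus_gradient_def)
  show "square_integrable (torus k) \<Phi>" "\<Phi> \<in> borel_measurable borel" "periodic 1 \<Phi>" "bounded (range \<Phi>)"
    using bounded_imp_square_integrable[OF assms(2) 1(1,3)] 1 by blast+
  show "square_integrable (torus k) (\<lambda>x. G + \<Phi> x)" "(\<lambda>x. G + \<Phi> x) \<in> borel_measurable borel"
    using bounded_imp_square_integrable[OF assms(2) 1(1,3)] 1(1) by (auto intro: square_integrable_shift[OF assms(2)])
  show "periodic 1 (\<lambda>x. G + \<Phi> x)" using 1(2) by (simp add: periodic_def)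
  show "bounded (range (\<lambda>x. G + \<Phi> x))"
    using assms(1) by (auto simp: approximate_corrector_def bounded_iff)
qed

text \<open>
  With \<open>X = \<Psi> - \<Phi>\<close> the energy of \<open>G + \<Psi>\<close> is that of \<open>A = G + \<Phi>\<close> plus
  \<open>2 * b A X + b X X\<close>, and the approximate Euler-Lagrange equation bounds the mixed term by
  \<open>\<eta>\<^sup>2 * (norm G)\<^sup>2 + b X X\<close>.
\<close>

lemma corrector_energy_le:
  assumes ac: "approximate_corrector \<eta> L G \<phi> \<Phi>" and \<eta>: "\<eta> \<ge> 0" and g: "L2_torus_gradient 1 \<psi> \<Psi>"
  shows "energy 1 (\<lambda>x. G + \<Phi> x) (\<lambda>x. G + \<Phi> x) - \<eta>\<^sup>2 * (norm G)\<^sup>2 \<le> energy 1 (\<lambda>x. G + \<Psi> x) (\<lambda>x. G + \<Psi> x)"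
proof -
  let ?A = "\<lambda>x. G + \<Phi> x"
  note A = corrector_square_integrable[OF ac order_refl]
  have "L2_torus_gradient 1 (\<lambda>x. \<psi> x + (-1) *\<^sub>R \<phi> x) (\<lambda>x. \<Psi> x + (-1) *\<^sub>R \<Phi> x)"
    using ac by (intro L2_torus_gradient_add L2_torus_gradient_scaleR g bounded_imp_L2_torus_gradient) (auto simp: approximate_corrector_def)
  then have d: "L2_torus_gradient 1 (\<lambda>x. \<psi> x - \<phi> x) (\<lambda>x. \<Psi> x - \<Phi> x)" by simp
  define X where "X x = \<Psi> x - \<Phi> x" for x
  have sX: "square_integrable (torus 1) X" "X \<in> borel_measurable borel"
    using d by (simp_all add: X_def[abs_def] L2_torus_gradient_def)
  have "\<bar>energy 1 ?A X\<bar> \<le> (\<eta> * norm G) * sqrt (energy 1 X X)"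
    unfolding X_def[abs_def]
    by (rule stationarity_limit(2)[OF order_refl A(6,7,8) _ _ d refl]) (use ac \<eta> in \<open>auto simp: approximate_corrector_def\<close>)
  moreover have "0 \<le> (\<eta> * norm G - sqrt (energy 1 X X))\<^sup>2" by simp
  then have "2 * ((\<eta> * norm G) * sqrt (energy 1 X X)) \<le> \<eta>\<^sup>2 * (norm G)\<^sup>2 + energy 1 X X"
    using energy_nonneg[of 1 X] by (simp add: power2_diff power_mult_distrib mult.assoc)
  moreover have "energy 1 (\<lambda>x. ?A x + X x) (\<lambda>x. ?A x + X x) = energy 1 ?A ?A + 2 * energy 1 ?A X + energy 1 X X"
    by (rule energy_square_add[OF A(5,6) sX])
  moreover have "(\<lambda>x. ?A x + X x) = (\<lambda>x. G + \<Psi> x)" by (simp add: X_def)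
  ultimately show ?thesis by (simp add: abs_le_iff)
qed

lemma energy_const_le: "energy 1 (\<lambda>x. G) (\<lambda>x. G) \<le> c * (norm G)\<^sup>2"
proof -
  interpret prob_space "torus 1 :: (real^'n) measure" by (rule prob_space_torus) simp
  have "square_integrable (torus 1) (\<lambda>x :: real^'n. G)"
    by (rule bounded_imp_square_integrable) auto
  from energy_quadratic_le[OF this] show ?thesis using prob_space by simp
qed

text \<open>
  Comparison with the zero potential.
\<close>

lemma corrector_energy_bound:
  assumes ac: "approximate_corrector \<eta> L G \<phi> \<Phi>" and \<eta>: "0 \<le> \<eta>" "\<eta> \<le> 1"
  shows "energy 1 (\<lambda>x. G + \<Phi> x) (\<lambda>x. G + \<Phi> x) \<le> (c + 1) * (norm G)\<^sup>2"
proof -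
  have "L2_torus_gradient 1 (\<lambda>x. 0) (\<lambda>x. 0 :: real^'n^'n)"
    by (intro bounded_imp_L2_torus_gradient bounded_torus_gradient_0) simp
  from corrector_energy_le[OF ac \<eta>(1) this]
  have "energy 1 (\<lambda>x. G + \<Phi> x) (\<lambda>x. G + \<Phi> x) \<le> \<eta>\<^sup>2 * (norm G)\<^sup>2 + c * (norm G)\<^sup>2"
    using energy_const_le[of G] by simp
  moreover have "\<eta>\<^sup>2 * (norm G)\<^sup>2 \<le> 1 * (norm G)\<^sup>2"
    using \<eta> by (intro mult_right_mono) (auto simp: power_le_one)
  ultimately show ?thesis by (simp add: distrib_right)
qed

text \<open>
  An approximate corrector is itself a competitor, and it is optimal up to the error of \<open>corrector_energy_le\<close>.
\<close>

lemma one_cell_bounds: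
  assumes Q: "AE x in lborel. \<forall>G. Q x G = b x G G"
    and ac: "approximate_corrector \<eta> L G \<phi> \<Phi>" and \<eta>: "\<eta> \<ge> 0"
  shows "one_cell_hom Q G \<le> ennreal (energy 1 (\<lambda>x. G + \<Phi> x) (\<lambda>x. G + \<Phi> x))"
    and "ennreal (energy 1 (\<lambda>x. G + \<Phi> x) (\<lambda>x. G + \<Phi> x) - \<eta>\<^sup>2 * (norm G)\<^sup>2) \<le> one_cell_hom Q G"
proof -
  have energy_eq: "(\<integral>\<^sup>+y\<in>cell 1. ennreal (Q y (G + \<Psi> y)) \<partial>lebesgue) / ennreal (real 1 ^ CARD('n)) = ennreal (energy 1 (\<lambda>x. G + \<Psi>' x) (\<lambda>x. G + \<Psi>' x))"
    if m: "\<Psi>' \<in> borel_measurable borel" and s: "square_integrable (torus 1) \<Psi>'" and e: "AE x in lborel. \<Psi> x = \<Psi>' x" for \<Psi> \<Psi>'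
  proof -
    have m': "(\<lambda>x. G + \<Psi>' x) \<in> borel_measurable borel" using m by measurable
    have s': "square_integrable (torus 1) (\<lambda>x. G + \<Psi>' x)" by (rule square_integrable_shift[OF order_refl s])
    have "AE x in lborel. Q x (G + \<Psi> x) = b x (G + \<Psi>' x) (G + \<Psi>' x)"
      using e Q by eventually_elim simp
    from cell_average_eq_torus[OF measurable_b_comp[OF m' m'] this, of 1]
    have "(\<integral>\<^sup>+y\<in>cell 1. ennreal (Q y (G + \<Psi> y)) \<partial>lebesgue) / ennreal (real 1 ^ CARD('n)) = (\<integral>\<^sup>+x. ennreal (b x (G + \<Psi>' x) (G + \<Psi>' x)) \<partial>torus 1)" .
    also have "\<dots> = ennreal (energy 1 (\<lambda>x. G + \<Psi>' x) (\<lambda>x. G + \<Psi>' x))"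
      unfolding energy_def
    proof (rule nn_integral_eq_integral[OF energy_integrable[OF s' s']])
      show "AE x in torus 1. 0 \<le> b x (G + \<Psi>' x) (G + \<Psi>' x)"
        using AE_torusI[OF nonneg_b] by eventually_elim simp
    qed
    finally show ?thesis .
  qed
  note A = corrector_square_integrable[OF ac order_refl]
  have g: "bounded_torus_gradient 1 \<phi> \<Phi>" using ac by (simp add: approximate_corrector_def)
  have "\<phi> \<in> W1p_per 2 1" "has_weak_gradient \<phi> \<Phi>"
    using bounded_torus_gradient_W1p_per[OF g, of 2] g by (auto simp: bounded_torus_gradient_def)
  from cell_average_competitor[OF this, of Q G]
  show "one_cell_hom Q G \<le> ennreal (energy 1 (\<lambda>x. G + \<Phi> x) (\<lambda>x. G + \<Phi> x))"
    unfolding one_cell_hom_def energy_eq[OF A(2,1) AE_I2[OF refl]] .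
  show "ennreal (energy 1 (\<lambda>x. G + \<Phi> x) (\<lambda>x. G + \<Phi> x) - \<eta>\<^sup>2 * (norm G)\<^sup>2) \<le> one_cell_hom Q G"
    unfolding one_cell_hom_def cell_inf_def
  proof (rule Inf_greatest, clarify)
    fix \<psi> :: "real^'n \<Rightarrow> real^'n" and \<Psi> :: "real^'n \<Rightarrow> real^'n^'n" assume \<psi>: "\<psi> \<in> W1p_per 2 1" and wg: "has_weak_gradient \<psi> \<Psi>"
    have "cell_periodic 1 \<psi>" using \<psi> by (simp add: W1p_per_def)
    from periodic_weak_gradient_representatives[OF wg this order_refl]
    obtain \<psi>' \<Psi>' where r: "\<psi>' \<in> borel_measurable borel" "\<Psi>' \<in> borel_measurable borel" "periodic 1 \<psi>'" "periodic 1 \<Psi>'"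
      "has_weak_gradient \<psi>' \<Psi>'" "AE x in lborel. \<psi> x = \<psi>' x" "AE x in lborel. \<Psi> x = \<Psi>' x" by blast
    have s: "square_integrable (torus 1) \<Psi>'"
      by (rule W1p_per_2_weak_gradient_square_integrable[OF order_refl \<psi> wg r(2,7)])
    have "L2_torus_gradient 1 \<psi>' \<Psi>'" using r s by (simp add: L2_torus_gradient_def)
    from ennreal_leI[OF corrector_energy_le[OF ac \<eta> this]]
    show "ennreal (energy 1 (\<lambda>x. G + \<Phi> x) (\<lambda>x. G + \<Phi> x) - \<eta>\<^sup>2 * (norm G)\<^sup>2) \<le>
      (\<integral>\<^sup>+y\<in>cell 1. ennreal (Q y (G + \<Psi> y)) \<partial>lebesgue) / ennreal (real 1 ^ CARD('n))"
      unfolding energy_eq[OF r(2) s r(7)] .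
  qed
qed

text \<open>
  The approximate corrector is a competitor on one cell, and its values stay where the expansion of \<open>W\<close> applies.
\<close>

lemma multi_cell_upper_bound:
  assumes p: "p > 0" and W: "AE x in lborel. \<forall>A. norm A \<le> d \<longrightarrow> W x (mat 1 + A) \<le> b x A A + \<epsilon> * (norm A)\<^sup>2"
    and ac: "approximate_corrector \<eta> L G \<phi> \<Phi>" and G: "L * norm G \<le> d" and \<epsilon>: "\<epsilon> \<ge> 0"
  shows "multi_cell_hom p W (mat 1 + G) \<le> ennreal (energy 1 (\<lambda>x. G + \<Phi> x) (\<lambda>x. G + \<Phi> x) + \<epsilon> * L\<^sup>2 * (norm G)\<^sup>2)"
proof -
  interpret prob_space "torus 1 :: (real^'n) measure" by (rule prob_space_torus) simp
  let ?A = "\<lambda>x. G + \<Phi> x"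
  note A = corrector_square_integrable[OF ac order_refl]
  have n: "norm (?A x) \<le> L * norm G" for x using ac by (simp add: approximate_corrector_def)
  have g: "bounded_torus_gradient 1 \<phi> \<Phi>" using ac by (simp add: approximate_corrector_def)
  let ?h = "\<lambda>x. b x (?A x) (?A x) + \<epsilon> * L\<^sup>2 * (norm G)\<^sup>2"
  have mh: "?h \<in> borel_measurable borel" by (intro borel_measurable_add borel_measurable_const measurable_b_comp A)
  have ih: "integrable (torus 1) ?h"
    by (intro Bochner_Integration.integrable_add energy_integrable A integrable_const)
  have "multi_cell_hom p W (mat 1 + G) \<le> cell_inf p 1 W (mat 1 + G)"
    unfolding multi_cell_hom_def by (rule INF_lower) simp
  also have "\<dots> \<le> (\<integral>\<^sup>+y\<in>cell 1. ennreal (W y ((mat 1 + G) + \<Phi> y)) \<partial>lebesgue) / ennreal (real 1 ^ CARD('n))"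
    by (rule cell_average_competitor[OF bounded_torus_gradient_W1p_per[OF g p]]) (use g in \<open>simp add: bounded_torus_gradient_def\<close>)
  also have "\<dots> \<le> (\<integral>\<^sup>+x. ennreal (?h x) \<partial>torus 1)"
  proof (rule cell_average_mono_torus(1)[OF mh])
    show "AE x in lborel. W x ((mat 1 + G) + \<Phi> x) \<le> ?h x"
      using W
    proof eventually_elim
      case (elim x)
      have "W x (mat 1 + ?A x) \<le> b x (?A x) (?A x) + \<epsilon> * (norm (?A x))\<^sup>2"
        using elim order_trans[OF n G] by blast
      also have "\<epsilon> * (norm (?A x))\<^sup>2 \<le> \<epsilon> * (L * norm G)\<^sup>2"
        using n \<epsilon> by (intro mult_left_mono power_mono) auto
      finally show ?case by (simp add: add.assoc power_mult_distrib mult.assoc)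
    qed
  qed
  also have "\<dots> = ennreal (\<integral>x. ?h x \<partial>torus 1)"
  proof (rule nn_integral_eq_integral[OF ih])
    show "AE x in torus 1. 0 \<le> ?h x"
      using AE_torusI[OF nonneg_b] by eventually_elim (use \<epsilon> in simp)
  qed
  also have "(\<integral>x. ?h x \<partial>torus 1) = energy 1 ?A ?A + \<epsilon> * L\<^sup>2 * (norm G)\<^sup>2"
    using Bochner_Integration.integral_add[OF energy_integrable[OF A(5,5)] integrable_const[of "\<epsilon> * L\<^sup>2 * (norm G)\<^sup>2"]] prob_space
    by (simp add: energy_def)
  finally show ?thesis .
qed

end

text \<open>
  Rotations have the norm of the identity, so a field whose distance to the rotations is square integrable is square
  integrable itself.
\<close>

lemma norm_le_infdist_SO: "norm X \<le> infdist (mat 1 + X) SO + 2 * norm (mat 1 :: real^'n^'n)"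
  for X :: "real^'n^'n"
proof -
  obtain R where R: "R \<in> SO" "infdist (mat 1 + X) SO = dist (mat 1 + X) R"
    using infdist_attains_inf[OF compact_imp_closed[OF compact_SO]] mat_1_in_SO by (metis empty_iff)
  have "norm R = norm (mat 1 :: real^'n^'n)"
    using R(1) by (simp add: SO_def rotation_matrix_def norm_matrix_eq_sqrt_trace orthogonal_matrix)
  moreover have "norm X \<le> norm (mat 1 + X - R) + norm (R - mat 1)"
    using norm_triangle_ineq[of "mat 1 + X - R" "R - mat 1"] by simp
  moreover have "norm (R - mat 1) \<le> norm R + norm (mat 1 :: real^'n^'n)" by (rule norm_triangle_ineq4)
  ultimately show ?thesis using R(2) by (simp add: dist_norm)
qed

text \<open>
  The pointwise bound of \<open>norm_sq_le_minor_form_infdist\<close> is averaged; the mean of the null Lagrangian is its value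
  at \<open>G\<close>. The constant does not involve \<open>k\<close>.
\<close>

lemma periodic_rigidity:
  fixes \<phi> :: "real^'n \<Rightarrow> real^'n"
  assumes k: "k \<ge> 1" and a: "a > 0"
    and m[measurable]: "\<phi> \<in> borel_measurable borel" "\<Phi> \<in> borel_measurable borel"
    and per: "periodic k \<phi>" "periodic k \<Phi>" and wg: "has_weak_gradient \<phi> \<Phi>"
    and C: "C > 0" "\<And>A :: real^'n^'n. (norm A)\<^sup>2 \<le> C * (minor_form A A + C * (infdist (mat 1 + A) SO)\<^sup>2)"
    and e: "e \<ge> 0" "(\<integral>\<^sup>+x. ennreal (1 / a * (infdist (mat 1 + (G + \<Phi> x)) SO)\<^sup>2) \<partial>torus k) \<le> ennreal e"
  shows "square_integrable (torus k) \<Phi>"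
    and "(\<integral>x. (norm (G + \<Phi> x))\<^sup>2 \<partial>torus k) \<le> C * (minor_form G G + C * a * e)"
proof -
  interpret prob_space "torus k :: (real^'n) measure" by (rule prob_space_torus[OF k])
  define D where "D x = infdist (mat 1 + (G + \<Phi> x)) SO" for x
  have mi: "(\<lambda>F :: real^'n^'n. infdist F SO) \<in> borel_measurable borel"
    by (intro borel_measurable_continuous_onI continuous_on_infdist continuous_on_id)
  have mD[measurable]: "D \<in> borel_measurable borel"
    unfolding D_def[abs_def] by (rule measurable_compose[OF _ mi]) measurable
  have D0: "D x \<ge> 0" for x by (simp add: D_def infdist_nonneg)
  have nD: "(\<integral>\<^sup>+x. ennreal ((D x)\<^sup>2) \<partial>torus k) \<le> ennreal (a * e)"
  proof -
    have "(\<integral>\<^sup>+x. ennreal ((D x)\<^sup>2) \<partial>torus k) = (\<integral>\<^sup>+x. ennreal a * ennreal (1 / a * (D x)\<^sup>2) \<partial>torus k)"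
      using a by (intro nn_integral_cong) (simp add: ennreal_mult[symmetric])
    also have "\<dots> = ennreal a * (\<integral>\<^sup>+x. ennreal (1 / a * (D x)\<^sup>2) \<partial>torus k)" by (rule nn_integral_cmult) measurable
    also have "\<dots> \<le> ennreal a * ennreal e" using e(2) by (intro mult_left_mono) (simp_all add: D_def)
    also have "\<dots> = ennreal (a * e)" using a e(1) by (simp add: ennreal_mult)
    finally show ?thesis .
  qed
  then have fin: "(\<integral>\<^sup>+x. ennreal ((norm (D x))\<^sup>2) \<partial>torus k) < \<infinity>"
    by (simp add: le_less_trans[OF _ ennreal_less_top])
  have sD: "square_integrable (torus k) D"
    using fin by (subst square_integrable_iff_nn) auto
  have iD: "integrable (torus k) (\<lambda>x. (D x)\<^sup>2)" using sD by (simp add: square_integrable_def)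
  have ID: "(\<integral>x. (D x)\<^sup>2 \<partial>torus k) \<le> a * e"
  proof -
    have "ennreal (\<integral>x. (D x)\<^sup>2 \<partial>torus k) \<le> ennreal (a * e)"
      using nn_integral_eq_integral[OF iD] nD by simp
    then show ?thesis using a e(1) by (subst (asm) ennreal_le_iff) auto
  qed
  have sX: "square_integrable (torus k) (\<lambda>x. G + \<Phi> x)"
    unfolding square_integrable_def
  proof
    let ?n = "norm (mat 1 :: real^'n^'n)"
    show "integrable (torus k) (\<lambda>x. (norm (G + \<Phi> x))\<^sup>2)"
    proof (rule Bochner_Integration.integrable_bound)
      show "integrable (torus k) (\<lambda>x. 2 * (D x)\<^sup>2 + 2 * (2 * ?n)\<^sup>2)" using iD by simp
      have "(norm (G + \<Phi> x))\<^sup>2 \<le> 2 * (D x)\<^sup>2 + 2 * (2 * ?n)\<^sup>2" for x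
      proof -
        have "(norm (G + \<Phi> x))\<^sup>2 \<le> (D x + 2 * ?n)\<^sup>2"
          unfolding D_def by (intro power_mono norm_le_infdist_SO) simp
        also have "\<dots> \<le> 2 * (D x)\<^sup>2 + 2 * (2 * ?n)\<^sup>2"
          using norm_add_square_le[of "D x" "2 * ?n"] by simp
        finally show ?thesis .
      qed
      then show "AE x in torus k. norm ((norm (G + \<Phi> x))\<^sup>2) \<le> norm (2 * (D x)\<^sup>2 + 2 * (2 * ?n)\<^sup>2)"
        by (intro AE_I2) (simp add: abs_of_nonneg)
    qed measurable
  qed measurable
  have sG: "square_integrable (torus k) (\<lambda>x :: real^'n. G)"
    by (rule bounded_imp_square_integrable[OF k]) auto
  have "square_integrable (torus k) (\<lambda>x. (G + \<Phi> x) - G)" by (rule square_integrable_diff[OF sX sG])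
  then show s\<Phi>: "square_integrable (torus k) \<Phi>" by simp
  obtain q where "bilinear_field (torus k :: (real^'n) measure) (\<lambda>x. minor_form :: real^'n^'n \<Rightarrow> _) q"
    using bilinear_field_const[OF bilinear_minor_form] .
  from bilinear_field_integral(1)[OF this sX sX]
  have im: "integrable (torus k) (\<lambda>x. minor_form (G + \<Phi> x) (G + \<Phi> x))" .
  have "(\<integral>x. (norm (G + \<Phi> x))\<^sup>2 \<partial>torus k) \<le> (\<integral>x. C * (minor_form (G + \<Phi> x) (G + \<Phi> x) + C * (D x)\<^sup>2) \<partial>torus k)"
    using sX im iD C(2) by (intro integral_mono) (auto simp: square_integrable_def D_def)
  also have "\<dots> = C * (minor_form G G + C * (\<integral>x. (D x)\<^sup>2 \<partial>torus k))"
    using im iD null_lagrangian[OF k m per wg s\<Phi>, of G] by simp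
  also have "\<dots> \<le> C * (minor_form G G + C * (a * e))"
    using C(1) ID by (intro mult_left_mono add_left_mono) auto
  finally show "(\<integral>x. (norm (G + \<Phi> x))\<^sup>2 \<partial>torus k) \<le> C * (minor_form G G + C * a * e)" by (simp add: mult.assoc)
qed

context periodic_form
begin

text \<open>
  Both \<open>\<Phi>\<close> and \<open>\<Psi>\<close> are test fields, almost orthogonal to \<open>A = G + \<Phi>\<close>. Hence the pairings of
  \<open>A\<close> with \<open>A\<close> and with \<open>G + \<Psi>\<close> are both close to that with \<open>G\<close>.
\<close>

lemma corrector_cross_energy:
  assumes ac: "approximate_corrector \<eta> L G \<phi> \<Phi>" and \<eta>: "0 \<le> \<eta>" "\<eta> \<le> 1" and k: "k \<ge> 1"
    and g: "L2_torus_gradient k \<psi> \<Psi>" and S: "(\<integral>x. (norm (\<Psi> x))\<^sup>2 \<partial>torus k) \<le> S * (norm G)\<^sup>2"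
  shows "energy 1 (\<lambda>x. G + \<Phi> x) (\<lambda>x. G + \<Phi> x) - \<eta> * (sqrt (4 * c + 2) + sqrt (c * S)) * (norm G)\<^sup>2
    \<le> energy k (\<lambda>x. G + \<Phi> x) (\<lambda>x. G + \<Psi> x)"
proof -
  let ?A = "\<lambda>x. G + \<Phi> x"
  let ?G = "\<lambda>x :: real^'n. G"
  let ?n = "norm G"
  have st: "\<And>\<psi> \<Psi>. bounded_torus_gradient 1 \<psi> \<Psi> \<Longrightarrow> \<bar>energy 1 ?A \<Psi>\<bar> \<le> (\<eta> * ?n) * sqrt (energy 1 \<Psi> \<Psi>)"
    and g\<Phi>: "bounded_torus_gradient 1 \<phi> \<Phi>"
    using ac by (auto simp: approximate_corrector_def)
  have s0: "\<eta> * ?n \<ge> 0" using \<eta> by simp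
  note A1 = corrector_square_integrable[OF ac order_refl]
  note A = corrector_square_integrable[OF ac k]
  have sG: "square_integrable (torus m) ?G" if "m \<ge> 1" for m
    by (rule bounded_imp_square_integrable[OF that]) auto
  have s\<Psi>: "square_integrable (torus k) \<Psi>" using g by (simp add: L2_torus_gradient_def)
  have J: "energy k ?A ?A = energy 1 ?A ?A"
    unfolding energy_def
    using periodic_b A(7) by (intro integral_torus_1[OF k] measurable_b_comp A) (simp add: periodic_def)
  have J\<Phi>: "energy k ?A \<Phi> = energy 1 ?A \<Phi>"
    unfolding energy_def
    using periodic_b A(3,7) by (intro integral_torus_1[OF k] measurable_b_comp A) (simp add: periodic_def)
  have 1: "\<bar>energy k ?A \<Psi>\<bar> \<le> \<eta> * sqrt (c * S) * ?n\<^sup>2"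
  proof -
    have "\<bar>energy k ?A \<Psi>\<bar> \<le> (\<eta> * ?n) * sqrt (c * (\<integral>x. (norm (\<Psi> x))\<^sup>2 \<partial>torus k))"
      by (rule stationarity_limit(1)[OF k A(6,7,8) st s0 g])
    also have "\<dots> \<le> (\<eta> * ?n) * sqrt (c * (S * ?n\<^sup>2))"
      using S c_pos by (intro mult_left_mono real_sqrt_le_mono s0) auto
    also have "sqrt (c * (S * ?n\<^sup>2)) = sqrt (c * S) * ?n" by (simp add: real_sqrt_mult mult.assoc[symmetric])
    finally show ?thesis by (simp add: power2_eq_square mult_ac)
  qed
  have 2: "\<bar>energy 1 ?A \<Phi>\<bar> \<le> \<eta> * sqrt (4 * c + 2) * ?n\<^sup>2"
  proof -
    have mG: "?G \<in> borel_measurable borel" "(\<lambda>x. - 1 *\<^sub>R G) \<in> borel_measurable borel" by auto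
    have sG': "square_integrable (torus 1) (\<lambda>x :: real^'n. - 1 *\<^sub>R G)"
      by (rule square_integrable_scaleR[OF sG[OF order_refl]])
    have e1: "energy 1 (\<lambda>x. ?A x + - 1 *\<^sub>R G) (\<lambda>x. ?A x + - 1 *\<^sub>R G) = energy 1 ?A ?A - 2 * energy 1 ?A ?G + energy 1 ?G ?G"
      using energy_square_add[OF A1(5,6) sG' mG(2)] energy_scaleR_left[of 1 "-1" ?G] energy_scaleR_right[of 1 _ "-1" ?G] by simp
    have e2: "energy 1 (\<lambda>x. ?A x + G) (\<lambda>x. ?A x + G) = energy 1 ?A ?A + 2 * energy 1 ?A ?G + energy 1 ?G ?G"
      by (rule energy_square_add[OF A1(5,6) sG[OF order_refl] mG(1)])
    have "energy 1 \<Phi> \<Phi> \<le> 2 * energy 1 ?A ?A + 2 * energy 1 ?G ?G"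
      using e1 e2 energy_nonneg[of 1 "\<lambda>x. ?A x + G"] by simp
    also have "\<dots> \<le> 2 * ((c + 1) * ?n\<^sup>2) + 2 * (c * ?n\<^sup>2)"
      using corrector_energy_bound[OF ac \<eta>] energy_const_le[of G] by linarith
    finally have "energy 1 \<Phi> \<Phi> \<le> (4 * c + 2) * ?n\<^sup>2" by (simp add: algebra_simps)
    then have "sqrt (energy 1 \<Phi> \<Phi>) \<le> sqrt ((4 * c + 2) * ?n\<^sup>2)" by (rule real_sqrt_le_mono)
    then have "sqrt (energy 1 \<Phi> \<Phi>) \<le> sqrt (4 * c + 2) * ?n" by (simp add: real_sqrt_mult)
    then have "(\<eta> * ?n) * sqrt (energy 1 \<Phi> \<Phi>) \<le> (\<eta> * ?n) * (sqrt (4 * c + 2) * ?n)" by (intro mult_left_mono s0)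
    with st[OF g\<Phi>] show ?thesis by (simp add: power2_eq_square mult_ac)
  qed
  have "energy k ?A ?A = energy k ?A ?G + energy k ?A \<Phi>"
    by (rule energy_add_right[OF sG[OF k] A(1) A(5)])
  moreover have "energy k ?A (\<lambda>x. G + \<Psi> x) = energy k ?A ?G + energy k ?A \<Psi>"
    by (rule energy_add_right[OF sG[OF k] s\<Psi> A(5)])
  ultimately have "energy k ?A (\<lambda>x. G + \<Psi> x) = energy 1 ?A ?A - energy 1 ?A \<Phi> + energy k ?A \<Psi>"
    using J J\<Phi> by simp
  then show ?thesis using 1 2 by (simp add: algebra_simps abs_le_iff)
qed

text \<open>
  Convexity bounds the quadratic form at a competitor \<open>X\<close> from below by its tangent at the approximate corrector
  \<open>A\<close>. The resulting bound \<open>h\<close> is below \<open>W\<close> almost everywhere: by the expansion if \<open>norm X \<le> d\<close>, and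
  otherwise since \<open>2 * b A X\<close> is at most \<open>2 * c * L * norm G * norm X\<close> and \<open>norm X \<le> (norm X)\<^sup>2 / d\<close>,
  so that \<open>h\<close> is not positive. Rigidity bounds the mean of the quadratic error, and \<open>corrector_cross_energy\<close>
  the mean of the tangent.
\<close>

lemma multi_cell_lower_bound:
  fixes W :: "real^'n \<Rightarrow> real^'n^'n \<Rightarrow> real"
  assumes a: "a > 0" and W0: "\<And>x F. W x F \<ge> 0"
    and nd: "AE x in lborel. \<forall>F. 1 / a * (infdist F SO)\<^sup>2 \<le> W x F"
    and W: "AE x in lborel. \<forall>A. norm A \<le> d \<longrightarrow> b x A A - \<epsilon> * (norm A)\<^sup>2 \<le> W x (mat 1 + A)"
    and d: "d > 0" and \<epsilon>: "\<epsilon> \<ge> 0" and L: "L > 0"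
    and C: "C > 0" "\<And>A :: real^'n^'n. (norm A)\<^sup>2 \<le> C * (minor_form A A + C * (infdist (mat 1 + A) SO)\<^sup>2)"
    and K0: "K \<ge> 0" and K: "\<And>A :: real^'n^'n. minor_form A A \<le> K * (norm A)\<^sup>2"
    and ac: "approximate_corrector \<eta> L G \<phi> \<Phi>" and \<eta>: "0 \<le> \<eta>" "\<eta> \<le> 1"
    and C1: "C1 = C * (K + C * a * (c + 1))"
    and \<kappa>: "\<kappa> = \<epsilon> + 2 * c * L * norm G / d"
  shows "ennreal (energy 1 (\<lambda>x. G + \<Phi> x) (\<lambda>x. G + \<Phi> x)
      - (2 * \<eta> * (sqrt (4 * c + 2) + sqrt (c * (2 * C1 + 2))) + \<kappa> * C1) * (norm G)\<^sup>2)
    \<le> multi_cell_hom p W (mat 1 + G)"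
  unfolding multi_cell_hom_def cell_inf_def
proof (intro INF_greatest Inf_greatest, clarify)
  fix k :: nat and \<psi> :: "real^'n \<Rightarrow> real^'n" and \<Psi> :: "real^'n \<Rightarrow> real^'n^'n"
  assume k: "1 \<le> k" and \<psi>: "\<psi> \<in> W1p_per p k" and wg: "has_weak_gradient \<psi> \<Psi>"
  let ?A = "\<lambda>x. G + \<Phi> x"
  let ?J = "energy 1 ?A ?A"
  let ?D = "sqrt (4 * c + 2) + sqrt (c * (2 * C1 + 2))"
  let ?n = "norm G"
  define v where "v = (\<integral>\<^sup>+y\<in>cell k. ennreal (W y (mat 1 + G + \<Psi> y)) \<partial>lebesgue) / ennreal (real k ^ CARD('n))"
  have \<kappa>0: "\<kappa> \<ge> 0" unfolding \<kappa> using \<epsilon> c_pos L d by simp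
  show "ennreal (?J - (2 * \<eta> * ?D + \<kappa> * C1) * ?n\<^sup>2) \<le> (\<integral>\<^sup>+y\<in>cell k. ennreal (W y (mat 1 + G + \<Psi> y)) \<partial>lebesgue) / ennreal (real k ^ CARD('n))"
    unfolding v_def[symmetric]
    \<comment> \<open>A competitor whose mean energy is at least \<open>?J\<close> satisfies the bound trivially, so rigidity is needed for energies of order
      \<open>(norm G)\<^sup>2\<close> only.\<close>
  proof (cases "v < ennreal ?J")
    case False
    have "0 \<le> K" by (rule K0)
    then have "C1 \<ge> 0" unfolding C1 using C(1) a c_pos by (intro mult_nonneg_nonneg add_nonneg_nonneg) auto
    then have "0 \<le> (2 * \<eta> * ?D + \<kappa> * C1) * ?n\<^sup>2"
      using \<eta> \<kappa>0 c_pos by (intro mult_nonneg_nonneg add_nonneg_nonneg) auto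
    then have "ennreal (?J - (2 * \<eta> * ?D + \<kappa> * C1) * ?n\<^sup>2) \<le> ennreal ?J" by (intro ennreal_leI) simp
    then show "ennreal (?J - (2 * \<eta> * ?D + \<kappa> * C1) * ?n\<^sup>2) \<le> v" using False by simp
  next
    case True
    then have "v \<noteq> top" by auto
    then obtain e where e: "v = ennreal e" "e \<ge> 0" by (cases v) auto
    have eJ: "e \<le> ?J" using True e energy_nonneg[of 1 ?A] by (simp add: ennreal_less_iff)
    then have eG: "e \<le> (c + 1) * ?n\<^sup>2" using corrector_energy_bound[OF ac \<eta>] by linarith
    have "cell_periodic k \<psi>" using \<psi> by (simp add: W1p_per_def)
    from periodic_weak_gradient_representatives[OF wg this k]
    obtain \<psi>' \<Psi>' where r: "\<psi>' \<in> borel_measurable borel" "\<Psi>' \<in> borel_measurable borel" "periodic k \<psi>'" "periodic k \<Psi>'"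
      "has_weak_gradient \<psi>' \<Psi>'" "AE x in lborel. \<psi> x = \<psi>' x" "AE x in lborel. \<Psi> x = \<Psi>' x" by blast
    note [measurable] = r(2)
    let ?X = "\<lambda>x. G + \<Psi>' x"
    have mX: "?X \<in> borel_measurable borel" by measurable
    have mi: "(\<lambda>x. 1 / a * (infdist (mat 1 + ?X x) SO)\<^sup>2) \<in> borel_measurable borel"
    proof -
      have "(\<lambda>F :: real^'n^'n. infdist F SO) \<in> borel_measurable borel"
        by (intro borel_measurable_continuous_onI continuous_on_infdist continuous_on_id)
      then have "(\<lambda>x. infdist (mat 1 + ?X x) SO) \<in> borel_measurable borel"
        by (rule measurable_compose[rotated]) measurable
      then show ?thesis by measurable
    qed
    have "(\<integral>\<^sup>+x. ennreal (1 / a * (infdist (mat 1 + ?X x) SO)\<^sup>2) \<partial>torus k) \<le> v"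
      unfolding v_def
    proof (rule cell_average_mono_torus(2)[OF mi])
      show "AE x in lborel. 1 / a * (infdist (mat 1 + ?X x) SO)\<^sup>2 \<le> W x (mat 1 + G + \<Psi> x)"
        using nd r(7) by eventually_elim (simp add: add.assoc)
    qed
    note rig = periodic_rigidity[OF k a r(1,2,3,4,5) C e(2) this[unfolded e(1)]]
    have g: "L2_torus_gradient k \<psi>' \<Psi>'" using r rig(1) by (simp add: L2_torus_gradient_def)
    have sX: "square_integrable (torus k) ?X" by (rule square_integrable_shift[OF k rig(1)])
    have S: "(\<integral>x. (norm (?X x))\<^sup>2 \<partial>torus k) \<le> C1 * ?n\<^sup>2"
    proof -
      have "C * (minor_form G G + C * a * e) \<le> C * (K * ?n\<^sup>2 + C * a * ((c + 1) * ?n\<^sup>2))"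
        using C(1) a eG K[of G] by (intro mult_left_mono add_mono) auto
      also have "\<dots> = C1 * ?n\<^sup>2" by (simp add: C1 algebra_simps)
      finally show ?thesis using rig(2) by linarith
    qed
    have S\<Psi>: "(\<integral>x. (norm (\<Psi>' x))\<^sup>2 \<partial>torus k) \<le> (2 * C1 + 2) * ?n\<^sup>2"
    proof -
      interpret prob_space "torus k :: (real^'n) measure" by (rule prob_space_torus[OF k])
      have iX: "integrable (torus k) (\<lambda>x. (norm (?X x))\<^sup>2)" using sX by (simp add: square_integrable_def)
      have "(norm (\<Psi>' x))\<^sup>2 \<le> 2 * (norm (?X x))\<^sup>2 + 2 * ?n\<^sup>2" for x
        using norm_add_square_le[of "?X x" "- G"] by simp
      then have "(\<integral>x. (norm (\<Psi>' x))\<^sup>2 \<partial>torus k) \<le> (\<integral>x. 2 * (norm (?X x))\<^sup>2 + 2 * ?n\<^sup>2 \<partial>torus k)"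
        using rig(1) iX by (intro integral_mono) (auto simp: square_integrable_def)
      also have "\<dots> = 2 * (\<integral>x. (norm (?X x))\<^sup>2 \<partial>torus k) + 2 * ?n\<^sup>2"
        using iX prob_space by simp
      finally show ?thesis using S by (simp add: algebra_simps)
    qed
    have cross: "?J - \<eta> * ?D * ?n\<^sup>2 \<le> energy k ?A ?X"
      by (rule corrector_cross_energy[OF ac \<eta> k g S\<Psi>])
    note A = corrector_square_integrable[OF ac k]
    define h where "h x = 2 * b x (?A x) (?X x) - b x (?A x) (?A x) - \<kappa> * (norm (?X x))\<^sup>2" for x
    have mh: "h \<in> borel_measurable borel"
      unfolding h_def by (intro borel_measurable_diff borel_measurable_times borel_measurable_const measurable_b_comp A mX borel_measurable_power measurable_compose[OF mX borel_measurable_norm])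
    have nX: "norm (?A x) \<le> L * ?n" for x using ac by (simp add: approximate_corrector_def)
    have "AE x in lborel. h x \<le> W x (mat 1 + G + \<Psi> x)"
      using W r(7) bound_b sym_b nonneg_b
    proof eventually_elim
      case (elim x)
      let ?a = "?A x" and ?x = "?X x"
      note bl = bilinear_b[of x]
      have conv: "2 * b x ?a ?x - b x ?a ?a \<le> b x ?x ?x"
      proof -
        have "0 \<le> b x (?x - ?a) (?x - ?a)" using elim by blast
        moreover have "b x ?x ?a = b x ?a ?x" using elim by blast
        ultimately show ?thesis by (simp only: bilinear_lsub[OF bl] bilinear_rsub[OF bl])
      qed
      have WX: "W x (mat 1 + G + \<Psi> x) = W x (mat 1 + ?x)" using elim by (simp add: add.assoc)
      show ?case
      proof (cases "norm ?x \<le> d")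
        case True
        then have "b x ?x ?x - \<epsilon> * (norm ?x)\<^sup>2 \<le> W x (mat 1 + ?x)" using elim by blast
        moreover have "\<epsilon> * (norm ?x)\<^sup>2 \<le> \<kappa> * (norm ?x)\<^sup>2"
          unfolding \<kappa> using c_pos L d by (intro mult_right_mono) auto
        ultimately show ?thesis using conv unfolding h_def WX by linarith
      next
        case False
        then have dx: "d \<le> norm ?x" by simp
        have "b x ?a ?x \<le> c * norm ?a * norm ?x" using elim(3) by (metis abs_le_D1)
        also have "\<dots> \<le> c * (L * ?n) * norm ?x"
          using c_pos nX by (intro mult_right_mono mult_left_mono) auto
        also have "\<dots> \<le> c * (L * ?n) * ((norm ?x)\<^sup>2 / d)"
        proof (intro mult_left_mono)
          show "norm ?x \<le> (norm ?x)\<^sup>2 / d"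
            using dx d mult_right_mono[OF dx, of "norm ?x"] by (simp add: pos_le_divide_eq power2_eq_square mult.commute)
          show "0 \<le> c * (L * ?n)" using c_pos L by simp
        qed
        finally have "2 * b x ?a ?x \<le> 2 * (c * (L * ?n) * ((norm ?x)\<^sup>2 / d))" by linarith
        then have "2 * b x ?a ?x \<le> (2 * c * L * ?n / d) * (norm ?x)\<^sup>2" by (simp add: mult_ac)
        also have "\<dots> \<le> \<kappa> * (norm ?x)\<^sup>2" unfolding \<kappa> using \<epsilon> by (intro mult_right_mono) auto
        finally have "2 * b x ?a ?x \<le> \<kappa> * (norm ?x)\<^sup>2" .
        moreover have "0 \<le> b x ?a ?a" using elim by blast
        ultimately have "h x \<le> 0" by (simp add: h_def)
        then show ?thesis using W0 order_trans by blast
      qed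
    qed
    from cell_average_mono_torus(2)[OF mh this, of k]
    have hv: "(\<integral>\<^sup>+x. ennreal (h x) \<partial>torus k) \<le> v" by (simp add: v_def)
    have i: "integrable (torus k) (\<lambda>x. b x (?A x) (?X x))" "integrable (torus k) (\<lambda>x. b x (?A x) (?A x))" "integrable (torus k) (\<lambda>x. (norm (?X x))\<^sup>2)"
      using energy_integrable[OF A(5) sX] energy_integrable[OF A(5,5)] sX by (auto simp: square_integrable_def)
    have ih: "integrable (torus k) h" unfolding h_def[abs_def] using i by simp
    have J: "energy k ?A ?A = ?J"
      unfolding energy_def
      using periodic_b A(7) by (intro integral_torus_1[OF k] measurable_b_comp A) (simp add: periodic_def)
    have "(\<integral>x. h x \<partial>torus k) = 2 * energy k ?A ?X - energy k ?A ?A - \<kappa> * (\<integral>x. (norm (?X x))\<^sup>2 \<partial>torus k)"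
      unfolding h_def[abs_def] energy_def using i by simp
    moreover have "\<kappa> * (\<integral>x. (norm (?X x))\<^sup>2 \<partial>torus k) \<le> \<kappa> * (C1 * ?n\<^sup>2)" by (rule mult_left_mono[OF S \<kappa>0])
    ultimately have "?J - (2 * \<eta> * ?D + \<kappa> * C1) * ?n\<^sup>2 \<le> (\<integral>x. h x \<partial>torus k)"
      using cross unfolding J by (simp add: algebra_simps)
    then have "ennreal (?J - (2 * \<eta> * ?D + \<kappa> * C1) * ?n\<^sup>2) \<le> ennreal (\<integral>x. h x \<partial>torus k)" by (rule ennreal_leI)
    also have "\<dots> \<le> (\<integral>\<^sup>+x. ennreal (h x) \<partial>torus k)" by (rule ennreal_integral_le[OF ih])
    finally show "ennreal (?J - (2 * \<eta> * ?D + \<kappa> * C1) * ?n\<^sup>2) \<le> v" using hv by (rule order_trans)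
  qed
qed

end

section \<open>The expansion of the homogenized energy\<close>

lemma abs_enn2ereal_diff_le:
  fixes x y :: ennreal
  assumes "ennreal l \<le> x" "x \<le> ennreal u" "ennreal l' \<le> y" "y \<le> ennreal u'"
    and "u - l' \<le> e" "u' - l \<le> e" "e \<ge> 0" "u \<ge> 0" "u' \<ge> 0"
  shows "\<bar>enn2ereal x - enn2ereal y\<bar> \<le> ereal e"
proof -
  obtain r where r: "x = ennreal r" "r \<ge> 0" using assms(2) by (cases x) (auto simp: top_unique)
  obtain s where s: "y = ennreal s" "s \<ge> 0" using assms(4) by (cases y) (auto simp: top_unique)
  have "l \<le> r" "r \<le> u" "l' \<le> s" "s \<le> u'"
    using assms r s by (auto simp: ennreal_le_iff2)
  then show ?thesis using assms(5,6) r s by (simp add: enn2ereal_ennreal abs_le_iff)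
qed

text \<open>
  The errors of the upper and the lower bounds are made smaller than \<open>\<epsilon>0 * (norm G)\<^sup>2\<close>. The order of choices
  matters: the rigidity constants come first, then \<open>\<eta>\<close>, which determines the bound \<open>L\<close> of the correctors, then
  \<open>\<epsilon>\<close>, which determines the radius \<open>d\<close> of the expansion, and finally the smallness of \<open>G\<close>.
\<close>

lemma (in periodic_form) homogenized_difference_le:
  fixes W Q :: "real^'n \<Rightarrow> real^'n^'n \<Rightarrow> real"
  assumes a: "a > 0" and p: "p > 0" and W: "W \<in> class_W0 a" and Q: "Q \<in> quadratic_integrands"
    and ex: "quadratic_expansion W Q" and Qb: "AE x in lborel. \<forall>G. Q x G = b x G G"
    and \<epsilon>0: "\<epsilon>0 > 0"
  shows "\<exists>\<delta>>0. \<forall>G. 0 < norm G \<and> norm G < \<delta> \<longrightarrow>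
    \<bar>enn2ereal (multi_cell_hom p W (mat 1 + G)) - enn2ereal (one_cell_hom Q G)\<bar> \<le> ereal (\<epsilon>0 * (norm G)\<^sup>2)"
proof -
  obtain C where C: "C > 0" "\<And>A :: real^'n^'n. (norm A)\<^sup>2 \<le> C * (minor_form A A + C * (infdist (mat 1 + A) SO)\<^sup>2)"
    by (rule norm_sq_le_minor_form_infdist, erule that)
  obtain K where K: "K > 0" "\<And>X Y :: real^'n^'n. \<bar>minor_form X Y\<bar> \<le> K * norm X * norm Y"
    using bilinear_bounded_pos[OF bilinear_minor_form] by (auto simp: mult_ac)
  have KA: "minor_form A A \<le> K * (norm A)\<^sup>2" for A :: "real^'n^'n"
    using K(2)[of A A] by (simp add: power2_eq_square mult.assoc abs_le_iff)
  define C1 where "C1 = C * (K + C * a * (c + 1))"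
  define D where "D = sqrt (4 * c + 2) + sqrt (c * (2 * C1 + 2))"
  have C1: "C1 \<ge> 0" unfolding C1_def using C(1) K(1) a c_pos by simp
  have D: "D \<ge> 0" unfolding D_def using C1 c_pos by simp
  \<comment> \<open>Both \<open>\<eta>\<^sup>2\<close> and \<open>2 * \<eta> * D\<close> are at most \<open>\<epsilon>0 / 2\<close>.\<close>
  define \<eta> where "\<eta> = min 1 (\<epsilon>0 / (4 * D + 2))"
  have \<eta>: "\<eta> > 0" "\<eta> \<le> 1" "\<eta> * (4 * D + 2) \<le> \<epsilon>0"
    using D \<epsilon>0 pos_le_divide_eq[of "4 * D + 2" \<eta> \<epsilon>0] by (simp_all add: \<eta>_def)
  have \<eta>2: "\<eta>\<^sup>2 \<le> \<eta>" using \<eta> by (simp add: power2_eq_square mult_left_le)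
  have e\<eta>: "\<eta>\<^sup>2 \<le> \<epsilon>0 / 2" "2 * \<eta> * D \<le> \<epsilon>0 / 2"
  proof -
    have "0 \<le> \<eta> * D" using \<eta> D by simp
    moreover have "4 * (\<eta> * D) + 2 * \<eta> \<le> \<epsilon>0" using \<eta>(3) by (simp add: algebra_simps)
    ultimately show "\<eta>\<^sup>2 \<le> \<epsilon>0 / 2" "2 * \<eta> * D \<le> \<epsilon>0 / 2" using \<eta>2 \<eta>(1) by (simp_all add: mult.assoc)
  qed
  obtain \<phi> \<Phi> L where L: "L > 0" and ac: "\<And>G. approximate_corrector \<eta> L G (\<phi> G) (\<Phi> G)"
    using approximate_correctors[OF \<eta>(1)] by blast
  define \<epsilon> where "\<epsilon> = \<epsilon>0 / (4 * (L\<^sup>2 + C1 + 1))"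
  have den: "4 * (L\<^sup>2 + C1 + 1) > 0" using C1 by (simp add: add_nonneg_pos)
  have \<epsilon>: "\<epsilon> > 0" using \<epsilon>0 den by (simp add: \<epsilon>_def)
  have \<epsilon>e: "\<epsilon> * (L\<^sup>2 + C1 + 1) = \<epsilon>0 / 4" using den by (simp add: \<epsilon>_def field_simps)
  have \<epsilon>L: "\<epsilon> * L\<^sup>2 \<le> \<epsilon>0 / 4" "\<epsilon> * C1 \<le> \<epsilon>0 / 4"
  proof -
    have "\<epsilon> * L\<^sup>2 + \<epsilon> * C1 + \<epsilon> = \<epsilon>0 / 4" using \<epsilon>e by (simp add: algebra_simps)
    moreover have "0 \<le> \<epsilon> * L\<^sup>2" "0 \<le> \<epsilon> * C1" using \<epsilon> C1 by simp_all
    ultimately show "\<epsilon> * L\<^sup>2 \<le> \<epsilon>0 / 4" "\<epsilon> * C1 \<le> \<epsilon>0 / 4" using \<epsilon> by linarith+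
  qed
  obtain d where d: "d > 0" and dW: "AE x in lborel. \<forall>A. norm A \<le> d \<longrightarrow> \<bar>W x (mat 1 + A) - Q x A\<bar> \<le> \<epsilon> * (norm A)\<^sup>2"
    using expansion_AE[OF W Q ex \<epsilon>] by blast
  have Wu: "AE x in lborel. \<forall>A. norm A \<le> d \<longrightarrow> W x (mat 1 + A) \<le> b x A A + \<epsilon> * (norm A)\<^sup>2"
    using dW Qb
  proof eventually_elim
    case (elim x)
    show ?case
    proof (intro allI impI)
      fix A :: "real^'n^'n" assume "norm A \<le> d"
      then have "\<bar>W x (mat 1 + A) - b x A A\<bar> \<le> \<epsilon> * (norm A)\<^sup>2" using elim by metis
      then show "W x (mat 1 + A) \<le> b x A A + \<epsilon> * (norm A)\<^sup>2" by linarith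
    qed
  qed
  have Wl: "AE x in lborel. \<forall>A. norm A \<le> d \<longrightarrow> b x A A - \<epsilon> * (norm A)\<^sup>2 \<le> W x (mat 1 + A)"
    using dW Qb
  proof eventually_elim
    case (elim x)
    show ?case
    proof (intro allI impI)
      fix A :: "real^'n^'n" assume "norm A \<le> d"
      then have "\<bar>W x (mat 1 + A) - b x A A\<bar> \<le> \<epsilon> * (norm A)\<^sup>2" using elim by metis
      then show "b x A A - \<epsilon> * (norm A)\<^sup>2 \<le> W x (mat 1 + A)" by linarith
    qed
  qed
  \<comment> \<open>The first bound keeps the correctors in the ball of radius \<open>d\<close>, the second one makes the contribution of large
    gradients to \<open>\<kappa> * C1\<close> at most \<open>\<epsilon>0 / 4\<close>.\<close>
  define \<delta> where "\<delta> = min (d / L) (\<epsilon>0 * d / (8 * c * L * (C1 + 1)))"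
  have den2: "8 * c * L * (C1 + 1) > 0" using c_pos L C1 by (simp add: add_nonneg_pos)
  have \<delta>: "\<delta> > 0" unfolding \<delta>_def using d L \<epsilon>0 den2 by simp
  have W0: "W x F \<ge> 0" for x F using W by (simp add: class_W0_def periodic_caratheodory_def)
  have "\<bar>enn2ereal (multi_cell_hom p W (mat 1 + G)) - enn2ereal (one_cell_hom Q G)\<bar> \<le> ereal (\<epsilon>0 * (norm G)\<^sup>2)"
    if G: "norm G < \<delta>" for G
  proof -
    let ?n = "norm G"
    define J where "J = energy 1 (\<lambda>x. G + \<Phi> G x) (\<lambda>x. G + \<Phi> G x)"
    have J0: "J \<ge> 0" unfolding J_def by (rule energy_nonneg)
    define \<kappa> where "\<kappa> = \<epsilon> + 2 * c * L * ?n / d"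
    have LG: "L * ?n \<le> d" using G L by (simp add: \<delta>_def pos_less_divide_eq mult.commute)
    have "?n * (8 * c * L * (C1 + 1)) \<le> \<epsilon>0 * d"
      using G den2 by (simp add: \<delta>_def pos_less_divide_eq)
    then have k1: "(2 * c * L * ?n / d) * (C1 + 1) \<le> \<epsilon>0 / 4" using d by (simp add: field_simps)
    have k2: "0 \<le> 2 * c * L * ?n / d" using c_pos L d by simp
    have k3: "\<kappa> * C1 \<le> \<epsilon>0 / 2"
    proof -
      have "(2 * c * L * ?n / d) * C1 \<le> (2 * c * L * ?n / d) * (C1 + 1)" using k2 by (intro mult_left_mono) auto
      moreover have "\<kappa> * C1 = \<epsilon> * C1 + (2 * c * L * ?n / d) * C1" unfolding \<kappa>_def by (rule distrib_right)
      ultimately show ?thesis using k1 \<epsilon>L(2) by linarith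
    qed
    have up: "multi_cell_hom p W (mat 1 + G) \<le> ennreal (J + \<epsilon> * L\<^sup>2 * ?n\<^sup>2)"
      unfolding J_def by (rule multi_cell_upper_bound[OF p Wu ac LG less_imp_le[OF \<epsilon>]])
    have lo: "ennreal (J - (2 * \<eta> * D + \<kappa> * C1) * ?n\<^sup>2) \<le> multi_cell_hom p W (mat 1 + G)"
      unfolding J_def D_def
      by (rule multi_cell_lower_bound[OF a W0 nondegenerate_AE[OF W] Wl d less_imp_le[OF \<epsilon>] L C less_imp_le[OF K(1)] KA ac
          less_imp_le[OF \<eta>(1)] \<eta>(2) C1_def \<kappa>_def])
    note one = one_cell_bounds[OF Qb ac less_imp_le[OF \<eta>(1)], of G, folded J_def]
    have le: "r * ?n\<^sup>2 \<le> \<epsilon>0 * ?n\<^sup>2" if "r \<le> \<epsilon>0" for r using that by (rule mult_right_mono) simp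
    show ?thesis
    proof (rule abs_enn2ereal_diff_le[OF lo up one(2,1)])
      show "J + \<epsilon> * L\<^sup>2 * ?n\<^sup>2 - (J - \<eta>\<^sup>2 * ?n\<^sup>2) \<le> \<epsilon>0 * ?n\<^sup>2"
        using le[of "\<epsilon> * L\<^sup>2 + \<eta>\<^sup>2"] \<epsilon>L(1) e\<eta>(1) \<epsilon>0 by (simp add: distrib_right)
      show "J - (J - (2 * \<eta> * D + \<kappa> * C1) * ?n\<^sup>2) \<le> \<epsilon>0 * ?n\<^sup>2"
        using le[of "2 * \<eta> * D + \<kappa> * C1"] k3 e\<eta>(2) by simp
    qed (use \<epsilon>0 \<epsilon> J0 in simp_all)
  qed
  then show ?thesis using \<delta> by blast
qed

lemma Limsup_homogenized_difference:
  fixes W Q :: "real^'n \<Rightarrow> real^'n^'n \<Rightarrow> real"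
  assumes a: "a > 0" and p: "p > 0" and W: "W \<in> class_W0 a" and Q: "Q \<in> quadratic_integrands"
    and ex: "quadratic_expansion W Q"
  shows "Limsup (at 0) (\<lambda>G. \<bar>enn2ereal (multi_cell_hom p W (mat 1 + G)) -
                enn2ereal (one_cell_hom Q G)\<bar> / ereal ((norm G)\<^sup>2)) = 0"
proof -
  let ?f = "\<lambda>G. \<bar>enn2ereal (multi_cell_hom p W (mat 1 + G)) - enn2ereal (one_cell_hom Q G)\<bar> / ereal ((norm G)\<^sup>2)"
  obtain b c where "periodic_form b c" and Qb: "AE x in lborel. \<forall>G. Q x G = b x G G"
    using quadratic_integrand_form[OF Q] by blast
  interpret periodic_form b c by fact
  have "Limsup (at 0) ?f \<le> ereal e" if e: "e > 0" for e
  proof (rule Limsup_bounded)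
    obtain \<delta> where \<delta>: "\<delta> > 0" "\<forall>G. 0 < norm G \<and> norm G < \<delta> \<longrightarrow>
      \<bar>enn2ereal (multi_cell_hom p W (mat 1 + G)) - enn2ereal (one_cell_hom Q G)\<bar> \<le> ereal (e * (norm G)\<^sup>2)"
      using homogenized_difference_le[OF a p W Q ex Qb e] by (elim exE conjE)
    show "\<forall>\<^sub>F G in at 0. ?f G \<le> ereal e"
      unfolding eventually_at
    proof (intro exI conjI ballI impI)
      fix G :: "real^'n^'n" assume G: "G \<noteq> 0 \<and> dist G 0 < \<delta>"
      then have "\<bar>enn2ereal (multi_cell_hom p W (mat 1 + G)) - enn2ereal (one_cell_hom Q G)\<bar> \<le> ereal (e * (norm G)\<^sup>2)"
        using \<delta>(2) by simp
      then show "?f G \<le> ereal e" using G by (subst ereal_divide_le_pos) (simp_all add: mult.commute)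
    qed (rule \<delta>(1))
  qed
  then have "Limsup (at 0) ?f \<le> 0" by (rule ereal_le_epsilon2[where y = 0, unfolded add_0])
  moreover have "0 \<le> Limsup (at 0) ?f"
    by (rule le_Limsup) simp_all
  ultimately show ?thesis by (rule antisym)
qed

theorem theorem1p1:
  fixes a p :: real
  assumes "CARD('n::finite) \<ge> 2" and "a > 0" and "p > 1"
  shows "(\<forall>(W :: real^'n \<Rightarrow> real^'n^'n \<Rightarrow> real) Q.
            W \<in> class_W a p \<longrightarrow> Q \<in> quadratic_integrands \<longrightarrow> quadratic_expansion W Q \<longrightarrow>
            Limsup (at 0) (\<lambda>G. \<bar>enn2ereal (multi_cell_hom p W (mat 1 + G)) -
                enn2ereal (one_cell_hom Q G)\<bar> / ereal ((norm G)\<^sup>2)) = 0) \<and>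
         (\<forall>(W :: real^'n \<Rightarrow> real^'n^'n \<Rightarrow> real) Q.
            W \<in> class_W0 a \<longrightarrow> Q \<in> quadratic_integrands \<longrightarrow> quadratic_expansion W Q \<longrightarrow>
            Limsup (at 0) (\<lambda>G. \<bar>enn2ereal (multi_cell_hom p W (mat 1 + G)) -
                enn2ereal (one_cell_hom Q G)\<bar> / ereal ((norm G)\<^sup>2)) = 0)"
proof (intro conjI allI impI)
  fix W Q :: "real^'n \<Rightarrow> real^'n^'n \<Rightarrow> real"
  assume "W \<in> class_W a p" "Q \<in> quadratic_integrands" "quadratic_expansion W Q"
  then show "Limsup (at 0) (\<lambda>G. \<bar>enn2ereal (multi_cell_hom p W (mat 1 + G)) -
                enn2ereal (one_cell_hom Q G)\<bar> / ereal ((norm G)\<^sup>2)) = 0"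
    using assms by (intro Limsup_homogenized_difference[where a = a]) (auto simp: class_W_def)
qed (use assms in \<open>auto intro: Limsup_homogenized_difference\<close>)

end
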